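(* Let $\mathrm{cr}_{S^2}(K_n)$ denote the spherical geodesic crossing number of $K_n$, and let $H(n) := \frac{1}{4}\lfloor \frac{n}{2}\rfloor\lfloor \frac{n-1}{2}\rfloor\lfloor \frac{n-2}{2}\rfloor\lfloor \frac{n-3}{2}\rfloor$. Then \[ \lim_{n\to\infty} \frac{\mathrm{cr}_{S^2}(K_n)}{H(n)} > 0.99635588. \]
   Context: A spherical geodesic drawing of a graph places the vertices as points on the sphere and draws each edge as a minimum-distance geodesic arc joining its endpoints. The spherical geodesic crossing number $\mathrm{cr}_{S^2}(G)$ is the minimum number of crossings over all spherical geodesic drawings of $G$. *)

theory Defs
  imports "HOL-Analysis.Analysis"
begin

definition sphere_dist :: "real ^ 3 \<Rightarrow> real ^ 3 \<Rightarrow> real" where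
  "sphere_dist x y = arccos (x \<bullet> y)"

text \<open>A minimum-distance geodesic arc is the image of an isometric embedding of an interval
  into the sphere with its angular metric. It is determined by \<open>x\<close> and \<open>y\<close> unless these are
  antipodal, in which case every great semicircle joining them qualifies.\<close>

definition min_geodesic_arc :: "real ^ 3 \<Rightarrow> real ^ 3 \<Rightarrow> (real ^ 3) set \<Rightarrow> bool" where
  "min_geodesic_arc x y A \<longleftrightarrow>
    (\<exists>g :: real \<Rightarrow> real ^ 3.
       g 0 = x \<and> g (sphere_dist x y) = y \<and>
       g ` {0..sphere_dist x y} \<subseteq> sphere 0 1 \<and>
       (\<forall>s \<in> {0..sphere_dist x y}. \<forall>t \<in> {0..sphere_dist x y}.
          sphere_dist (g s) (g t) = \<bar>s - t\<bar>) \<and>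
       A = g ` {0..sphere_dist x y})"

text \<open>A simple graph is given by a vertex set \<open>V\<close> and a set \<open>E\<close> of two-element subsets of \<open>V\<close>.
  A drawing consists of the vertex positions \<open>p\<close> and the arcs \<open>a\<close>; the arcs are part of the
  data because of antipodal vertices. As usual for drawings, distinct vertices have distinct
  positions and no edge passes through a vertex other than its ends. For geodesic arcs this
  already implies that distinct edges do not overlap in an arc, so that every common interior
  point of two edges is a proper crossing.\<close>

definition spherical_geodesic_drawing ::
  "'v set \<Rightarrow> 'v set set \<Rightarrow> ('v \<Rightarrow> real ^ 3) \<Rightarrow> ('v set \<Rightarrow> (real ^ 3) set) \<Rightarrow> bool" where
  "spherical_geodesic_drawing V E p a \<longleftrightarrow>
    p ` V \<subseteq> sphere 0 1 \<and> inj_on p V \<and>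
    (\<forall>u v. {u, v} \<in> E \<longrightarrow> min_geodesic_arc (p u) (p v) (a {u, v})) \<and>
    (\<forall>e \<in> E. \<forall>w \<in> V - e. p w \<notin> a e)"

definition edge_interior ::
  "('v \<Rightarrow> real ^ 3) \<Rightarrow> ('v set \<Rightarrow> (real ^ 3) set) \<Rightarrow> 'v set \<Rightarrow> (real ^ 3) set" where
  "edge_interior p a e = a e - p ` e"

text \<open>A crossing is an unordered pair of edges together with a common interior point, so a
  point in the interior of \<open>k\<close> edges accounts for \<open>k choose 2\<close> crossings.\<close>

definition crossings ::
  "'v set set \<Rightarrow> ('v \<Rightarrow> real ^ 3) \<Rightarrow> ('v set \<Rightarrow> (real ^ 3) set) \<Rightarrow> ('v set set \<times> (real ^ 3)) set" where
  "crossings E p a =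
    {({e, f}, x) | e f x. e \<in> E \<and> f \<in> E \<and> e \<noteq> f \<and>
       x \<in> edge_interior p a e \<inter> edge_interior p a f}"

definition spherical_geodesic_crossing_number :: "'v set \<Rightarrow> 'v set set \<Rightarrow> nat" where
  "spherical_geodesic_crossing_number V E =
    (LEAST k. \<exists>p a. spherical_geodesic_drawing V E p a \<and> k = card (crossings E p a))"

definition complete_edges :: "nat \<Rightarrow> nat set set" where
  "complete_edges n = {e. e \<subseteq> {..<n} \<and> card e = 2}"

definition cr_S2_K :: "nat \<Rightarrow> nat" where
  "cr_S2_K n = spherical_geodesic_crossing_number {..<n} (complete_edges n)"

definition hill :: "nat \<Rightarrow> real" where
  "hill n = 1 / 4 * real_of_int \<lfloor>real n / 2\<rfloor> * real_of_int \<lfloor>(real n - 1) / 2\<rfloor>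
              * real_of_int \<lfloor>(real n - 2) / 2\<rfloor> * real_of_int \<lfloor>(real n - 3) / 2\<rfloor>"

end

theory Submission
  imports Defs
begin

text \<open>
  After a perturbation the drawing is given by n vectors in general position, and four of them span a
  crossing iff their linear dependency has two positive and two negative coefficients. Choose a plane
  through the origin with n/2 vectors on either side, colour the vectors by their side and project
  them to an affine plane. If \<open>d i j\<close> is the number of vectors on one side of the plane spanned by
  i and j minus the number on the other side, and \<open>\<sigma>\<close> is the colour, then counting quadruples
  gives, up to terms of order \<open>n ^ 3\<close>,
  \<open>16 * crossings = n ^ 4 / 4 + (\<Sum>i<j. (1 + 3 * \<sigma> i * \<sigma> j) * (d i j)\<^sup>2)\<close>.
  If the sum on the right is essentially nonnegative, then the limit is at least 1.

  The square is a sum over thresholds of truncated linear functions of the side counts. For each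
  threshold the truncated sum does not increase when the leftmost point v of the projection is deleted:
  projecting v to infinity and dualising turns the other points into coloured lines, which are swept
  from left to right. Two lines of different colours that cross at high level either keep a large rank
  difference until the end of the sweep, where such pairs are counted by the terms of v, or lose it at
  a crossing of two lines of the same colour at high level, which determines the pair.
\<close>


section \<open>Sweeping an arrangement of coloured lines\<close>

text \<open>The colours are forced by the quadruples. Unweighted, a quadruple contributes 2, 0 or -6
  to the sum of squares according as its dependency has sign pattern 2+2, 3+1 or 4+0, so
  nonnegativity would only compare crossings with quadruples of the last kind. The weight
  \<open>1 + 3 * \<sigma> i * \<sigma> j\<close> makes all non-crossing quadruples contribute alike,
  up to a multiple of the product of their colours; these products cancel because the colours add up
  to 0. The price is the weight -2 on pairs of different colours, against 4 on the others, so that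
  nonnegativity is no longer visible. The sweep can pay for exactly this ratio: it is run in both
  directions, a pair of equal colours may be charged once in each of them, and a mixed pair occurs
  in only one. Halving is used a second time there: it bounds both colour classes by
  \<open>J + 1\<close> for every threshold \<open>J\<close> that occurs. Convergence is a separate
  matter: averaging over vertex deletions makes the crossing number divided by
  \<open>n * (n - 1) * (n - 2) * (n - 3)\<close> nondecreasing, so that the lower bound is needed
  for even n only.\<close>

locale bicolored_lines =
  fixes P N :: "'a set" and \<alpha> \<beta> :: "'a \<Rightarrow> real"
  assumes finP: "finite P" and finN: "finite N" and disj: "P \<inter> N = {}"
    and inj: "inj_on \<alpha> (P \<union> N)"
    and nonconcurrent: "\<And>i j k t. \<lbrakk>i \<in> P \<union> N; j \<in> P \<union> N; k \<in> P \<union> N; i \<noteq> j; j \<noteq> k; i \<noteq> k;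
      \<alpha> i * t + \<beta> i = \<alpha> j * t + \<beta> j\<rbrakk> \<Longrightarrow> \<alpha> k * t + \<beta> k \<noteq> \<alpha> j * t + \<beta> j"
begin

definition height :: "'a \<Rightarrow> real \<Rightarrow> real" where
  "height i t = \<alpha> i * t + \<beta> i"

definition meet :: "'a \<Rightarrow> 'a \<Rightarrow> real" where
  "meet i j = (\<beta> j - \<beta> i) / (\<alpha> i - \<alpha> j)"

text \<open>This is a side count in dual form: the crossing of two lines stands for the line through
  two points. Lines of \<open>N\<close> are counted on the opposite side because the colour -1
  reverses sides.\<close>

definition level :: "'a \<Rightarrow> 'a \<Rightarrow> nat" where
  "level i j = card {k \<in> P - {i, j}. height k (meet i j) < height i (meet i j)}
             + card {k \<in> N - {i, j}. height i (meet i j) < height k (meet i j)}"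

text \<open>The order immediately to the right of \<open>t\<close>, where two lines that cross at
  \<open>t\<close> are already separated by their slopes; \<open>below_before\<close> is the order
  immediately to the left. Ranks are thereby meaningful at crossing times as well.\<close>

definition below_after :: "real \<Rightarrow> 'a \<Rightarrow> 'a \<Rightarrow> bool" where
  "below_after t i j \<longleftrightarrow> height i t < height j t \<or> height i t = height j t \<and> \<alpha> i < \<alpha> j"

definition below_before :: "real \<Rightarrow> 'a \<Rightarrow> 'a \<Rightarrow> bool" where
  "below_before t i j \<longleftrightarrow> height i t < height j t \<or> height i t = height j t \<and> \<alpha> j < \<alpha> i"

definition rank_after :: "'a set \<Rightarrow> real \<Rightarrow> 'a \<Rightarrow> nat" where
  "rank_after X t i = card {k \<in> X. below_after t k i}"

definition rank_before :: "'a set \<Rightarrow> real \<Rightarrow> 'a \<Rightarrow> nat" where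
  "rank_before X t i = card {k \<in> X. below_before t k i}"

text \<open>The rank at the end of the sweep: far to the right, heights are ordered by
  slope.\<close>

definition slope_rank :: "'a set \<Rightarrow> 'a \<Rightarrow> nat" where
  "slope_rank X i = card {k \<in> X. \<alpha> k < \<alpha> i}"

lemma slope_eq: "\<lbrakk>i \<in> P \<union> N; j \<in> P \<union> N; \<alpha> i = \<alpha> j\<rbrakk> \<Longrightarrow> i = j"
  using inj by (meson inj_onD)

lemma height_meet:
  assumes "\<alpha> i \<noteq> \<alpha> j"
  shows "height i (meet i j) = height j (meet i j)"
proof -
  have "(\<alpha> i - \<alpha> j) * meet i j = \<beta> j - \<beta> i"
    using assms by (simp add: meet_def)
  then show ?thesis by (simp add: height_def algebra_simps)
qed

lemma meet_unique:
  assumes "\<alpha> i \<noteq> \<alpha> j" "height i t = height j t"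
  shows "t = meet i j"
proof -
  have "(\<alpha> i - \<alpha> j) * t = \<beta> j - \<beta> i"
    using assms(2) by (simp add: height_def algebra_simps)
  then show ?thesis using assms(1) by (simp add: meet_def field_simps)
qed

lemma meet_commute: "meet i j = meet j i"
  unfolding meet_def by (metis minus_diff_eq minus_divide_divide)

lemma level_commute:
  assumes "\<alpha> i \<noteq> \<alpha> j" shows "level i j = level j i"
  using height_meet[OF assms] by (simp add: level_def meet_commute[of j i] insert_commute)

lemma height_eq_imp:
  assumes "i \<in> P \<union> N" "j \<in> P \<union> N" "k \<in> P \<union> N" "i \<noteq> j" 
    "height i t = height j t" "height k t = height j t"
  shows "k = i \<or> k = j"
  using nonconcurrent[of i j k t] assms unfolding height_def by metis

lemma height_less_after:
  assumes "height i s = height j s" "\<alpha> i < \<alpha> j" "s < t"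
  shows "height i t < height j t"
proof -
  have "(\<alpha> j - \<alpha> i) * (t - s) > 0" using assms by simp
  moreover have "height j t - height i t = (\<alpha> j - \<alpha> i) * (t - s)"
    using assms(1) by (simp add: height_def algebra_simps)
  ultimately show ?thesis by simp
qed

text \<open>The tie-breaking places a crossing at \<open>s\<close> before the interval and a
  crossing at \<open>t\<close> after it, so a change of order forces a crossing strictly
  inside.\<close>

lemma meet_between:
  assumes "i \<in> P \<union> N" "j \<in> P \<union> N" "s < t" "below_after s i j" "\<not> below_before t i j"
  shows "s < meet i j \<and> meet i j < t"
proof -
  have ne: "i \<noteq> j" using assms(4) by (auto simp: below_after_def)
  then have sl: "\<alpha> i \<noteq> \<alpha> j" using slope_eq assms by blast
  have d: "height j t - height i t = height j s - height i s + (\<alpha> j - \<alpha> i) * (t - s)"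
    by (simp add: height_def algebra_simps)
  have neg: "\<alpha> j < \<alpha> i"
  proof (rule ccontr)
    assume "\<not> \<alpha> j < \<alpha> i"
    then have "\<alpha> i < \<alpha> j" using sl by simp
    then have "(\<alpha> j - \<alpha> i) * (t - s) > 0" using assms(3) by simp
    moreover have "height j s - height i s \<ge> 0" using assms(4) by (auto simp: below_after_def)
    ultimately show False using d assms(5) by (auto simp: below_before_def)
  qed
  have hs: "height i s < height j s" using assms(4) neg by (auto simp: below_after_def)
  have ht: "height j t < height i t" using assms(5) neg by (auto simp: below_before_def)
  have m: "height i (meet i j) = height j (meet i j)" by (rule height_meet[OF sl])
  have "s < meet i j"
  proof (rule ccontr)
    assume "\<not> ?thesis"
    then have "meet i j < s \<or> meet i j = s" by auto
    then show False using m hs height_less_after[of j "meet i j" i s] neg by auto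
  qed
  moreover have "meet i j < t"
  proof (rule ccontr)
    assume "\<not> ?thesis"
    then have a: "t \<le> meet i j" by simp
    have "height j (meet i j) - height i (meet i j)
        = height j t - height i t + (\<alpha> j - \<alpha> i) * (meet i j - t)"
      by (simp add: height_def algebra_simps)
    moreover have "(\<alpha> j - \<alpha> i) * (meet i j - t) \<le> 0"
      using a neg by (simp add: mult_nonpos_nonneg)
    ultimately show False using m ht by simp
  qed
  ultimately show ?thesis by simp
qed

lemma below_before_if_no_meet:
  assumes "i \<in> P \<union> N" "j \<in> P \<union> N" "s < t"
    and no: "\<And>i j. \<lbrakk>i \<in> P \<union> N; j \<in> P \<union> N; s < meet i j\<rbrakk> \<Longrightarrow> t \<le> meet i j"
  shows "below_before t i j \<longleftrightarrow> below_after s i j"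
proof
  assume a: "below_before t i j"
  then have ne: "i \<noteq> j" by (auto simp: below_before_def)
  then have sl: "\<alpha> i \<noteq> \<alpha> j" using slope_eq assms by blast
  show "below_after s i j"
  proof (rule ccontr)
    assume "\<not> below_after s i j"
    then have "below_after s j i" using sl by (auto simp: below_after_def)
    moreover have "\<not> below_before t j i" using a by (auto simp: below_before_def)
    ultimately show False using meet_between[of j i s t] no[of j i] assms by force
  qed
next
  assume "below_after s i j"
  then show "below_before t i j" using meet_between[of i j s t] no[of i j] assms by force
qed

lemma rank_after_less:
  assumes "finite X" "X \<subseteq> P \<union> N" "i \<in> X" "below_after t i j"
  shows "rank_after X t i < rank_after X t j"
  unfolding rank_after_def
proof (rule psubset_card_mono)
  show "finite {k \<in> X. below_after t k j}" using assms by simp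
  have "below_after t k j" if "below_after t k i" for k
    using that assms(4) unfolding below_after_def by auto
  moreover have "i \<in> {k \<in> X. below_after t k j}" "i \<notin> {k \<in> X. below_after t k i}"
    using assms by (auto simp: below_after_def)
  ultimately show "{k \<in> X. below_after t k i} \<subset> {k \<in> X. below_after t k j}" by blast
qed

lemma rank_before_less:
  assumes "finite X" "X \<subseteq> P \<union> N" "i \<in> X" "below_before t i j"
  shows "rank_before X t i < rank_before X t j"
  unfolding rank_before_def
proof (rule psubset_card_mono)
  show "finite {k \<in> X. below_before t k j}" using assms by simp
  have "below_before t k j" if "below_before t k i" for k
    using that assms(4) unfolding below_before_def by auto
  moreover have "i \<in> {k \<in> X. below_before t k j}" "i \<notin> {k \<in> X. below_before t k i}"
    using assms by (auto simp: below_before_def)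
  ultimately show "{k \<in> X. below_before t k i} \<subset> {k \<in> X. below_before t k j}" by blast
qed

lemma rank_after_inj:
  assumes "finite X" "X \<subseteq> P \<union> N" "i \<in> X" "j \<in> X" "rank_after X t i = rank_after X t j"
  shows "i = j"
proof (rule ccontr)
  assume "i \<noteq> j"
  then have "\<alpha> i \<noteq> \<alpha> j" using slope_eq assms by blast
  then have "below_after t i j \<or> below_after t j i" by (auto simp: below_after_def)
  then show False using rank_after_less[of X i t j] rank_after_less[of X j t i] assms by auto
qed

lemma rank_before_inj:
  assumes "finite X" "X \<subseteq> P \<union> N" "i \<in> X" "j \<in> X" "rank_before X t i = rank_before X t j"
  shows "i = j"
proof (rule ccontr)
  assume "i \<noteq> j"
  then have "\<alpha> i \<noteq> \<alpha> j" using slope_eq assms by blast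
  then have "below_before t i j \<or> below_before t j i" by (auto simp: below_before_def)
  then show False using rank_before_less[of X i t j] rank_before_less[of X j t i] assms by auto
qed

section \<open>Charging mixed crossings to swaps of equal colour\<close>

text \<open>No third line passes through the crossing, so the lines of \<open>N\<close> other than
  \<open>c\<close> that are not below it are above it. A threshold for the level thus becomes a
  threshold for a difference of two ranks, which can be followed along the sweep.\<close>

lemma level_mixed:
  assumes "a \<in> P" "c \<in> N"
  shows "int (level a c) = int (rank_after P (meet a c) a) - int (rank_after N (meet a c) c) + int (card N) - 1"
proof -
  have ne: "a \<noteq> c" using assms disj by blast
  then have sl: "\<alpha> a \<noteq> \<alpha> c" using slope_eq assms by blast
  let ?t = "meet a c"
  have m: "height a ?t = height c ?t" by (rule height_meet[OF sl])
  have other: "k = a \<or> k = c" if "k \<in> P \<union> N" "height k ?t = height c ?t" for k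
    using height_eq_imp[of a c k ?t] that assms ne m by auto
  have 1: "{k \<in> P - {a, c}. height k ?t < height a ?t} = {k \<in> P. below_after ?t k a}"
    using other m assms disj by (auto simp: below_after_def)
  have 2: "{k \<in> N - {a, c}. height a ?t < height k ?t} = N - {c} - {k \<in> N. below_after ?t k c}"
    using other m assms disj by (force simp: below_after_def)
  have "{k \<in> N. below_after ?t k c} \<subseteq> N - {c}" by (auto simp: below_after_def)
  then have "card (N - {c} - {k \<in> N. below_after ?t k c}) = card (N - {c}) - rank_after N ?t c"
    "rank_after N ?t c \<le> card (N - {c})"
    using finN by (auto simp: rank_after_def card_Diff_subset finite_subset intro: card_mono)
  moreover have "card (N - {c}) = card N - 1" "card N > 0"
    using assms finN by (auto simp: card_gt_0_iff)
  ultimately show ?thesis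
    unfolding level_def 1 2 rank_after_def[of P, symmetric] by linarith
qed

text \<open>A pair (a, c) whose rank difference falls below the threshold T after the two lines have
  crossed is charged to the swap of two lines of the same colour at which this happens. Simultaneous
  swaps are resolved by performing those of P first.\<close>

lemma rank_drop_charged:
  fixes T :: int
  assumes a: "a \<in> P" and c: "c \<in> N" and ac: "\<alpha> a < \<alpha> c" and t: "meet a c < t"
    and bef: "T \<le> int (rank_before P t a) - int (rank_before N t c)"
    and aft: "int (rank_after P t a) - int (rank_after N t c) < T"
  shows "(\<exists>b \<in> P. \<alpha> a < \<alpha> b \<and> t = meet a b \<and> int (card N) + T - 1 \<le> int (level a b)
            \<and> int (rank_before N t c) = int (rank_after P t a) - T + 1)
       \<or> (\<exists>d \<in> N. \<alpha> d < \<alpha> c \<and> t = meet d c \<and> int (card N) + T - 1 \<le> int (level d c)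
            \<and> int (rank_after P t a) = int (rank_after N t c) + T - 1)"
proof -
  have "a \<noteq> c" using a c disj by blast
  then have sl: "\<alpha> a \<noteq> \<alpha> c" using ac by simp
  have hac: "height a t < height c t"
    using height_less_after[OF height_meet[OF sl] ac t] .
  show ?thesis
  proof (cases "int (rank_after P t a) - int (rank_before N t c) < T")
    case True
    then have fall: "rank_after P t a < rank_before P t a" using bef by linarith
    then have "\<not> {k \<in> P. below_before t k a} \<subseteq> {k \<in> P. below_after t k a}"
      unfolding rank_after_def rank_before_def
      using card_mono[of "{k \<in> P. below_after t k a}" "{k \<in> P. below_before t k a}"] finP by auto
    then obtain b where b: "b \<in> P" "below_before t b a" "\<not> below_after t b a" by blast
    then have hb: "height b t = height a t" "\<alpha> a < \<alpha> b"
      by (auto simp: below_before_def below_after_def)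
    then have ne: "a \<noteq> b" by auto
    have tm: "t = meet a b" using meet_unique[of a b t] hb by auto
    have other: "k = a \<or> k = b" if "k \<in> P \<union> N" "height k t = height a t" for k
      using height_eq_imp[of b a k t] that a b(1) ne hb by auto
    have sub: "{k \<in> P. below_before t k a} \<subseteq> insert b {k \<in> P. below_after t k a}"
      using other by (fastforce simp: below_before_def below_after_def)
    have "rank_before P t a \<le> Suc (rank_after P t a)"
      unfolding rank_after_def rank_before_def
      using card_mono[OF _ sub] finP by (simp add: card_insert_if split: if_splits)
    \<comment> \<open>A swap changes the rank by one, so the difference is now exactly
      \<open>T - 1\<close>. This equation later recovers \<open>c\<close> from \<open>a\<close> and
      the swap.\<close>
    then have eq: "int (rank_before N t c) = int (rank_after P t a) - T + 1"
      using True bef fall by linarith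
    have 1: "{k \<in> P - {a, b}. height k t < height a t} = {k \<in> P. below_after t k a}"
      using other hb by (fastforce simp: below_after_def)
    have Nb: "{k \<in> N - {a, b}. height a t < height k t} = N - {k \<in> N. height k t < height a t}"
      using other hb a b(1) disj by (fastforce)
    \<comment> \<open>At time \<open>t\<close> the line \<open>a\<close> runs below
      \<open>c\<close>, so whatever is below \<open>a\<close> is below \<open>c\<close>.\<close>
    have "card {k \<in> N. height k t < height a t} \<le> rank_before N t c"
      unfolding rank_before_def using finN hac by (intro card_mono) (auto simp: below_before_def)
    then have "card N \<le> card (N - {k \<in> N. height k t < height a t}) + rank_before N t c"
      using finN by (subst card_Diff_subset) auto
    then have "int (card N) + T - 1 \<le> int (level a b)"
      unfolding level_def tm[symmetric] 1 Nb rank_after_def[of P, symmetric] using eq by linarith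
    then show ?thesis using b hb tm eq by blast
  next
    case False
    then have rise: "rank_before N t c < rank_after N t c" using aft by linarith
    then have "\<not> {k \<in> N. below_after t k c} \<subseteq> {k \<in> N. below_before t k c}"
      unfolding rank_after_def rank_before_def
      using card_mono[of "{k \<in> N. below_before t k c}" "{k \<in> N. below_after t k c}"] finN by auto
    then obtain d where d: "d \<in> N" "below_after t d c" "\<not> below_before t d c" by blast
    then have hd: "height d t = height c t" "\<alpha> d < \<alpha> c"
      by (auto simp: below_before_def below_after_def)
    then have ne: "d \<noteq> c" by auto
    have tm: "t = meet d c" using meet_unique[of d c t] hd by auto
    have other: "k = c \<or> k = d" if "k \<in> P \<union> N" "height k t = height c t" for k
      using height_eq_imp[of d c k t] that c d(1) ne hd by auto
    have sub: "{k \<in> N. below_after t k c} \<subseteq> insert d {k \<in> N. below_before t k c}"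
      using other by (fastforce simp: below_before_def below_after_def)
    have "rank_after N t c \<le> Suc (rank_before N t c)"
      unfolding rank_after_def rank_before_def
      using card_mono[OF _ sub] finN by (simp add: card_insert_if split: if_splits)
    then have eq: "int (rank_after P t a) = int (rank_after N t c) + T - 1"
      "rank_after N t c = Suc (rank_before N t c)"
      using False aft rise by linarith+
    have 1: "{k \<in> N - {d, c}. height d t < height k t}
        = N - ({d, c} \<union> {k \<in> N. below_before t k c})"
      using other hd by (fastforce simp: below_before_def)
    have "card ({d, c} \<union> {k \<in> N. below_before t k c}) \<le> 2 + rank_before N t c"
      unfolding rank_before_def using ne by (intro order_trans[OF card_Un_le]) simp
    moreover have "{d, c} \<union> {k \<in> N. below_before t k c} \<subseteq> N" using c d by auto
    ultimately have n1: "card N \<le> card {k \<in> N - {d, c}. height d t < height k t} + 2 + rank_before N t c"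
      unfolding 1 using finN by (subst card_Diff_subset) (auto intro: finite_subset)
    \<comment> \<open>The line \<open>a\<close> itself lies below the swap of \<open>d\<close> and
      \<open>c\<close>. Counting it makes up for one of the two lines \<open>d\<close> and
      \<open>c\<close> that are missing from the count in \<open>N\<close>.\<close>
    have "insert a {k \<in> P. below_after t k a} \<subseteq> {k \<in> P - {d, c}. height k t < height d t}"
      using a c d(1) disj hac hd by (fastforce simp: below_after_def)
    then have "card (insert a {k \<in> P. below_after t k a}) \<le> card {k \<in> P - {d, c}. height k t < height d t}"
      using finP by (intro card_mono) auto
    moreover have "card (insert a {k \<in> P. below_after t k a}) = Suc (rank_after P t a)"
      using finP by (simp add: rank_after_def below_after_def)
    ultimately have "int (card N) + T - 1 \<le> int (level d c)"
      unfolding level_def tm[symmetric] using n1 eq by linarith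
    then show ?thesis using d hd tm eq by blast
  qed
qed

text \<open>Ranks change at crossings only. At the earliest crossing time after
  \<open>meet a c\<close> with too small a difference, the value just before it is the value just
  after the preceding crossing, where the difference is still large.\<close>

lemma rank_drop_time:
  fixes T :: int
  assumes a: "a \<in> P" and c: "c \<in> N"
    and start: "T \<le> int (rank_after P (meet a c) a) - int (rank_after N (meet a c) c)"
    and "end": "int (slope_rank P a) - int (slope_rank N c) < T"
  obtains t where "meet a c < t" "T \<le> int (rank_before P t a) - int (rank_before N t c)"
    "int (rank_after P t a) - int (rank_after N t c) < T"
proof -
  \<comment> \<open>The diagonal adds the spurious time 0, the value of 0 / 0; an additional event
    time does no harm.\<close>
  define Ts where "Ts = (\<lambda>(i, j). meet i j) ` ((P \<union> N) \<times> (P \<union> N))"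
  have finT: "finite Ts" using finP finN by (simp add: Ts_def)
  have meetT: "meet i j \<in> Ts" if "i \<in> P \<union> N" "j \<in> P \<union> N" for i j
    using that unfolding Ts_def by force
  \<comment> \<open>All crossings are over at \<open>z\<close>, so the ranks there are the slope
    ranks. Having \<open>z\<close> among the candidate times makes the set \<open>C\<close> below
    nonempty.\<close>
  define z where "z = Max Ts + 1"
  have zT: "t < z" if "t \<in> Ts" for t
    using Max_ge[OF finT that] by (simp add: z_def)
  have zrank: "rank_after X z i = slope_rank X i" if "X \<subseteq> P \<union> N" "i \<in> P \<union> N" for X i
  proof -
    have "below_after z k i \<longleftrightarrow> \<alpha> k < \<alpha> i" if k: "k \<in> X" for k
    proof (cases "k = i")
      case False
      then have sl: "\<alpha> k \<noteq> \<alpha> i" using slope_eq[of k i] k \<open>X \<subseteq> P \<union> N\<close> \<open>i \<in> P \<union> N\<close> by blast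
      have "meet k i < z" using zT meetT k \<open>X \<subseteq> P \<union> N\<close> \<open>i \<in> P \<union> N\<close> by blast
      then show ?thesis
        using sl height_less_after[of k "meet k i" i z] height_less_after[of i "meet k i" k z]
          height_meet[OF sl] by (cases "\<alpha> k < \<alpha> i") (auto simp: below_after_def)
    qed (simp add: below_after_def)
    then show ?thesis by (auto simp: rank_after_def slope_rank_def intro: arg_cong[where f = card])
  qed
  define \<Delta> where "\<Delta> t = int (rank_after P t a) - int (rank_after N t c)" for t
  define C where "C = {t \<in> insert z Ts. meet a c < t \<and> \<Delta> t < T}"
  have "z \<in> C" using "end" zT[OF meetT[of a c]] a c zrank by (simp add: C_def \<Delta>_def)
  moreover have finC: "finite C" using finT by (simp add: C_def)
  ultimately have tC: "Min C \<in> C" and tmin: "\<And>u. u \<in> C \<Longrightarrow> Min C \<le> u"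
    by (auto intro!: Min_in)
  define t where "t = Min C"
  define S where "S = {s \<in> Ts. meet a c \<le> s \<and> s < t}"
  have t: "meet a c < t" "\<Delta> t < T" using tC by (auto simp: t_def C_def)
  have "meet a c \<in> S" using t a c meetT by (simp add: S_def)
  moreover have finS: "finite S" using finT by (simp add: S_def)
  ultimately have sS: "Max S \<in> S" and smax: "\<And>u. u \<in> S \<Longrightarrow> u \<le> Max S"
    by (auto intro!: Max_in)
  define s where "s = Max S"
  have s: "s \<in> Ts" "meet a c \<le> s" "s < t" using sS by (auto simp: s_def S_def)
  have "T \<le> \<Delta> s"
  proof (cases "s = meet a c")
    case True then show ?thesis using start by (simp add: \<Delta>_def)
  next
    case False
    then have "s \<notin> C" using tmin[of s] s by (force simp: t_def)
    then show ?thesis using False s by (auto simp: C_def)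
  qed
  moreover have no: "t \<le> meet i j" if "i \<in> P \<union> N" "j \<in> P \<union> N" "s < meet i j" for i j
    using smax[of "meet i j"] that meetT[of i j] s by (force simp: S_def s_def)
  have "rank_before X t i = rank_after X s i" if "X \<subseteq> P \<union> N" "i \<in> P \<union> N" for X i
    unfolding rank_before_def rank_after_def
    using below_before_if_no_meet[OF _ _ s(3) no] that by (intro arg_cong[where f = card]) blast
  then have "int (rank_before P t a) - int (rank_before N t c) = \<Delta> s"
    using a c by (simp add: \<Delta>_def)
  ultimately show thesis using that[of t] t by (simp add: \<Delta>_def)
qed

text \<open>The condition on the slopes says that \<open>a\<close> runs below \<open>c\<close> once
  they have crossed. The second term counts the pairs whose rank difference stays large until the
  end; every other pair is charged to the swap at which the difference drops, and no swap is charged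
  twice.\<close>

lemma mixed_meets_le:
  "card {(a, c). a \<in> P \<and> c \<in> N \<and> \<alpha> a < \<alpha> c \<and> J \<le> level a c}
   \<le> card {(i, j). (i \<in> P \<and> j \<in> P \<or> i \<in> N \<and> j \<in> N) \<and> \<alpha> i < \<alpha> j \<and> J \<le> level i j}
     + card {(a, c). a \<in> P \<and> c \<in> N \<and> \<alpha> a < \<alpha> c \<and> slope_rank N c + J + 1 \<le> slope_rank P a + card N}"
    (is "card ?M \<le> card ?S + card ?F")
proof -
  \<comment> \<open>By \<open>level_mixed\<close>, level at least \<open>J\<close> means rank
    difference at least this \<open>T\<close>.\<close>
  define T :: int where "T = int J + 1 - int (card N)"
  \<comment> \<open>A swap in \<open>P\<close> keeps \<open>a\<close> as its line of smaller slope,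
    a swap in \<open>N\<close> keeps \<open>c\<close> as its line of larger slope. The other member
    of the pair is determined by its rank at the time of the swap.\<close>
  define r where "r = (\<lambda>(a, c) (i, j).
      (i = a \<and> j \<in> P \<and> int (rank_before N (meet i j) c) = int (rank_after P (meet i j) i) - T + 1)
    \<or> (j = c \<and> i \<in> N \<and> int (rank_after P (meet i j) a) = int (rank_after N (meet i j) j) + T - 1))"
  have fin: "finite ((P \<union> N) \<times> (P \<union> N))" using finP finN by simp
  have finS: "finite ?S" and finM: "finite ?M" and finF: "finite ?F"
    by (rule finite_subset[OF _ fin]; auto)+
  have "card (?M - ?F) \<le> card ?S"
  proof (rule card_le_if_inj_on_rel[where r = r, OF finS])
    fix x assume x: "x \<in> ?M - ?F"
    obtain a c where xac: "x = (a, c)" by (cases x)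
    then have a: "a \<in> P" and c: "c \<in> N" and ac: "\<alpha> a < \<alpha> c" and lv: "J \<le> level a c"
      and dr: "int (slope_rank P a) - int (slope_rank N c) < T"
      using x by (auto simp: T_def)
    have "T \<le> int (rank_after P (meet a c) a) - int (rank_after N (meet a c) c)"
      using level_mixed[OF a c] lv by (simp add: T_def)
    then obtain t where "meet a c < t" "T \<le> int (rank_before P t a) - int (rank_before N t c)"
      "int (rank_after P t a) - int (rank_after N t c) < T"
      using rank_drop_time[OF a c _ dr] by blast
    from rank_drop_charged[OF a c ac this] show "\<exists>y. y \<in> ?S \<and> r x y"
    proof (elim disjE bexE conjE)
      fix b assume b: "b \<in> P" "\<alpha> a < \<alpha> b" "t = meet a b" "int (card N) + T - 1 \<le> int (level a b)"
        "int (rank_before N t c) = int (rank_after P t a) - T + 1"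
      then show ?thesis using a by (intro exI[of _ "(a, b)"]) (auto simp: r_def xac T_def)
    next
      fix d assume d: "d \<in> N" "\<alpha> d < \<alpha> c" "t = meet d c" "int (card N) + T - 1 \<le> int (level d c)"
        "int (rank_after P t a) = int (rank_after N t c) + T - 1"
      then show ?thesis using c by (intro exI[of _ "(d, c)"]) (auto simp: r_def xac T_def)
    qed
  next
    fix x y z assume xyz: "x \<in> ?M - ?F" "y \<in> ?M - ?F" "z \<in> ?S" "r x z" "r y z"
    obtain a c a' c' i j where e: "x = (a, c)" "y = (a', c')" "z = (i, j)" by (cases x; cases y; cases z)
    have m: "a \<in> P" "c \<in> N" "a' \<in> P" "c' \<in> N" using xyz e by auto
    show "x = y"
    proof (cases "i \<in> P")
      case True
      then have "i \<notin> N" using disj by blast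
      then have "i = a" "i = a'" "rank_before N (meet i j) c = rank_before N (meet i j) c'"
        using xyz(4,5) e by (auto simp: r_def)
      then show ?thesis using rank_before_inj[of N c c'] finN m e by auto
    next
      case False
      then have "j \<in> N" using xyz(3) e by auto
      then have "j \<notin> P" using disj by blast
      then have "j = c" "j = c'" "rank_after P (meet i j) a = rank_after P (meet i j) a'"
        using xyz(4,5) e by (auto simp: r_def)
      then show ?thesis using rank_after_inj[of P a a'] finP m e by auto
    qed
  qed
  moreover have "card ?M \<le> card ((?M - ?F) \<union> ?F)"
    using finM finF by (intro card_mono) auto
  moreover have "\<dots> \<le> card (?M - ?F) + card ?F" by (rule card_Un_le)
  ultimately show ?thesis by linarith
qed

section \<open>Pairs with a large rank difference at the end of the sweep\<close>

text \<open>The level of the point at infinity of line \<open>i\<close>. It will be a side count of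
  a line through the deleted point.\<close>

definition end_level :: "'a \<Rightarrow> nat" where
  "end_level i = card {k \<in> P. \<alpha> k < \<alpha> i} + card {k \<in> N. \<alpha> i < \<alpha> k}"

lemma slope_rank_bij:
  assumes "finite X" "X \<subseteq> P \<union> N"
  shows "bij_betw (slope_rank X) X {..<card X}"
proof -
  have less: "slope_rank X i < slope_rank X j" if "i \<in> X" "\<alpha> i < \<alpha> j" for i j
    unfolding slope_rank_def
  proof (rule psubset_card_mono)
    show "{k \<in> X. \<alpha> k < \<alpha> i} \<subset> {k \<in> X. \<alpha> k < \<alpha> j}" using that by force
  qed (use assms in simp)
  have "inj_on (slope_rank X) X"
  proof (rule inj_onI, rule ccontr)
    fix i j assume "i \<in> X" "j \<in> X" "slope_rank X i = slope_rank X j" "i \<noteq> j"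
    then show False using less[of i j] less[of j i] slope_eq[of i j] assms by force
  qed
  moreover have "slope_rank X ` X \<subseteq> {..<card X}"
    unfolding slope_rank_def using assms by (auto intro!: psubset_card_mono)
  ultimately show ?thesis
    by (simp add: bij_betw_def card_image card_subset_eq)
qed

lemma slope_less_iff_rank:
  assumes "finite X" "X \<subseteq> P \<union> N" "i \<in> P \<union> N" "i \<notin> X" "k \<in> X"
  shows "\<alpha> k < \<alpha> i \<longleftrightarrow> slope_rank X k < slope_rank X i"
proof
  assume "\<alpha> k < \<alpha> i"
  then show "slope_rank X k < slope_rank X i"
    unfolding slope_rank_def using assms by (intro psubset_card_mono) force+
next
  assume *: "slope_rank X k < slope_rank X i"
  show "\<alpha> k < \<alpha> i"
  proof (rule ccontr)
    assume "\<not> \<alpha> k < \<alpha> i"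
    then have "slope_rank X i \<le> slope_rank X k"
      unfolding slope_rank_def using assms by (intro card_mono) auto
    then show False using * by simp
  qed
qed

text \<open>For a fixed member of the pair, the slope ranks admissible for the other member form an
  interval whose length is the excess of an end level over \<open>J\<close>. The bounds on the class
  sizes keep this interval inside the range of ranks, so the same set can be counted from either
  colour.\<close>

lemma card_end_pairs:
  assumes "card P \<le> J + 1" "card N \<le> J + 1"
  defines "F \<equiv> {(a, c). a \<in> P \<and> c \<in> N \<and> \<alpha> a < \<alpha> c \<and> slope_rank N c + J + 1 \<le> slope_rank P a + card N}"
  shows "card F = (\<Sum>a\<in>P. end_level a - J)" and "card F = (\<Sum>c\<in>N. end_level c - J)"
proof -
  have bN: "bij_betw (slope_rank N) N {..<card N}" and bP: "bij_betw (slope_rank P) P {..<card P}"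
    using slope_rank_bij finP finN by auto
  have "F = (SIGMA a:P. {c \<in> N. \<alpha> a < \<alpha> c \<and> slope_rank N c + J + 1 \<le> slope_rank P a + card N})"
    by (auto simp: F_def)
  then have "card F = (\<Sum>a\<in>P. card {c \<in> N. \<alpha> a < \<alpha> c \<and> slope_rank N c + J + 1 \<le> slope_rank P a + card N})"
    using finP finN by simp
  also have "\<dots> = (\<Sum>a\<in>P. end_level a - J)"
  proof (rule sum.cong[OF refl])
    fix a assume a: "a \<in> P"
    then have aN: "a \<notin> N" using disj by blast
    let ?C = "{c \<in> N. \<alpha> a < \<alpha> c \<and> slope_rank N c + J + 1 \<le> slope_rank P a + card N}"
    have ra: "slope_rank P a < card P" using bP a by (auto simp: bij_betw_def)
    have le: "slope_rank N a \<le> card N" unfolding slope_rank_def using finN by (auto intro: card_mono)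
    have gt: "\<alpha> a < \<alpha> c \<longleftrightarrow> slope_rank N a \<le> slope_rank N c" if "c \<in> N" for c
      using slope_less_iff_rank[of N a c] slope_eq[of a c] that a aN finN by force
    have "slope_rank N ` ?C = {slope_rank N a..<slope_rank P a + card N - J}"
    proof (intro set_eqI iffI)
      fix k assume k: "k \<in> {slope_rank N a..<slope_rank P a + card N - J}"
      \<comment> \<open>\<open>slope_rank P a\<close> is at most \<open>J\<close>, so the interval
        ends at \<open>card N\<close> or earlier.\<close>
      then have "k < card N" using ra assms(1) by auto
      then have "k \<in> slope_rank N ` N" using bN by (simp add: bij_betw_def)
      then obtain c where "c \<in> N" "k = slope_rank N c" by blast
      then show "k \<in> slope_rank N ` ?C" using k gt by auto
    qed (use gt in auto)
    moreover have "inj_on (slope_rank N) ?C" using bN by (auto simp: bij_betw_def inj_on_def)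
    ultimately have "card ?C = slope_rank P a + card N - J - slope_rank N a"
      using card_image[of "slope_rank N" ?C] by simp
    moreover have "{k \<in> N. \<alpha> a < \<alpha> k} = N - {k \<in> N. \<alpha> k < \<alpha> a}"
    proof -
      have "\<alpha> a \<noteq> \<alpha> k" if "k \<in> N" for k using slope_eq[of a k] that a aN by auto
      then show ?thesis by force
    qed
    then have "card {k \<in> N. \<alpha> a < \<alpha> k} = card N - slope_rank N a"
      using finN by (simp add: slope_rank_def card_Diff_subset)
    then have "end_level a = slope_rank P a + (card N - slope_rank N a)"
      by (simp add: end_level_def slope_rank_def)
    ultimately show "card ?C = end_level a - J" using le by simp
  qed
  finally show "card F = (\<Sum>a\<in>P. end_level a - J)" .
  have "card F = card (prod.swap ` F)" by (simp add: card_image)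
  also have "prod.swap ` F = (SIGMA c:N. {a \<in> P. \<alpha> a < \<alpha> c \<and> slope_rank N c + J + 1 \<le> slope_rank P a + card N})"
    by (auto simp: F_def)
  also have "card \<dots> = (\<Sum>c\<in>N. card {a \<in> P. \<alpha> a < \<alpha> c \<and> slope_rank N c + J + 1 \<le> slope_rank P a + card N})"
    using finP finN by simp
  also have "\<dots> = (\<Sum>c\<in>N. end_level c - J)"
  proof (rule sum.cong[OF refl])
    fix c assume c: "c \<in> N"
    then have cP: "c \<notin> P" using disj by blast
    let ?A = "{a \<in> P. \<alpha> a < \<alpha> c \<and> slope_rank N c + J + 1 \<le> slope_rank P a + card N}"
    have rc: "slope_rank N c < card N" using bN c by (auto simp: bij_betw_def)
    have le: "slope_rank P c \<le> card P" unfolding slope_rank_def using finP by (auto intro: card_mono)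
    have lt: "\<alpha> a < \<alpha> c \<longleftrightarrow> slope_rank P a < slope_rank P c" if "a \<in> P" for a
      using slope_less_iff_rank[of P c a] that c cP finP by force
    have "slope_rank P ` ?A = {slope_rank N c + J + 1 - card N..<slope_rank P c}"
    proof (intro set_eqI iffI)
      fix k assume k: "k \<in> {slope_rank N c + J + 1 - card N..<slope_rank P c}"
      then have "k < card P" using le by auto
      then have "k \<in> slope_rank P ` P" using bP by (simp add: bij_betw_def)
      then obtain a where "a \<in> P" "k = slope_rank P a" by blast
      then show "k \<in> slope_rank P ` ?A" using k lt by auto
    qed (use lt in auto)
    moreover have "inj_on (slope_rank P) ?A" using bP by (auto simp: bij_betw_def inj_on_def)
    ultimately have "card ?A = slope_rank P c - (slope_rank N c + J + 1 - card N)"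
      using card_image[of "slope_rank P" ?A] by simp
    moreover have "{k \<in> N. \<alpha> c < \<alpha> k} = N - insert c {k \<in> N. \<alpha> k < \<alpha> c}"
    proof -
      have "\<alpha> c \<noteq> \<alpha> k" if "k \<in> N" "k \<noteq> c" for k using slope_eq[of c k] that c by auto
      then show ?thesis by force
    qed
    then have "card {k \<in> N. \<alpha> c < \<alpha> k} = card N - Suc (slope_rank N c)"
      using finN c by (simp add: slope_rank_def card_Diff_subset)
    then have "end_level c = slope_rank P c + (card N - Suc (slope_rank N c))"
      by (simp add: end_level_def slope_rank_def)
    \<comment> \<open>As \<open>card N\<close> is at most \<open>J + 1\<close>, the subtraction in
      the lower end of the interval does not truncate.\<close>
    ultimately show "card ?A = end_level c - J" using rc assms(2) by simp
  qed
  finally show "card F = (\<Sum>c\<in>N. end_level c - J)" .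
qed

end

section \<open>Side counts of coloured points\<close>

text \<open>Reflecting time exchanges the two ends of the sweep and keeps all levels, so every
  result on the sweep is also available from right to left.\<close>

lemma (in bicolored_lines) reversed: "bicolored_lines P N (\<lambda>i. - \<alpha> i) \<beta>"
proof
  fix i j k t assume *: "i \<in> P \<union> N" "j \<in> P \<union> N" "k \<in> P \<union> N" "i \<noteq> j" "j \<noteq> k" "i \<noteq> k"
    "- \<alpha> i * t + \<beta> i = - \<alpha> j * t + \<beta> j"
  then show "- \<alpha> k * t + \<beta> k \<noteq> - \<alpha> j * t + \<beta> j"
    using nonconcurrent[of i j k "- t"] by simp
qed (use finP finN disj inj in \<open>auto simp: inj_on_def\<close>)

lemma (in bicolored_lines) level_reversed:
  "bicolored_lines.level P N (\<lambda>i. - \<alpha> i) \<beta> i j = level i j"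
proof -
  interpret R: bicolored_lines P N "\<lambda>i. - \<alpha> i" \<beta> by (rule reversed)
  have "(\<beta> j - \<beta> i) / (\<alpha> j - \<alpha> i) = - meet i j"
    unfolding meet_def by (metis minus_diff_eq minus_divide_right)
  then have "R.meet i j = - meet i j" by (simp add: R.meet_def)
  moreover have "R.height k (- t) = height k t" for k t by (simp add: R.height_def height_def)
  ultimately show ?thesis by (simp add: R.level_def level_def)
qed

definition orient :: "('a \<Rightarrow> real) \<Rightarrow> ('a \<Rightarrow> real) \<Rightarrow> 'a \<Rightarrow> 'a \<Rightarrow> 'a \<Rightarrow> real" where
  "orient x y i j k = (x j - x i) * (y k - y i) - (x k - x i) * (y j - y i)"

lemma orient_swap12: "orient x y j i k = - orient x y i j k"
  by (simp add: orient_def algebra_simps)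

lemma orient_rotate: "orient x y j k i = orient x y i j k"
  by (simp add: orient_def algebra_simps)

locale colored_points =
  fixes x y \<sigma> :: "'a \<Rightarrow> real" and I :: "'a set"
  assumes fin: "finite I"
    and sign: "\<And>i. i \<in> I \<Longrightarrow> \<sigma> i = 1 \<or> \<sigma> i = - 1"
    and inj_x: "inj_on x I"
    and orient_nz: "\<And>i j k. \<lbrakk>i \<in> I; j \<in> I; k \<in> I; i \<noteq> j; j \<noteq> k; i \<noteq> k\<rbrakk> \<Longrightarrow> orient x y i j k \<noteq> 0"

text \<open>The vectors on one side of the plane spanned by \<open>i\<close> and \<open>j\<close>,
  seen in the projection: a vector of colour -1 appears on the wrong side of the projected line,
  which the factor \<open>\<sigma> k\<close> corrects. Exchanging \<open>i\<close> and
  \<open>j\<close> gives the other side.\<close>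

definition side_count :: "('a \<Rightarrow> real) \<Rightarrow> ('a \<Rightarrow> real) \<Rightarrow> ('a \<Rightarrow> real) \<Rightarrow> 'a set \<Rightarrow> 'a \<Rightarrow> 'a \<Rightarrow> nat" where
  "side_count x y \<sigma> I i j = card {k \<in> I - {i, j}. \<sigma> k * orient x y i j k > 0}"

text \<open>The part of the weighted sum of squares that belongs to the threshold \<open>J\<close>;
  subtraction on \<open>nat\<close> supplies the truncation.\<close>

definition imbalance :: "('a \<Rightarrow> real) \<Rightarrow> ('a \<Rightarrow> real) \<Rightarrow> ('a \<Rightarrow> real) \<Rightarrow> nat \<Rightarrow> 'a set \<Rightarrow> real" where
  "imbalance x y \<sigma> J I =
    (\<Sum>i\<in>I. \<Sum>j\<in>I - {i}. (1 + 3 * \<sigma> i * \<sigma> j) * real (side_count x y \<sigma> I i j - J))"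

section \<open>The dual arrangement at the leftmost point\<close>

locale leftmost_point = colored_points x y \<sigma> I for x y \<sigma> :: "'a \<Rightarrow> real" and I :: "'a set" +
  fixes v :: 'a
  assumes v: "v \<in> I" and left: "\<And>a. \<lbrakk>a \<in> I; a \<noteq> v\<rbrakk> \<Longrightarrow> x v < x a"
begin

definition I' where "I' = I - {v}"
definition X where "X a = x a - x v"
definition Y where "Y a = y a - y v"
definition s where "s a = \<sigma> a * \<sigma> v"
definition P where "P = {a \<in> I'. s a = 1}"
definition N where "N = {a \<in> I'. s a = - 1}"
text \<open>Together with \<open>\<beta>\<close> this dualises after a projective map sending
  \<open>v\<close> to infinity. A point \<open>(t, h)\<close> of the sweep plane stands for the line
  \<open>h * X + t * Y + 1 = 0\<close>, which misses \<open>v\<close>. Since \<open>v\<close> is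
  leftmost, \<open>X a\<close> is positive, and by \<open>line_eq\<close> the side of this line on
  which \<open>a\<close> lies tells whether the dual line of \<open>a\<close> runs below
  \<open>(t, h)\<close>.\<close>

definition \<alpha> where "\<alpha> a = - (Y a / X a)"
definition \<beta> where "\<beta> a = - (1 / X a)"

lemma fin': "finite I'" using fin by (simp add: I'_def)

lemma X_pos: "a \<in> I' \<Longrightarrow> X a > 0" using left by (simp add: I'_def X_def)

lemma sv: "\<sigma> v = 1 \<or> \<sigma> v = - 1" using sign v by simp

lemma s_cases: "a \<in> I' \<Longrightarrow> s a = 1 \<or> s a = - 1"
  using sign[of a] sv by (auto simp: I'_def s_def)

lemma PN: "P \<union> N = I'" using s_cases by (auto simp: P_def N_def)

lemma orient_XY: "orient x y i j k = (X j - X i) * (Y k - Y i) - (X k - X i) * (Y j - Y i)"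
  by (simp add: orient_def X_def Y_def)

lemma orient_v: "i \<in> I' \<Longrightarrow> j \<in> I' \<Longrightarrow> orient x y i j v = X i * X j * (\<alpha> i - \<alpha> j)"
  using X_pos[of i] X_pos[of j] by (simp add: orient_XY X_def[of v] Y_def[of v] \<alpha>_def field_simps)

lemma orient_v_pos_iff:
  assumes "i \<in> I'" "j \<in> I'"
  shows "orient x y i j v > 0 \<longleftrightarrow> \<alpha> j < \<alpha> i" "orient x y i j v < 0 \<longleftrightarrow> \<alpha> i < \<alpha> j"
  using orient_v[OF assms] X_pos[OF assms(1)] X_pos[OF assms(2)]
  by (auto simp: zero_less_mult_iff mult_less_0_iff)

lemma line_eq: "a \<in> I' \<Longrightarrow> h * X a + t * Y a + 1 = X a * (h - (\<alpha> a * t + \<beta> a))"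
  using X_pos[of a] by (simp add: \<alpha>_def \<beta>_def field_simps)

sublocale L: bicolored_lines P N \<alpha> \<beta>
proof
  show "finite P" "finite N" using fin' by (auto simp: P_def N_def)
  show "P \<inter> N = {}" by (auto simp: P_def N_def)
  show "inj_on \<alpha> (P \<union> N)" unfolding PN
  proof (rule inj_onI, rule ccontr)
    fix i j assume "i \<in> I'" "j \<in> I'" "\<alpha> i = \<alpha> j" "i \<noteq> j"
    then show False using orient_v[of i j] orient_nz[of i j v] v by (auto simp: I'_def)
  qed
  fix i j k t assume ijk: "i \<in> P \<union> N" "j \<in> P \<union> N" "k \<in> P \<union> N" "i \<noteq> j" "j \<noteq> k" "i \<noteq> k"
    and e: "\<alpha> i * t + \<beta> i = \<alpha> j * t + \<beta> j"
  show "\<alpha> k * t + \<beta> k \<noteq> \<alpha> j * t + \<beta> j"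
  proof
    assume e': "\<alpha> k * t + \<beta> k = \<alpha> j * t + \<beta> j"
    define h where "h = \<alpha> j * t + \<beta> j"
    have i: "h * X i + t * Y i + 1 = 0" and j: "h * X j + t * Y j + 1 = 0" and k: "h * X k + t * Y k + 1 = 0"
      using line_eq ijk e e' by (auto simp: PN h_def)
    \<comment> \<open>Three concurrent dual lines would put three points on one line.\<close>
    have "h * orient x y i j k = 0" "t * orient x y i j k = 0"
      unfolding orient_XY using i j k by algebra+
    moreover have "h \<noteq> 0 \<or> t \<noteq> 0" using i by auto
    ultimately show False using orient_nz[of i j k] ijk by (auto simp: PN I'_def)
  qed
qed

sublocale R: bicolored_lines P N "\<lambda>i. - \<alpha> i" \<beta>
  by (rule L.reversed)

lemma side_count_level:
  assumes ij: "i \<in> I'" "j \<in> I'" "i \<noteq> j" and pos: "\<sigma> v * orient x y i j v > 0"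
  shows "side_count x y \<sigma> I' i j = L.level i j"
proof -
  define t where "t = L.meet i j"
  define h where "h = L.height i t"
  have "\<alpha> i \<noteq> \<alpha> j" using L.slope_eq[of i j] ij PN by auto
  then have hj: "h = L.height j t" unfolding h_def t_def by (rule L.height_meet)
  have i: "h * X i + t * Y i + 1 = 0" and j: "h * X j + t * Y j + 1 = 0"
    using line_eq ij hj by (auto simp: h_def L.height_def)
  \<comment> \<open>Both sides are affine in the point \<open>k\<close>, vanish at \<open>i\<close>
    and \<open>j\<close>, and agree at \<open>v\<close>, where \<open>X\<close> and \<open>Y\<close>
    are 0.\<close>
  have o: "orient x y i j k = orient x y i j v * (h * X k + t * Y k + 1)" for k
    unfolding orient_XY X_def[of v] Y_def[of v] using i j by (simp, algebra)
  have "\<sigma> k * orient x y i j k = (\<sigma> v * orient x y i j v * X k) * (s k * (h - L.height k t))"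
    if "k \<in> I'" for k
  proof -
    have "\<sigma> k = s k * \<sigma> v" using sv by (auto simp: s_def)
    then show ?thesis unfolding o[of k] line_eq[OF that] L.height_def by (simp only: mult_ac)
  qed
  then have iff: "\<sigma> k * orient x y i j k > 0 \<longleftrightarrow> s k * (h - L.height k t) > 0" if "k \<in> I'" for k
    using that mult_pos_pos[OF pos X_pos[OF that]] by (metis mult_pos_pos zero_less_mult_pos)
  have "{k \<in> I' - {i, j}. \<sigma> k * orient x y i j k > 0} =
      {k \<in> P - {i, j}. L.height k t < h} \<union> {k \<in> N - {i, j}. h < L.height k t}"
  proof -
    have "\<sigma> k * orient x y i j k > 0 \<longleftrightarrow> s k = 1 \<and> L.height k t < h \<or> s k = - 1 \<and> h < L.height k t"
      if "k \<in> I'" for k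
      using iff[OF that] s_cases[OF that] by auto
    then show ?thesis by (auto simp: P_def N_def)
  qed
  then have "side_count x y \<sigma> I' i j = card ({k \<in> P - {i, j}. L.height k t < h} \<union> {k \<in> N - {i, j}. h < L.height k t})"
    by (simp add: side_count_def)
  also have "\<dots> = card {k \<in> P - {i, j}. L.height k t < h} + card {k \<in> N - {i, j}. h < L.height k t}"
    using L.finP L.finN L.disj by (intro card_Un_disjoint) auto
  finally show ?thesis by (simp add: L.level_def h_def t_def)
qed

lemma side_count_insert:
  assumes ij: "i \<in> I'" "j \<in> I'"
  shows "side_count x y \<sigma> I i j = side_count x y \<sigma> I' i j + (if \<sigma> v * orient x y i j v > 0 then 1 else 0)"
proof -
  have "{k \<in> I - {i, j}. \<sigma> k * orient x y i j k > 0} =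
     (if \<sigma> v * orient x y i j v > 0 then insert v else id) {k \<in> I' - {i, j}. \<sigma> k * orient x y i j k > 0}"
    using ij v by (auto simp: I'_def)
  then show ?thesis using fin' by (auto simp: side_count_def I'_def)
qed

text \<open>Lines through \<open>v\<close> are dual to points at infinity, so the two orders of the
  pair \<open>v\<close>, \<open>b\<close> see the two ends of the sweep. Which order sees which end
  depends on the colour of \<open>v\<close>; only the sum is independent of it.\<close>

lemma side_count_end:
  assumes b: "b \<in> I'"
  shows "(side_count x y \<sigma> I v b - J) + (side_count x y \<sigma> I b v - J) = (L.end_level b - J) + (R.end_level b - J)"
proof -
  have o1: "orient x y v b k > 0 \<longleftrightarrow> \<alpha> k < \<alpha> b" "orient x y v b k < 0 \<longleftrightarrow> \<alpha> b < \<alpha> k"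
    "orient x y b v k > 0 \<longleftrightarrow> \<alpha> b < \<alpha> k" "orient x y b v k < 0 \<longleftrightarrow> \<alpha> k < \<alpha> b" if "k \<in> I'" for k
    using orient_v_pos_iff[OF b that] orient_rotate[of x y b k v] orient_swap12[of x y b v k] by auto
  have I: "I - {v, b} = I' - {b}" "I - {b, v} = I' - {b}" by (auto simp: I'_def)
  have un: "card ({k \<in> P. Q k} \<union> {k \<in> N. Q' k}) = card {k \<in> P. Q k} + card {k \<in> N. Q' k}" for Q Q'
    using L.finP L.finN L.disj by (intro card_Un_disjoint) auto
  consider "\<sigma> v = 1" | "\<sigma> v = - 1" using sv by blast
  then show ?thesis
  proof cases
    case 1
    have "\<sigma> k * orient x y v b k > 0 \<longleftrightarrow> s k = 1 \<and> \<alpha> k < \<alpha> b \<or> s k = - 1 \<and> \<alpha> b < \<alpha> k"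
      "\<sigma> k * orient x y b v k > 0 \<longleftrightarrow> s k = 1 \<and> \<alpha> b < \<alpha> k \<or> s k = - 1 \<and> \<alpha> k < \<alpha> b" if "k \<in> I'" for k
      using s_cases[OF that] o1[OF that] 1 by (auto simp: s_def)
    then have "{k \<in> I' - {b}. \<sigma> k * orient x y v b k > 0} = {k \<in> P. \<alpha> k < \<alpha> b} \<union> {k \<in> N. \<alpha> b < \<alpha> k}"
      "{k \<in> I' - {b}. \<sigma> k * orient x y b v k > 0} = {k \<in> P. - \<alpha> k < - \<alpha> b} \<union> {k \<in> N. - \<alpha> b < - \<alpha> k}"
      by (auto simp: P_def N_def)
    then show ?thesis unfolding side_count_def I L.end_level_def R.end_level_def by (simp add: un)
  next
    case 2
    have "\<sigma> k * orient x y b v k > 0 \<longleftrightarrow> s k = 1 \<and> \<alpha> k < \<alpha> b \<or> s k = - 1 \<and> \<alpha> b < \<alpha> k"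
      "\<sigma> k * orient x y v b k > 0 \<longleftrightarrow> s k = 1 \<and> \<alpha> b < \<alpha> k \<or> s k = - 1 \<and> \<alpha> k < \<alpha> b" if "k \<in> I'" for k
      using s_cases[OF that] o1[OF that] 2 by (auto simp: s_def)
    then have "{k \<in> I' - {b}. \<sigma> k * orient x y b v k > 0} = {k \<in> P. \<alpha> k < \<alpha> b} \<union> {k \<in> N. \<alpha> b < \<alpha> k}"
      "{k \<in> I' - {b}. \<sigma> k * orient x y v b k > 0} = {k \<in> P. - \<alpha> k < - \<alpha> b} \<union> {k \<in> N. - \<alpha> b < - \<alpha> k}"
      by (auto simp: P_def N_def)
    then show ?thesis unfolding side_count_def I L.end_level_def R.end_level_def by (simp add: un)
  qed
qed

text \<open>The positivity condition selects one order of each pair, so the pairs may be listed by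
  increasing slope instead. \<open>B\<close> and \<open>D\<close> separate the mixed pairs according
  to the colour of the smaller slope, that is, according to the direction of the sweep that treats
  them.\<close>

lemma sum_level_pairs:
  fixes J :: nat
  defines "W \<equiv> {(i, j). i \<in> I' \<and> j \<in> I' \<and> i \<noteq> j \<and> \<sigma> v * orient x y i j v > 0 \<and> J \<le> L.level i j}"
  defines "S \<equiv> {(i, j). (i \<in> P \<and> j \<in> P \<or> i \<in> N \<and> j \<in> N) \<and> \<alpha> i < \<alpha> j \<and> J \<le> L.level i j}"
    and "B \<equiv> {(a, c). a \<in> P \<and> c \<in> N \<and> \<alpha> a < \<alpha> c \<and> J \<le> L.level a c}"
    and "D \<equiv> {(a, c). a \<in> P \<and> c \<in> N \<and> - \<alpha> a < - \<alpha> c \<and> J \<le> L.level a c}"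
  shows "(\<Sum>(i, j)\<in>W. 1 + 3 * \<sigma> i * \<sigma> j) = 4 * real (card S) - 2 * real (card B) - 2 * real (card D)"
proof -
  define W0 where "W0 = {(i, j). i \<in> I' \<and> j \<in> I' \<and> \<alpha> i < \<alpha> j \<and> J \<le> L.level i j}"
  have sub: "W0 \<subseteq> I' \<times> I'" by (auto simp: W0_def)
  have comm: "L.level i j = L.level j i" if "i \<in> I'" "j \<in> I'" for i j
    using L.level_commute[of i j] L.slope_eq[of i j] that PN by (cases "i = j") auto
  have ss: "\<sigma> i * \<sigma> j = s i * s j" for i j using sv by (auto simp: s_def)
  have "(\<Sum>(i, j)\<in>W. 1 + 3 * \<sigma> i * \<sigma> j) = (\<Sum>(i, j)\<in>W0. 1 + 3 * \<sigma> i * \<sigma> j)"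
  proof -
    consider "\<sigma> v = 1" | "\<sigma> v = - 1" using sv by blast
    then show ?thesis
    proof cases
      case 1
      then have "W = prod.swap ` W0"
        using orient_v_pos_iff comm by (auto simp: W_def W0_def image_iff)
      then show ?thesis by (simp add: sum.reindex case_prod_beta mult.commute mult.left_commute)
    next
      case 2
      then have "W = W0" using orient_v_pos_iff by (auto simp: W_def W0_def)
      then show ?thesis by simp
    qed
  qed
  also have "W0 = S \<union> B \<union> prod.swap ` D"
  proof -
    have "L.level c a = L.level a c" if "a \<in> P" "c \<in> N" for a c using comm that PN by blast
    then show ?thesis unfolding W0_def PN[symmetric] by (auto simp: S_def B_def D_def image_iff) metis+
  qed
  also have "(\<Sum>(i, j)\<in>\<dots>. 1 + 3 * \<sigma> i * \<sigma> j) = (\<Sum>(i, j)\<in>S. 1 + 3 * \<sigma> i * \<sigma> j)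
      + (\<Sum>(i, j)\<in>B. 1 + 3 * \<sigma> i * \<sigma> j) + (\<Sum>(i, j)\<in>prod.swap ` D. 1 + 3 * \<sigma> i * \<sigma> j)"
  proof -
    have f: "finite (I' \<times> I')" using fin' by simp
    have "S \<subseteq> I' \<times> I'" "B \<subseteq> I' \<times> I'" "prod.swap ` D \<subseteq> I' \<times> I'"
      unfolding PN[symmetric] by (auto simp: S_def B_def D_def)
    then have "finite S" "finite B" "finite (prod.swap ` D)" using f finite_subset by blast+
    moreover have "S \<inter> B = {}" "(S \<union> B) \<inter> prod.swap ` D = {}"
      using L.disj by (auto simp: S_def B_def D_def)
    ultimately show ?thesis by (simp add: sum.union_disjoint)
  qed
  also have "(\<Sum>(i, j)\<in>S. 1 + 3 * \<sigma> i * \<sigma> j) = (\<Sum>(i, j)\<in>S. 4)"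
    by (rule sum.cong) (auto simp: S_def P_def N_def ss mult.assoc)
  also have "(\<Sum>(i, j)\<in>B. 1 + 3 * \<sigma> i * \<sigma> j) = (\<Sum>(i, j)\<in>B. - 2)"
    by (rule sum.cong) (auto simp: B_def P_def N_def ss mult.assoc)
  also have "(\<Sum>(i, j)\<in>prod.swap ` D. 1 + 3 * \<sigma> i * \<sigma> j) = (\<Sum>(i, j)\<in>prod.swap ` D. - 2)"
    by (rule sum.cong) (auto simp: D_def P_def N_def ss mult.assoc)
  also have "(\<Sum>(i, j)\<in>S. 4) + (\<Sum>(i, j)\<in>B. - 2) + (\<Sum>(i, j)\<in>prod.swap ` D. - 2)
      = 4 * real (card S) - 2 * real (card B) - 2 * real (card D)"
    by (simp add: case_prod_beta card_image)
  finally show ?thesis .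
qed

text \<open>Restoring \<open>v\<close> changes the pairs inside \<open>I'\<close> by
  \<open>4 * card S - 2 * card B - 2 * card D\<close>. By \<open>card_end_pairs\<close> the pairs
  containing \<open>v\<close> have the same total excess \<open>card FL + card FR\<close> in both
  colours, with weights 4 and -2, which leaves twice that total. The forward sweep gives
  \<open>card B \<le> card S + card FL\<close>, the backward sweep
  \<open>card D \<le> card S + card FR\<close>, and these balance the account.\<close>

lemma imbalance_mono:
  assumes "card {i \<in> I. \<sigma> i = 1} \<le> J + 1" "card {i \<in> I. \<sigma> i = - 1} \<le> J + 1"
  shows "imbalance x y \<sigma> J I' \<le> imbalance x y \<sigma> J I"
proof -
  let ?e = "\<lambda>i j. 1 + 3 * \<sigma> i * \<sigma> j"
  let ?m = "\<lambda>I i j. side_count x y \<sigma> I i j"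
  define W where "W = {(i, j). i \<in> I' \<and> j \<in> I' \<and> i \<noteq> j \<and> \<sigma> v * orient x y i j v > 0 \<and> J \<le> L.level i j}"
  define S where "S = {(i, j). (i \<in> P \<and> j \<in> P \<or> i \<in> N \<and> j \<in> N) \<and> \<alpha> i < \<alpha> j \<and> J \<le> L.level i j}"
  define S' where "S' = {(i, j). (i \<in> P \<and> j \<in> P \<or> i \<in> N \<and> j \<in> N) \<and> - \<alpha> i < - \<alpha> j \<and> J \<le> L.level i j}"
  define B where "B = {(a, c). a \<in> P \<and> c \<in> N \<and> \<alpha> a < \<alpha> c \<and> J \<le> L.level a c}"
  define D where "D = {(a, c). a \<in> P \<and> c \<in> N \<and> - \<alpha> a < - \<alpha> c \<and> J \<le> L.level a c}"
  define u where "u b = (L.end_level b - J) + (R.end_level b - J)" for b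
  have cP: "card P \<le> J + 1" and cN: "card N \<le> J + 1"
  proof -
    have "P \<subseteq> {i \<in> I. \<sigma> i = 1} \<and> N \<subseteq> {i \<in> I. \<sigma> i = - 1} \<or> P \<subseteq> {i \<in> I. \<sigma> i = - 1} \<and> N \<subseteq> {i \<in> I. \<sigma> i = 1}"
      using sv by (auto simp: P_def N_def I'_def s_def)
    moreover have "finite {i \<in> I. \<sigma> i = 1}" "finite {i \<in> I. \<sigma> i = - 1}" using fin by auto
    ultimately have "card P \<le> card {i \<in> I. \<sigma> i = 1} \<and> card N \<le> card {i \<in> I. \<sigma> i = - 1}
      \<or> card P \<le> card {i \<in> I. \<sigma> i = - 1} \<and> card N \<le> card {i \<in> I. \<sigma> i = 1}"
      by (meson card_mono)
    then show "card P \<le> J + 1" "card N \<le> J + 1" using assms by auto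
  qed
  define FL where "FL = {(a, c). a \<in> P \<and> c \<in> N \<and> \<alpha> a < \<alpha> c \<and> L.slope_rank N c + J + 1 \<le> L.slope_rank P a + card N}"
  define FR where "FR = {(a, c). a \<in> P \<and> c \<in> N \<and> - \<alpha> a < - \<alpha> c \<and> R.slope_rank N c + J + 1 \<le> R.slope_rank P a + card N}"
  have BS: "card B \<le> card S + card FL"
    unfolding B_def S_def FL_def by (rule L.mixed_meets_le)
  have "card D \<le> card S' + card FR"
    unfolding D_def S'_def FR_def using R.mixed_meets_le[of J] by (simp only: L.level_reversed)
  moreover have "S' = prod.swap ` S"
  proof -
    have "L.level i j = L.level j i" if "\<alpha> i < \<alpha> j" for i j
      using L.level_commute[of i j] that by simp
    then show ?thesis by (auto simp: S'_def S_def image_iff)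
  qed
  then have "card S' = card S" by (simp add: card_image)
  ultimately have DS: "card D \<le> card S + card FR" by simp
  have uP: "(\<Sum>b\<in>P. u b) = card FL + card FR" and uN: "(\<Sum>b\<in>N. u b) = card FL + card FR"
    using L.card_end_pairs[OF cP cN] R.card_end_pairs[OF cP cN]
    by (simp_all add: u_def sum.distrib FL_def FR_def)
  have ev: "?e v b = 1 + 3 * s b" for b by (simp add: s_def)
  have Isplit: "I = insert v I'" "v \<notin> I'" using v by (auto simp: I'_def)
  have W: "W \<subseteq> (SIGMA i:I'. I' - {i})" by (auto simp: W_def)
  have "imbalance x y \<sigma> J I = (\<Sum>j\<in>I'. ?e v j * real (?m I v j - J))
      + (\<Sum>i\<in>I'. ?e i v * real (?m I i v - J) + (\<Sum>j\<in>I' - {i}. ?e i j * real (?m I i j - J)))"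
  proof -
    have "(\<Sum>j\<in>I - {i}. f j) = f v + (\<Sum>j\<in>I' - {i}. f j)" if "i \<in> I'" for i and f :: "'a \<Rightarrow> real"
    proof -
      have "I - {i} = insert v (I' - {i})" using that v by (auto simp: I'_def)
      then show ?thesis using fin' Isplit by simp
    qed
    moreover have "(\<Sum>i\<in>I. g i) = g v + (\<Sum>i\<in>I'. g i)" for g :: "'a \<Rightarrow> real"
      using Isplit(2) fin' by (subst Isplit(1)) simp
    ultimately show ?thesis by (simp add: imbalance_def I'_def)
  qed
  also have "\<dots> = (\<Sum>b\<in>I'. ?e v b * real (u b)) + (\<Sum>i\<in>I'. \<Sum>j\<in>I' - {i}. ?e i j * real (?m I i j - J))"
  proof -
    have "?e v b * real (u b) = ?e v b * real (?m I v b - J) + ?e b v * real (?m I b v - J)" if "b \<in> I'" for b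
      unfolding u_def side_count_end[OF that, symmetric] by (simp add: algebra_simps)
    then have "(\<Sum>b\<in>I'. ?e v b * real (u b))
        = (\<Sum>b\<in>I'. ?e v b * real (?m I v b - J)) + (\<Sum>b\<in>I'. ?e b v * real (?m I b v - J))"
      unfolding sum.distrib[symmetric] by (rule sum.cong[OF refl])
    then show ?thesis by (simp add: sum.distrib)
  qed
  also have "(\<Sum>i\<in>I'. \<Sum>j\<in>I' - {i}. ?e i j * real (?m I i j - J))
      = (\<Sum>i\<in>I'. \<Sum>j\<in>I' - {i}. ?e i j * real (?m I' i j - J) + (if (i, j) \<in> W then ?e i j else 0))"
  proof (intro sum.cong refl)
    fix i j assume ij: "i \<in> I'" "j \<in> I' - {i}"
    show "?e i j * real (?m I i j - J) = ?e i j * real (?m I' i j - J) + (if (i, j) \<in> W then ?e i j else 0)"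
    \<comment> \<open>Raising a side count by one raises its truncated excess only if the count had
      reached \<open>J\<close> already; hence the level condition in \<open>W\<close>.\<close>
    proof (cases "\<sigma> v * orient x y i j v > 0")
      case True
      then show ?thesis using ij side_count_insert[of i j] side_count_level[of i j]
        by (auto simp: W_def Suc_diff_le algebra_simps not_le)
    next
      case False
      then show ?thesis using ij side_count_insert[of i j] by (auto simp: W_def)
    qed
  qed
  also have "\<dots> = imbalance x y \<sigma> J I' + (\<Sum>i\<in>I'. \<Sum>j\<in>I' - {i}. if (i, j) \<in> W then ?e i j else 0)"
    by (simp add: imbalance_def sum.distrib)
  also have "(\<Sum>i\<in>I'. \<Sum>j\<in>I' - {i}. if (i, j) \<in> W then ?e i j else 0)
      = (\<Sum>(i, j)\<in>(SIGMA i:I'. I' - {i}). if (i, j) \<in> W then ?e i j else 0)"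
    using fin' by (subst sum.Sigma) auto
  also have "\<dots> = (\<Sum>(i, j)\<in>W. ?e i j)"
    using W fin' by (intro sum.mono_neutral_cong_right) auto
  also have "\<dots> = 4 * real (card S) - 2 * real (card B) - 2 * real (card D)"
    unfolding W_def S_def B_def D_def by (rule sum_level_pairs)
  also have "(\<Sum>b\<in>I'. ?e v b * real (u b)) = (\<Sum>b\<in>P. ?e v b * real (u b)) + (\<Sum>b\<in>N. ?e v b * real (u b))"
    using L.finP L.finN L.disj unfolding PN[symmetric] by (rule sum.union_disjoint)
  also have "(\<Sum>b\<in>P. ?e v b * real (u b)) = 4 * real (\<Sum>b\<in>P. u b)"
    unfolding of_nat_sum sum_distrib_left ev by (rule sum.cong) (auto simp: P_def)
  also have "(\<Sum>b\<in>N. ?e v b * real (u b)) = - 2 * real (\<Sum>b\<in>N. u b)"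
    unfolding of_nat_sum sum_distrib_left ev by (rule sum.cong) (auto simp: N_def)
  finally show ?thesis using BS DS uP uN by simp
qed

end

lemma imbalance_nonneg:
  assumes "colored_points x y \<sigma> I"
    and "card {i \<in> I. \<sigma> i = 1} \<le> J + 1" "card {i \<in> I. \<sigma> i = - 1} \<le> J + 1"
  shows "imbalance x y \<sigma> J I \<ge> 0"
  using assms
proof (induction "card I" arbitrary: I)
  case 0
  then have "I = {}" using colored_points.fin by fastforce
  then show ?case by (simp add: imbalance_def)
next
  case (Suc n)
  interpret C: colored_points x y \<sigma> I by fact
  have "I \<noteq> {}" using Suc(2) by auto
  define v where "v = arg_min_on x I"
  have v: "v \<in> I" "\<And>a. a \<in> I \<Longrightarrow> x v \<le> x a"
    using arg_min_if_finite[OF C.fin \<open>I \<noteq> {}\<close>, of x] by (auto simp: v_def not_less)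
  interpret L: leftmost_point x y \<sigma> I v
  proof
    fix a assume "a \<in> I" "a \<noteq> v"
    then show "x v < x a" using v C.inj_x by (metis inj_onD order_le_imp_less_or_eq)
  qed fact
  have cp: "colored_points x y \<sigma> (I - {v})"
  proof
    show "inj_on x (I - {v})" using C.inj_x by (auto intro: inj_on_diff)
  qed (use C.fin C.sign C.orient_nz in auto)
  have "card {i \<in> I - {v}. \<sigma> i = c} \<le> card {i \<in> I. \<sigma> i = c}" for c
    using C.fin by (intro card_mono) auto
  then have "card {i \<in> I - {v}. \<sigma> i = 1} \<le> J + 1" "card {i \<in> I - {v}. \<sigma> i = - 1} \<le> J + 1"
    using Suc(4,5) by (meson order_trans)+
  moreover have "n = card (I - {v})" using Suc(2) v by simp
  ultimately have "imbalance x y \<sigma> J (I - {v}) \<ge> 0" using Suc(1) cp by blast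
  then show ?case using L.imbalance_mono[OF Suc(4,5)] by (simp add: L.I'_def)
qed

section \<open>Counting quadruples\<close>

lemma sum_truncated_diff:
  assumes "e \<le> (m :: nat)"
  shows "(\<Sum>i\<le>m. real (e - i)) = real e * (real e + 1) / 2"
  using assms
proof (induction m arbitrary: e)
  case (Suc m)
  show ?case
  proof (cases "e = Suc m")
    case True
    have "(\<Sum>i\<le>Suc m. real (e - i)) = (\<Sum>i\<le>m. real (m - i) + 1)"
      unfolding True by (auto simp: Suc_diff_le simp del: of_nat_diff intro!: sum.cong)
    also have "\<dots> = (\<Sum>i\<le>m. real (m - i)) + (real m + 1)" by (simp only: sum.distrib) simp
    also have "\<dots> = real m * (real m + 1) / 2 + (real m + 1)" using Suc.IH[of m] by simp
    finally show ?thesis using True by (simp add: field_simps)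
  next
    case False
    then show ?thesis using Suc by simp
  qed
qed simp

text \<open>Only the larger of \<open>L\<close> and \<open>R\<close> can exceed their mean
  \<open>a\<close>. If it does so by \<open>e\<close>, its excesses add up to
  \<open>e * (e + 1) / 2\<close>, where \<open>2 * e\<close> is the absolute difference of
  \<open>L\<close> and \<open>R\<close>.\<close>

lemma sum_truncated_diff_pair:
  assumes "L + R = 2 * a"
  shows "(\<Sum>i\<le>2 * a. real (L - (a + i)) + real (R - (a + i))) =
    ((real L - real R)\<^sup>2 / 4 + \<bar>real L - real R\<bar> / 2) / 2"
proof -
  have aux: "(\<Sum>i\<le>2 * a. real (L - (a + i)) + real (R - (a + i))) =
      ((real L - real R)\<^sup>2 / 4 + \<bar>real L - real R\<bar> / 2) / 2"
    if LR: "L + R = 2 * a" "R \<le> L" for L R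
  proof -
    define e where "e = L - a"
    have e: "L = a + e" "R = a - e" "e \<le> a" using LR by (auto simp: e_def)
    have "(\<Sum>i\<le>2 * a. real (L - (a + i)) + real (R - (a + i))) = (\<Sum>i\<le>2 * a. real (e - i))"
      by (rule sum.cong) (auto simp: e)
    also have "\<dots> = real e * (real e + 1) / 2" using e by (intro sum_truncated_diff) simp
    also have "real L - real R = 2 * real e" using e by (simp add: of_nat_diff)
    then have "real e * (real e + 1) / 2 = ((real L - real R)\<^sup>2 / 4 + \<bar>real L - real R\<bar> / 2) / 2"
      by (simp add: power2_eq_square field_simps)
    finally show ?thesis .
  qed
  show ?thesis
  proof (cases "R \<le> L")
    case True then show ?thesis using aux assms by blast
  next
    case False
    then have "(\<Sum>i\<le>2 * a. real (R - (a + i)) + real (L - (a + i))) =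
      ((real R - real L)\<^sup>2 / 4 + \<bar>real R - real L\<bar> / 2) / 2" using aux[of R L] assms by simp
    then show ?thesis by (simp add: add.commute power2_commute abs_minus_commute)
  qed
qed

section \<open>Signs of a single quadruple\<close>

lemma orient_same [simp]: "orient x y i i k = 0" "orient x y i k i = 0" "orient x y i k k = 0"
  by (auto simp: orient_def)

lemma orient_four: "orient x y j k l - orient x y i k l + orient x y i j l - orient x y i j k = 0"
  by (simp add: orient_def algebra_simps)

lemma alternating_signs:
  fixes a b c d :: real
  assumes "a - b + c - d = 0" "a \<noteq> 0"
  shows "\<not> (sgn a = - sgn b \<and> sgn a = sgn c \<and> sgn a = - sgn d)"
proof
  assume *: "sgn a = - sgn b \<and> sgn a = sgn c \<and> sgn a = - sgn d"
  consider "a > 0" | "a < 0" using assms(2) by linarith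
  then show False
  proof cases
    case 1
    then have "sgn b = - 1" "sgn c = 1" "sgn d = - 1" using * by (simp_all add: sgn_if split: if_splits)
    then show False using assms(1) 1 by (simp add: sgn_1_pos sgn_1_neg)
  next
    case 2
    then have "sgn b = 1" "sgn c = - 1" "sgn d = 1" using * by (simp_all add: sgn_if split: if_splits)
    then show False using assms(1) 2 by (simp add: sgn_1_pos sgn_1_neg)
  qed
qed

text \<open>A, B, C, D are the signs of the four triples, so that (A, -B, C, -D) are the signs of the
  linear dependency of the four vectors. The last assumption holds because the coefficients of an
  affine dependency of the four projected points add up to 0.\<close>

lemma six_pairs_identity:
  fixes A B C D s1 s2 s3 s4 :: real
  assumes "s1 = 1 \<or> s1 = -1" "s2 = 1 \<or> s2 = -1" "s3 = 1 \<or> s3 = -1" "s4 = 1 \<or> s4 = -1"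
    and "A = 1 \<or> A = -1" "B = 1 \<or> B = -1" "C = 1 \<or> C = -1" "D = 1 \<or> D = -1"
    and "\<not> (s1 * A = - (s2 * B) \<and> s1 * A = s3 * C \<and> s1 * A = - (s4 * D))"
  shows "(1 + 3 * s1 * s2) * (D * C) - (1 + 3 * s1 * s3) * (D * B) + (1 + 3 * s1 * s4) * (C * B)
      + (1 + 3 * s2 * s3) * (D * A) - (1 + 3 * s2 * s4) * (C * A) + (1 + 3 * s3 * s4) * (B * A)
    = 8 * (of_bool (B = - A \<and> C = - A \<and> D = A) + of_bool (B = A \<and> C = A \<and> D = A)
        + of_bool (B = A \<and> C = - A \<and> D = - A)) - 3 + 3 * (s1 * s2 * s3 * s4)"
  using assms by (elim disjE; simp)

text \<open>Admitting all orders and repetitions makes the sum symmetric and lets products factor;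
  the quadruples with a repetition cost only a cubic error.\<close>

definition sum4 :: "'a set \<Rightarrow> ('a \<Rightarrow> 'a \<Rightarrow> 'a \<Rightarrow> 'a \<Rightarrow> real) \<Rightarrow> real" where
  "sum4 I g = (\<Sum>i\<in>I. \<Sum>j\<in>I. \<Sum>k\<in>I. \<Sum>l\<in>I. g i j k l)"

lemma sum4_swap12: "sum4 I (\<lambda>i j k l. g j i k l) = sum4 I g"
  unfolding sum4_def by (rule sum.swap)

lemma sum4_swap23: "sum4 I (\<lambda>i j k l. g i k j l) = sum4 I g"
  unfolding sum4_def by (intro sum.cong refl sum.swap)

lemma sum4_swap34: "sum4 I (\<lambda>i j k l. g i j l k) = sum4 I g"
  unfolding sum4_def by (intro sum.cong refl sum.swap)

lemma sum4_perms:
  "sum4 I (\<lambda>i j k l. g i l j k) = sum4 I g"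
  "sum4 I (\<lambda>i j k l. g j k i l) = sum4 I g"
  "sum4 I (\<lambda>i j k l. g j l i k) = sum4 I g"
  "sum4 I (\<lambda>i j k l. g k l i j) = sum4 I g"
proof -
  show 1: "sum4 I (\<lambda>i j k l. g i l j k) = sum4 I g"
    using sum4_swap34[of I "\<lambda>i j k l. g i k j l"] sum4_swap23[of I g] by simp
  show 2: "sum4 I (\<lambda>i j k l. g j k i l) = sum4 I g"
    using sum4_swap12[of I "\<lambda>i j k l. g i k j l"] sum4_swap23[of I g] by simp
  show 3: "sum4 I (\<lambda>i j k l. g j l i k) = sum4 I g"
    using sum4_swap12[of I "\<lambda>i j k l. g i l j k"] 1 by simp
  show 4: "sum4 I (\<lambda>i j k l. g k l i j) = sum4 I g"
    using sum4_swap23[of I "\<lambda>i j k l. g j l i k"] 3 by simp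
qed

lemma sum4_add: "sum4 I (\<lambda>i j k l. f i j k l + g i j k l) = sum4 I f + sum4 I g"
  by (simp add: sum4_def sum.distrib)

lemma sum4_mult: "sum4 I (\<lambda>i j k l. c * f i j k l) = c * sum4 I f"
  by (simp add: sum4_def sum_distrib_left)

lemma sum4_mono:
  "(\<And>i j k l. \<lbrakk>i \<in> I; j \<in> I; k \<in> I; l \<in> I\<rbrakk> \<Longrightarrow> f i j k l \<le> g i j k l) \<Longrightarrow> sum4 I f \<le> sum4 I g"
  unfolding sum4_def by (intro sum_mono) auto

lemma sum4_const: "sum4 I (\<lambda>i j k l. c) = c * real (card I) ^ 4"
  by (simp add: sum4_def power4_eq_xxxx)

lemma sum4_prod: "sum4 I (\<lambda>i j k l. f i * f j * f k * f l) = (\<Sum>i\<in>I. f i) ^ 4"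
  by (simp add: sum4_def power4_eq_xxxx sum_distrib_left sum_distrib_right mult_ac)

text \<open>For determinant signs \<open>\<tau>\<close> this says that \<open>i\<close> and
  \<open>j\<close> carry one sign in the linear dependency of the four vectors and \<open>k\<close>
  and \<open>l\<close> the other, so that the cones over the two pairs meet.\<close>

definition crossing_signs :: "('a \<Rightarrow> 'a \<Rightarrow> 'a \<Rightarrow> real) \<Rightarrow> 'a \<Rightarrow> 'a \<Rightarrow> 'a \<Rightarrow> 'a \<Rightarrow> bool" where
  "crossing_signs \<tau> i j k l \<longleftrightarrow> \<tau> j k l \<noteq> 0 \<and> \<tau> i k l = - \<tau> j k l \<and> \<tau> i j l = - \<tau> j k l \<and> \<tau> i j k = \<tau> j k l"

context colored_points
begin

definition chi where "chi i j k = \<sigma> i * \<sigma> j * \<sigma> k * sgn (orient x y i j k)"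

text \<open>The number \<open>d i j\<close> of the overview: \<open>chi\<close> is the sign of the
  determinant of the three vectors, recovered from the projection, and it vanishes when indices
  repeat.\<close>

definition net where "net i j = (\<Sum>k\<in>I. chi i j k)"

lemma side_count_add:
  assumes "i \<in> I" "j \<in> I" "i \<noteq> j"
  shows "side_count x y \<sigma> I i j + side_count x y \<sigma> I j i = card I - 2"
proof -
  have "side_count x y \<sigma> I i j + side_count x y \<sigma> I j i =
    card ({k \<in> I - {i, j}. \<sigma> k * orient x y i j k > 0} \<union> {k \<in> I - {j, i}. \<sigma> k * orient x y j i k > 0})"
    unfolding side_count_def using fin
    by (subst card_Un_disjoint) (auto simp: orient_swap12[of x y j i])
  also have "{k \<in> I - {i, j}. \<sigma> k * orient x y i j k > 0} \<union> {k \<in> I - {j, i}. \<sigma> k * orient x y j i k > 0} = I - {i, j}"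
  proof -
    have "\<sigma> k * orient x y i j k \<noteq> 0" if "k \<in> I - {i, j}" for k
      using sign[of k] orient_nz[of i j k] that assms by auto
    then have "\<sigma> k * orient x y i j k > 0 \<or> \<sigma> k * orient x y i j k < 0" if "k \<in> I - {i, j}" for k
      using that by (meson linorder_neqE_linordered_idom)
    then show ?thesis by (auto simp: orient_swap12[of x y j i])
  qed
  also have "card \<dots> = card I - 2" using assms fin by (subst card_Diff_subset) auto
  finally show ?thesis .
qed

lemma net_eq:
  assumes "i \<in> I" "j \<in> I"
  shows "net i j = (if i = j then 0 else \<sigma> i * \<sigma> j * (real (side_count x y \<sigma> I i j) - real (side_count x y \<sigma> I j i)))"
proof (cases "i = j")
  case False
  have "net i j = \<sigma> i * \<sigma> j * (\<Sum>k\<in>I. \<sigma> k * sgn (orient x y i j k))"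
    by (simp add: net_def chi_def sum_distrib_left mult.assoc)
  also have "(\<Sum>k\<in>I. \<sigma> k * sgn (orient x y i j k))
    = (\<Sum>k\<in>I. of_bool (k \<in> {k \<in> I - {i, j}. \<sigma> k * orient x y i j k > 0})
         - of_bool (k \<in> {k \<in> I - {j, i}. \<sigma> k * orient x y j i k > 0}))"
  proof (rule sum.cong[OF refl])
    fix k assume "k \<in> I"
    then show "\<sigma> k * sgn (orient x y i j k) = of_bool (k \<in> {k \<in> I - {i, j}. \<sigma> k * orient x y i j k > 0})
         - of_bool (k \<in> {k \<in> I - {j, i}. \<sigma> k * orient x y j i k > 0})"
      using sign[of k] by (auto simp: orient_swap12[of x y j i] sgn_if)
  qed
  also have "\<dots> = real (side_count x y \<sigma> I i j) - real (side_count x y \<sigma> I j i)"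
  proof -
    have cA: "(\<Sum>k\<in>I. of_bool (k \<in> A)) = real (card A)" if "A \<subseteq> I" for A
      using fin that by (simp add: Int_absorb1)
    show ?thesis unfolding sum_subtractf side_count_def
      by (intro arg_cong2[where f = minus] cA) auto
  qed
  finally show ?thesis using False by simp
qed (simp add: net_def chi_def)

text \<open>Both colour classes have \<open>a + 1\<close> members, so
  \<open>imbalance_nonneg\<close> applies to all thresholds from \<open>a\<close> on. The side
  counts of the two orders of a pair add up to \<open>2 * a\<close>, so precisely these thresholds
  assemble the square of \<open>net\<close>. The linear term costs at most \<open>card I\<close> per
  pair.\<close>

lemma net_sq_sum_ge:
  assumes bal: "(\<Sum>i\<in>I. \<sigma> i) = 0"
  shows "(\<Sum>i\<in>I. \<Sum>j\<in>I. (1 + 3 * \<sigma> i * \<sigma> j) * (net i j)\<^sup>2) \<ge> - 8 * real (card I) ^ 3"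
proof (cases "I = {}")
  case False
  define a where "a = card {i \<in> I. \<sigma> i = 1} - 1"
  let ?e = "\<lambda>i j. 1 + 3 * \<sigma> i * \<sigma> j"
  let ?m = "side_count x y \<sigma> I"
  have I: "I = {i \<in> I. \<sigma> i = 1} \<union> {i \<in> I. \<sigma> i = - 1}" using sign by auto
  have "(\<Sum>i\<in>{i \<in> I. \<sigma> i = 1} \<union> {i \<in> I. \<sigma> i = - 1}. \<sigma> i)
      = (\<Sum>i\<in>{i \<in> I. \<sigma> i = 1}. \<sigma> i) + (\<Sum>i\<in>{i \<in> I. \<sigma> i = - 1}. \<sigma> i)"
    using fin by (intro sum.union_disjoint) auto
  then have eq: "card {i \<in> I. \<sigma> i = 1} = card {i \<in> I. \<sigma> i = - 1}" using bal I by simp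
  have "card I = card {i \<in> I. \<sigma> i = 1} + card {i \<in> I. \<sigma> i = - 1}"
    using fin by (subst I, intro card_Un_disjoint) auto
  then have cI: "card I = 2 * (a + 1)" "card {i \<in> I. \<sigma> i = 1} = a + 1" "card {i \<in> I. \<sigma> i = - 1} = a + 1"
  proof -
    have "card I > 0" using False fin by (simp add: card_gt_0_iff)
    then show "card I = 2 * (a + 1)" "card {i \<in> I. \<sigma> i = 1} = a + 1" "card {i \<in> I. \<sigma> i = - 1} = a + 1"
      using eq \<open>card I = card {i \<in> I. \<sigma> i = 1} + _\<close> by (simp_all add: a_def)
  qed
  have "0 \<le> (\<Sum>r\<le>2 * a. imbalance x y \<sigma> (a + r) I)"
    using cI colored_points_axioms by (intro sum_nonneg imbalance_nonneg) auto
  also have "\<dots> = (\<Sum>i\<in>I. \<Sum>j\<in>I - {i}. ?e i j * (\<Sum>r\<le>2 * a. real (?m i j - (a + r))))"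
    unfolding imbalance_def sum_distrib_left by (subst sum.swap, intro sum.cong refl, rule sum.swap)
  finally have nn: "0 \<le> (\<Sum>i\<in>I. \<Sum>j\<in>I - {i}. ?e i j * (\<Sum>r\<le>2 * a. real (?m i j - (a + r))))" .
  have swap: "(\<Sum>i\<in>I. \<Sum>j\<in>I - {i}. g i j) = (\<Sum>i\<in>I. \<Sum>j\<in>I - {i}. g j i)" for g :: "'a \<Rightarrow> 'a \<Rightarrow> real"
  proof -
    have conv: "(\<Sum>j\<in>I - {i}. h i j) = (\<Sum>j\<in>I. if i = j then 0 else h i j)" for h :: "'a \<Rightarrow> 'a \<Rightarrow> real" and i
      using fin by (intro sum.mono_neutral_cong_left) auto
    have "(\<Sum>i\<in>I. \<Sum>j\<in>I. if i = j then 0 else g i j) = (\<Sum>j\<in>I. \<Sum>i\<in>I. if i = j then 0 else g i j)"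
      by (rule sum.swap)
    also have "\<dots> = (\<Sum>j\<in>I. \<Sum>i\<in>I. if j = i then 0 else g i j)" by (simp only: eq_commute)
    finally show ?thesis using conv[of g] conv[of "\<lambda>i j. g j i"] by simp
  qed
  have "0 \<le> (\<Sum>i\<in>I. \<Sum>j\<in>I - {i}. ?e i j * (\<Sum>r\<le>2 * a. real (?m i j - (a + r))))
      + (\<Sum>i\<in>I. \<Sum>j\<in>I - {i}. ?e j i * (\<Sum>r\<le>2 * a. real (?m j i - (a + r))))"
    using nn swap[of "\<lambda>i j. ?e i j * (\<Sum>r\<le>2 * a. real (?m i j - (a + r)))"] by linarith
  also have "\<dots> = (\<Sum>i\<in>I. \<Sum>j\<in>I - {i}. ?e i j * (((net i j)\<^sup>2 / 4 + \<bar>net i j\<bar> / 2) / 2))"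
    unfolding sum.distrib[symmetric]
  proof (intro sum.cong refl)
    fix i j assume ij: "i \<in> I" "j \<in> I - {i}"
    have "?m i j + ?m j i = 2 * a" using side_count_add[of i j] ij cI by auto
    then have "(\<Sum>r\<le>2 * a. real (?m i j - (a + r)) + real (?m j i - (a + r)))
        = ((real (?m i j) - real (?m j i))\<^sup>2 / 4 + \<bar>real (?m i j) - real (?m j i)\<bar> / 2) / 2"
      by (rule sum_truncated_diff_pair)
    moreover have "(net i j)\<^sup>2 = (real (?m i j) - real (?m j i))\<^sup>2" "\<bar>net i j\<bar> = \<bar>real (?m i j) - real (?m j i)\<bar>"
      using net_eq[of i j] ij sign[of i] sign[of j] by (auto simp: power2_commute)
    moreover have "?e i j * p + ?e j i * r = ?e i j * (p + r)" for p r by (simp add: algebra_simps)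
    ultimately show "?e i j * (\<Sum>r\<le>2 * a. real (?m i j - (a + r))) + ?e j i * (\<Sum>r\<le>2 * a. real (?m j i - (a + r)))
      = ?e i j * (((net i j)\<^sup>2 / 4 + \<bar>net i j\<bar> / 2) / 2)"
      by (simp only: sum.distrib)
  qed
  also have "\<dots> \<le> (\<Sum>i\<in>I. \<Sum>j\<in>I. ?e i j * (net i j)\<^sup>2 / 8 + real (card I))"
  proof (intro sum_mono)
    fix i assume i: "i \<in> I"
    have "(\<Sum>j\<in>I - {i}. ?e i j * (((net i j)\<^sup>2 / 4 + \<bar>net i j\<bar> / 2) / 2))
      = (\<Sum>j\<in>I. ?e i j * (((net i j)\<^sup>2 / 4 + \<bar>net i j\<bar> / 2) / 2))"
      using fin i net_eq[OF i i] by (intro sum.mono_neutral_left) auto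
    also have "\<dots> \<le> (\<Sum>j\<in>I. ?e i j * (net i j)\<^sup>2 / 8 + real (card I))"
    proof (rule sum_mono)
      fix j assume j: "j \<in> I"
      have "\<bar>net i j\<bar> \<le> (\<Sum>k\<in>I. \<bar>chi i j k\<bar>)" unfolding net_def by (rule sum_abs)
      also have "\<dots> \<le> (\<Sum>k\<in>I. 1)"
      proof (rule sum_mono)
        fix k assume "k \<in> I"
        then show "\<bar>chi i j k\<bar> \<le> 1" using sign[OF i] sign[OF j] sign[of k] by (auto simp: chi_def abs_mult abs_sgn_eq)
      qed
      finally have "\<bar>net i j\<bar> \<le> real (card I)" by simp
      moreover have "?e i j * \<bar>net i j\<bar> \<le> 4 * \<bar>net i j\<bar>"
        using sign[OF i] sign[OF j] by (intro mult_right_mono) auto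
      ultimately show "?e i j * (((net i j)\<^sup>2 / 4 + \<bar>net i j\<bar> / 2) / 2) \<le> ?e i j * (net i j)\<^sup>2 / 8 + real (card I)"
        by (simp add: field_simps)
    qed
    finally show "(\<Sum>j\<in>I - {i}. ?e i j * (((net i j)\<^sup>2 / 4 + \<bar>net i j\<bar> / 2) / 2))
      \<le> (\<Sum>j\<in>I. ?e i j * (net i j)\<^sup>2 / 8 + real (card I))" .
  qed
  also have "\<dots> = (\<Sum>i\<in>I. \<Sum>j\<in>I. ?e i j * (net i j)\<^sup>2) / 8 + real (card I) ^ 3"
    by (simp add: sum.distrib power3_eq_cube flip: sum_divide_distrib)
  finally show ?thesis by simp
qed simp

text \<open>The six terms are the ways to single out a pair, the three values of \<open>K\<close>
  the ways to split the quadruple into two pairs. For distinct indices this is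
  \<open>six_pairs_identity\<close>. With a repetition, the left side is at most 24 and the first
  three summands on the right are at least -6 together, so the constant 30 suffices.\<close>

lemma six_pairs_le:
  assumes I: "i \<in> I" "j \<in> I" "k \<in> I" "l \<in> I"
  defines "G \<equiv> \<lambda>i j k l. (1 + 3 * \<sigma> i * \<sigma> j) * (chi i j k * chi i j l)"
    and "K \<equiv> \<lambda>i j k l. of_bool (crossing_signs chi i j k l) :: real"
  shows "G i j k l + G i k j l + G i l j k + G j k i l + G j l i k + G k l i j
    \<le> 8 * (K i j k l + K i k j l + K i l j k) + - 3 + 3 * (\<sigma> i * \<sigma> j * \<sigma> k * \<sigma> l)
      + 30 * (of_bool (i = j) + of_bool (i = k) + of_bool (i = l) + of_bool (j = k) + of_bool (j = l) + of_bool (k = l))"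
proof -
  define A where "A = chi j k l"
  define B where "B = chi i k l"
  define C where "C = chi i j l"
  define D where "D = chi i j k"
  have anti: "chi b a c = - chi a b c" "chi b c a = chi a b c" for a b c
    by (simp_all add: chi_def orient_swap12[of x y b a] orient_rotate mult_ac sgn_minus)
  have perm: "chi i k j = - D" "chi i l j = - C" "chi i l k = - B" "chi j k i = D" "chi j l i = C" "chi j l k = - A"
    "chi k l i = B" "chi k l j = A" "chi k j l = - A" "chi l j k = A"
    unfolding A_def B_def C_def D_def by (metis anti(1) anti(2))+
  note defs = A_def[symmetric] B_def[symmetric] C_def[symmetric] D_def[symmetric]
  have Gs: "G i j k l + G i k j l + G i l j k + G j k i l + G j l i k + G k l i j =
      (1 + 3 * \<sigma> i * \<sigma> j) * (D * C) - (1 + 3 * \<sigma> i * \<sigma> k) * (D * B) + (1 + 3 * \<sigma> i * \<sigma> l) * (C * B)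
      + (1 + 3 * \<sigma> j * \<sigma> k) * (D * A) - (1 + 3 * \<sigma> j * \<sigma> l) * (C * A) + (1 + 3 * \<sigma> k * \<sigma> l) * (B * A)"
    unfolding G_def perm defs by simp
  note sg = sign[OF I(1)] sign[OF I(2)] sign[OF I(3)] sign[OF I(4)]
  show ?thesis
  proof (cases "distinct [i, j, k, l]")
    case True
    then have "orient x y j k l \<noteq> 0" "orient x y i k l \<noteq> 0" "orient x y i j l \<noteq> 0" "orient x y i j k \<noteq> 0"
      using orient_nz I by auto
    then have nz: "orient x y j k l \<noteq> 0" and o: "sgn (orient x y j k l) = 1 \<or> sgn (orient x y j k l) = -1" "sgn (orient x y i k l) = 1 \<or> sgn (orient x y i k l) = -1"
      "sgn (orient x y i j l) = 1 \<or> sgn (orient x y i j l) = -1" "sgn (orient x y i j k) = 1 \<or> sgn (orient x y i j k) = -1"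
      by (auto simp: sgn_if)
    have pm: "A = 1 \<or> A = -1" "B = 1 \<or> B = -1" "C = 1 \<or> C = -1" "D = 1 \<or> D = -1"
      using sg(2,3,4) o(1) unfolding A_def chi_def apply force
      using sg(1,3,4) o(2) unfolding B_def chi_def apply force
      using sg(1,2,4) o(3) unfolding C_def chi_def apply force
      using sg(1,2,3) o(4) unfolding D_def chi_def by force
    have "\<not> (sgn (orient x y j k l) = - sgn (orient x y i k l) \<and> sgn (orient x y j k l) = sgn (orient x y i j l)
        \<and> sgn (orient x y j k l) = - sgn (orient x y i j k))"
      using orient_four[of x y j k l i] nz by (rule alternating_signs)
    moreover have "\<sigma> i * A = \<sigma> i * \<sigma> j * \<sigma> k * \<sigma> l * sgn (orient x y j k l)" "\<sigma> j * B = \<sigma> i * \<sigma> j * \<sigma> k * \<sigma> l * sgn (orient x y i k l)"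
      "\<sigma> k * C = \<sigma> i * \<sigma> j * \<sigma> k * \<sigma> l * sgn (orient x y i j l)" "\<sigma> l * D = \<sigma> i * \<sigma> j * \<sigma> k * \<sigma> l * sgn (orient x y i j k)"
      unfolding A_def B_def C_def D_def chi_def by simp_all
    moreover have "\<sigma> i * \<sigma> j * \<sigma> k * \<sigma> l \<noteq> 0" using sg by auto
    ultimately have "\<not> (\<sigma> i * A = - (\<sigma> j * B) \<and> \<sigma> i * A = \<sigma> k * C \<and> \<sigma> i * A = - (\<sigma> l * D))"
      by (metis mult_cancel_left mult_minus_right)
    note id = six_pairs_identity[OF sg pm this]
    have "K i j k l + K i k j l + K i l j k = of_bool (B = - A \<and> C = - A \<and> D = A) + of_bool (B = A \<and> C = A \<and> D = A)
        + of_bool (B = A \<and> C = - A \<and> D = - A)"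
      unfolding K_def crossing_signs_def perm defs using pm by auto
    then show ?thesis using True unfolding Gs id by simp
  next
    case False
    have abs: "\<bar>chi a b c\<bar> \<le> 1" if "a \<in> I" "b \<in> I" "c \<in> I" for a b c
      using sign[OF that(1)] sign[OF that(2)] sign[OF that(3)] by (auto simp: chi_def abs_mult abs_sgn_eq)
    have "G a b c d \<le> 4" if "a \<in> I" "b \<in> I" "c \<in> I" "d \<in> I" for a b c d
    proof -
      have "\<bar>1 + 3 * \<sigma> a * \<sigma> b\<bar> \<le> 4" using sign[OF that(1)] sign[OF that(2)] by auto
      moreover have "\<bar>chi a b c * chi a b d\<bar> \<le> 1"
        using abs[of a b c] abs[of a b d] that by (simp add: abs_mult mult_le_one)
      ultimately have "\<bar>1 + 3 * \<sigma> a * \<sigma> b\<bar> * \<bar>chi a b c * chi a b d\<bar> \<le> 4 * 1"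
        by (intro mult_mono) auto
      then show ?thesis unfolding G_def by (simp only: abs_mult[symmetric])
    qed
    then have "G i j k l + G i k j l + G i l j k + G j k i l + G j l i k + G k l i j \<le> 4 + 4 + 4 + 4 + 4 + 4"
      using I by (intro add_mono) auto
    moreover have "\<sigma> i * \<sigma> j * \<sigma> k * \<sigma> l \<ge> - 1" using sg by auto
    moreover have "K a b c d \<ge> 0" for a b c d by (simp add: K_def)
    then have "K i j k l + K i k j l + K i l j k \<ge> 0" by simp
    moreover have "of_bool (i = j) + of_bool (i = k) + of_bool (i = l) + of_bool (j = k) + of_bool (j = l) + of_bool (k = l) \<ge> (1 :: real)"
      using False by auto
    moreover have "a \<le> 8 * b + - 3 + 3 * c + 30 * d"
      if "a \<le> 4 + 4 + 4 + 4 + 4 + 4" "- 1 \<le> c" "0 \<le> b" "1 \<le> d" for a b c d :: real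
      using that by linarith
    ultimately show ?thesis by blast
  qed
qed

text \<open>The six rearrangements of \<open>G\<close> have the same sum, and so have the three of
  \<open>K\<close>. The colour products sum to the fourth power of the sum of all colours, which is
  0. The cubic errors \<open>6 * 8\<close> and \<open>6 * 30\<close>, divided by 24, stay below
  10.\<close>

lemma crossing_signs_count:
  assumes bal: "(\<Sum>i\<in>I. \<sigma> i) = 0"
  shows "sum4 I (\<lambda>i j k l. of_bool (crossing_signs chi i j k l)) \<ge> real (card I) ^ 4 / 8 - 10 * real (card I) ^ 3"
proof -
  define G where "G = (\<lambda>i j k l. (1 + 3 * \<sigma> i * \<sigma> j) * (chi i j k * chi i j l))"
  define K where "K = (\<lambda>i j k l. of_bool (crossing_signs chi i j k l) :: real)"
  have "(\<Sum>i\<in>I. \<Sum>j\<in>I. (1 + 3 * \<sigma> i * \<sigma> j) * (net i j)\<^sup>2) = sum4 I G"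
    by (simp only: G_def sum4_def net_def power2_eq_square sum_product) (simp only: sum_distrib_left)
  then have "sum4 I G \<ge> - 8 * real (card I) ^ 3" using net_sq_sum_ge[OF bal] by simp
  then have "- 48 * real (card I) ^ 3 \<le> sum4 I G + sum4 I (\<lambda>i j k l. G i k j l) + sum4 I (\<lambda>i j k l. G i l j k)
      + sum4 I (\<lambda>i j k l. G j k i l) + sum4 I (\<lambda>i j k l. G j l i k) + sum4 I (\<lambda>i j k l. G k l i j)"
    unfolding sum4_swap23[of I G] sum4_perms[of I G] by simp
  also have "\<dots> = sum4 I (\<lambda>i j k l. G i j k l + G i k j l + G i l j k + G j k i l + G j l i k + G k l i j)"
    by (simp add: sum4_add)
  also have "\<dots> \<le> sum4 I (\<lambda>i j k l. 8 * (K i j k l + K i k j l + K i l j k) + - 3 + 3 * (\<sigma> i * \<sigma> j * \<sigma> k * \<sigma> l)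
      + 30 * (of_bool (i = j) + of_bool (i = k) + of_bool (i = l) + of_bool (j = k) + of_bool (j = l) + of_bool (k = l)))"
    unfolding G_def K_def by (intro sum4_mono six_pairs_le)
  also have "\<dots> = 24 * sum4 I K - 3 * real (card I) ^ 4 + 180 * real (card I) ^ 3"
  proof -
    have e: "(\<Sum>j\<in>I. of_bool (i = j)) = (1 :: real)" if "i \<in> I" for i
      using fin that by (simp add: of_bool_def)
    have c: "sum4 I (\<lambda>i j k l. of_bool (i = j)) = real (card I) ^ 3"
      by (simp add: sum4_def e power3_eq_cube flip: sum_distrib_left)
    have "sum4 I (\<lambda>i j k l. of_bool (i = k)) = real (card I) ^ 3"
      "sum4 I (\<lambda>i j k l. of_bool (i = l)) = real (card I) ^ 3"
      "sum4 I (\<lambda>i j k l. of_bool (j = k)) = real (card I) ^ 3"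
      "sum4 I (\<lambda>i j k l. of_bool (j = l)) = real (card I) ^ 3"
      "sum4 I (\<lambda>i j k l. of_bool (k = l)) = real (card I) ^ 3"
      using c sum4_swap23[of I "\<lambda>i j k l. of_bool (i = j)"] sum4_perms[of I "\<lambda>i j k l. of_bool (i = j)"] by simp_all
    with c show ?thesis
      unfolding sum4_add sum4_mult sum4_const sum4_prod bal sum4_swap23[of I K] sum4_perms(1)[of I K] by simp
  qed
  finally have "24 * sum4 I K \<ge> 3 * real (card I) ^ 4 - 228 * real (card I) ^ 3" by simp
  moreover have "real (card I) ^ 3 \<ge> 0" by simp
  ultimately show ?thesis unfolding K_def by linarith
qed

end

section \<open>Vectors in general position\<close>

definition det3 :: "real ^ 3 \<Rightarrow> real ^ 3 \<Rightarrow> real ^ 3 \<Rightarrow> real" where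
  "det3 u v w = u $ 1 * (v $ 2 * w $ 3 - w $ 2 * v $ 3) - u $ 2 * (v $ 1 * w $ 3 - w $ 1 * v $ 3)
    + u $ 3 * (v $ 1 * w $ 2 - w $ 1 * v $ 2)"

text \<open>Cramer's rule for four vectors in space, with the negative terms moved across.\<close>

lemma det3_dependency:
  "det3 b c d *\<^sub>R a + det3 a b d *\<^sub>R c = det3 a c d *\<^sub>R b + det3 a b c *\<^sub>R d"
  unfolding vec_eq_iff forall_3 det3_def by (simp; algebra)

lemma crossing_signs_imp_cones_meet:
  fixes a :: "'a \<Rightarrow> real ^ 3"
  assumes "crossing_signs (\<lambda>i j k. sgn (det3 (a i) (a j) (a k))) i j k l"
  obtains c1 c2 c3 c4 where "c1 > 0" "c2 > 0" "c3 > 0" "c4 > 0"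
    "c1 *\<^sub>R a i + c2 *\<^sub>R a j = c3 *\<^sub>R a k + c4 *\<^sub>R a l"
proof -
  define s where "s = sgn (det3 (a j) (a k) (a l))"
  have *: "s \<noteq> 0" "sgn (det3 (a i) (a k) (a l)) = - s" "sgn (det3 (a i) (a j) (a l)) = - s"
    "sgn (det3 (a i) (a j) (a k)) = s"
    using assms by (auto simp: crossing_signs_def s_def)
  then have pos: "\<bar>det3 (a j) (a k) (a l)\<bar> > 0" "\<bar>det3 (a i) (a k) (a l)\<bar> > 0"
    "\<bar>det3 (a i) (a j) (a l)\<bar> > 0" "\<bar>det3 (a i) (a j) (a k)\<bar> > 0"
    by (auto simp: s_def sgn_0_0)
  have d: "det3 (a j) (a k) (a l) = s * \<bar>det3 (a j) (a k) (a l)\<bar>"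
    "det3 (a i) (a k) (a l) = - s * \<bar>det3 (a i) (a k) (a l)\<bar>"
    "det3 (a i) (a j) (a l) = - s * \<bar>det3 (a i) (a j) (a l)\<bar>"
    "det3 (a i) (a j) (a k) = s * \<bar>det3 (a i) (a j) (a k)\<bar>"
    using * sgn_mult_abs[of "det3 (a j) (a k) (a l)"] sgn_mult_abs[of "det3 (a i) (a k) (a l)"]
      sgn_mult_abs[of "det3 (a i) (a j) (a l)"] sgn_mult_abs[of "det3 (a i) (a j) (a k)"]
    by (auto simp: s_def)
  have e: "(s * \<bar>det3 (a j) (a k) (a l)\<bar>) *\<^sub>R a i + (- s * \<bar>det3 (a i) (a j) (a l)\<bar>) *\<^sub>R a k
      = (- s * \<bar>det3 (a i) (a k) (a l)\<bar>) *\<^sub>R a j + (s * \<bar>det3 (a i) (a j) (a k)\<bar>) *\<^sub>R a l"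
    using det3_dependency[of "a j" "a k" "a l" "a i"] by (simp only: d[symmetric])
  have "s *\<^sub>R (\<bar>det3 (a j) (a k) (a l)\<bar> *\<^sub>R a i + \<bar>det3 (a i) (a k) (a l)\<bar> *\<^sub>R a j)
      = s *\<^sub>R (\<bar>det3 (a i) (a j) (a l)\<bar> *\<^sub>R a k + \<bar>det3 (a i) (a j) (a k)\<bar> *\<^sub>R a l)"
    using e by (simp add: algebra_simps)
  then have "\<bar>det3 (a j) (a k) (a l)\<bar> *\<^sub>R a i + \<bar>det3 (a i) (a k) (a l)\<bar> *\<^sub>R a j
      = \<bar>det3 (a i) (a j) (a l)\<bar> *\<^sub>R a k + \<bar>det3 (a i) (a j) (a k)\<bar> *\<^sub>R a l"
    using *(1) by (simp only: scaleR_cancel_left simp_thms)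
  then show thesis using that pos by blast
qed

section \<open>A halving plane\<close>

lemma real_between_finite_sets:
  fixes S T :: "real set"
  assumes "finite S" "finite T" "\<And>s t. s \<in> S \<Longrightarrow> t \<in> T \<Longrightarrow> s < t"
  obtains c where "\<And>s. s \<in> S \<Longrightarrow> s < c" "\<And>t. t \<in> T \<Longrightarrow> c < t"
proof (cases "S = {} \<or> T = {}")
  case True
  have "\<exists>c. (\<forall>s\<in>S. s < c) \<and> (\<forall>t\<in>T. c < t)"
  proof (cases "S = {}")
    case True
    obtain c where "\<forall>t\<in>T. c < t" by (metis Min_le assms(2) lt_ex order_less_le_trans)
    then show ?thesis using True by blast
  next
    case False
    then have "T = {}" using \<open>S = {} \<or> T = {}\<close> by blast
    moreover obtain c where "\<forall>s\<in>S. s < c" by (metis Max_ge assms(1) gt_ex order_le_less_trans)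
    ultimately show ?thesis by blast
  qed
  then show thesis using that by blast
next
  case False
  then have "Max S < Min T" using assms by simp
  then obtain c where "Max S < c" "c < Min T" using dense by blast
  then show thesis using that[of c] assms False by simp
qed

text \<open>When \<open>c\<close> passes the ratio \<open>f i / g i\<close>, only \<open>i\<close>
  changes sides, since the ratios are distinct. The two extreme positions have complementary
  positive sets, so a discrete intermediate value argument finds a position with exactly
  \<open>q\<close> positive values.\<close>

lemma halving_functional:
  fixes f g :: "'a \<Rightarrow> real"
  assumes fin: "finite I" and card: "card I = 2 * q" and g: "\<And>i. i \<in> I \<Longrightarrow> g i \<noteq> 0"
    and fg: "\<And>i j. \<lbrakk>i \<in> I; j \<in> I; i \<noteq> j\<rbrakk> \<Longrightarrow> f i * g j \<noteq> f j * g i"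
  obtains c where "\<And>i. i \<in> I \<Longrightarrow> f i - c * g i \<noteq> 0" "card {i \<in> I. f i - c * g i > 0} = q"
proof -
  define r where "r i = f i / g i" for i
  have r: "r i \<noteq> r j" if "i \<in> I" "j \<in> I" "i \<noteq> j" for i j
    using fg[OF that] g[of i] g[of j] that by (simp add: r_def frac_eq_eq)
  define rk where "rk i = card {k \<in> I. r k < r i}" for i
  have rk_less: "rk i < rk j" if "i \<in> I" "r i < r j" for i j
    unfolding rk_def using that fin by (intro psubset_card_mono) force+
  have inj: "inj_on rk I"
  proof (rule inj_onI, rule ccontr)
    fix i j assume ij: "i \<in> I" "j \<in> I" "rk i = rk j" "i \<noteq> j"
    then have "r i < r j \<or> r j < r i" using r by (meson linorder_neqE_linordered_idom)
    then show False using ij rk_less[of i j] rk_less[of j i] by auto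
  qed
  have rk_card: "rk i < 2 * q" if "i \<in> I" for i
    unfolding rk_def card[symmetric] using that fin by (intro psubset_card_mono) auto
  \<comment> \<open>The positive set when \<open>c\<close> separates the \<open>m\<close> smallest
    ratios from the rest.\<close>
  define A where "A m = {i \<in> I. if rk i < m then g i < 0 else g i > 0}" for m
  define U where "U m = int (card (A m))" for m
  have step: "\<bar>U (Suc m) - U m\<bar> \<le> 1" for m
  proof -
    have "card (A (Suc m)) \<le> card (A m) + 1" "card (A m) \<le> card (A (Suc m)) + 1"
    proof -
      have fA: "finite (A m)" for m using fin by (simp add: A_def)
      have c1: "card {i \<in> I. rk i = m} \<le> 1"
        using inj fin by (auto simp: card_le_Suc0_iff_eq inj_on_def)
      have "A (Suc m) \<subseteq> A m \<union> {i \<in> I. rk i = m}" "A m \<subseteq> A (Suc m) \<union> {i \<in> I. rk i = m}"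
        by (auto simp: A_def less_Suc_eq)
      then have "card (A (Suc m)) \<le> card (A m \<union> {i \<in> I. rk i = m})" "card (A m) \<le> card (A (Suc m) \<union> {i \<in> I. rk i = m})"
        using fin fA by (simp_all add: card_mono)
      then show "card (A (Suc m)) \<le> card (A m) + 1" "card (A m) \<le> card (A (Suc m)) + 1"
        using c1 card_Un_le[of "A m" "{i \<in> I. rk i = m}"] card_Un_le[of "A (Suc m)" "{i \<in> I. rk i = m}"]
        by linarith+
    qed
    then show ?thesis by (simp add: U_def)
  qed
  have sum: "U 0 + U (2 * q) = 2 * int q"
  proof -
    have "card (A 0 \<union> A (2 * q)) = card (A 0) + card (A (2 * q))"
      using fin rk_card by (intro card_Un_disjoint) (auto simp: A_def)
    moreover have "A 0 \<union> A (2 * q) = I" using g rk_card by (force simp: A_def)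
    ultimately show ?thesis using card by (simp add: U_def)
  qed
  have "\<exists>m. U m = int q"
  proof (cases "U 0 \<le> int q")
    case True
    then show ?thesis using nat0_intermed_int_val[of "2 * q" U "int q"] step sum by auto
  next
    case False
    then show ?thesis
      using nat0_intermed_int_val[of "2 * q" "\<lambda>m. - U m" "- int q"] step sum by (auto simp: abs_minus_commute)
  qed
  then obtain m where m: "U m = int q" by blast
  let ?L = "r ` {i \<in> I. rk i < m}" and ?R = "r ` {i \<in> I. \<not> rk i < m}"
  have sep: "s < t" if st: "s \<in> ?L" "t \<in> ?R" for s t
  proof -
    obtain i j where ij: "s = r i" "t = r j" "i \<in> I" "j \<in> I" "rk i < m" "\<not> rk j < m" using st by auto
    then have "i \<noteq> j" by auto
    then show "s < t" using ij rk_less[of j i] r[of i j] by force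
  qed
  have "finite ?L" "finite ?R" using fin by auto
  then obtain c where c: "\<And>s. s \<in> ?L \<Longrightarrow> s < c" "\<And>s. s \<in> ?R \<Longrightarrow> c < s"
    using real_between_finite_sets[OF _ _ sep] by blast
  have eq: "f i - c * g i = g i * (r i - c)" if "i \<in> I" for i
    using g[OF that] by (simp add: r_def field_simps)
  have cr: "(r i < c \<and> rk i < m) \<or> (c < r i \<and> \<not> rk i < m)" if "i \<in> I" for i using c that by auto
  have "f i - c * g i \<noteq> 0" if "i \<in> I" for i
    using eq[OF that] cr[OF that] g[OF that] by auto
  moreover have "{i \<in> I. f i - c * g i > 0} = A m"
  proof -
    have "f i - c * g i > 0 \<longleftrightarrow> (if rk i < m then g i < 0 else g i > 0)" if "i \<in> I" for i
      using eq[OF that] cr[OF that] g[OF that] by (auto simp: zero_less_mult_iff)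
    then show ?thesis by (auto simp: A_def)
  qed
  then have "card {i \<in> I. f i - c * g i > 0} = q" using m by (simp add: U_def)
  ultimately show thesis using that by blast
qed

text \<open>The halving plane \<open>p = 0\<close> contains the third axis, and \<open>x\<close>,
  \<open>y\<close> are coordinates in the chart \<open>p = 1\<close>. Replacing the first coordinate
  by \<open>p\<close> is a shear, so determinants are kept. The assumption \<open>fg\<close> gives
  both distinct ratios for the halving and distinct x-coordinates for the projection.\<close>

lemma vectors_crossing_count:
  fixes a :: "'a \<Rightarrow> real ^ 3"
  assumes fin: "finite I" and card: "card I = 2 * q"
    and g: "\<And>i. i \<in> I \<Longrightarrow> a i $ 2 \<noteq> 0"
    and fg: "\<And>i j. \<lbrakk>i \<in> I; j \<in> I; i \<noteq> j\<rbrakk> \<Longrightarrow> a i $ 1 * a j $ 2 \<noteq> a j $ 1 * a i $ 2"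
    and det: "\<And>i j k. \<lbrakk>i \<in> I; j \<in> I; k \<in> I; i \<noteq> j; j \<noteq> k; i \<noteq> k\<rbrakk> \<Longrightarrow> det3 (a i) (a j) (a k) \<noteq> 0"
  shows "sum4 I (\<lambda>i j k l. of_bool (crossing_signs (\<lambda>i j k. sgn (det3 (a i) (a j) (a k))) i j k l))
    \<ge> real (card I) ^ 4 / 8 - 10 * real (card I) ^ 3"
proof -
  obtain c where c: "\<And>i. i \<in> I \<Longrightarrow> a i $ 1 - c * a i $ 2 \<noteq> 0" "card {i \<in> I. a i $ 1 - c * a i $ 2 > 0} = q"
    using halving_functional[where f = "\<lambda>i. a i $ 1" and g = "\<lambda>i. a i $ 2", OF fin card g fg] by blast
  define p where "p i = a i $ 1 - c * a i $ 2" for i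
  define x where "x i = a i $ 2 / p i" for i
  define y where "y i = a i $ 3 / p i" for i
  define \<sigma> where "\<sigma> i = sgn (p i)" for i
  have p: "p i \<noteq> 0" if "i \<in> I" for i using c that by (simp add: p_def)
  have o: "p i * p j * p k * orient x y i j k = det3 (a i) (a j) (a k)" if "i \<in> I" "j \<in> I" "k \<in> I" for i j k
  proof -
    have a: "a i $ 2 = p i * x i" "a i $ 3 = p i * y i" "a i $ 1 = p i + c * (p i * x i)" if "i \<in> I" for i
      using p[OF that] by (auto simp: x_def y_def p_def)
    show ?thesis unfolding det3_def orient_def a[OF that(1)] a[OF that(2)] a[OF that(3)]
      by (simp add: algebra_simps)
  qed
  interpret C: colored_points x y \<sigma> I
  proof
    show "finite I" by fact
    show "\<sigma> i = 1 \<or> \<sigma> i = - 1" if "i \<in> I" for i using p[OF that] by (auto simp: \<sigma>_def sgn_if)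
    show "inj_on x I"
    proof (rule inj_onI, rule ccontr)
      fix i j assume ij: "i \<in> I" "j \<in> I" "x i = x j" "i \<noteq> j"
      then have "a i $ 2 * p j = a j $ 2 * p i" using p by (simp add: x_def frac_eq_eq)
      then have "a i $ 2 * a j $ 1 = a j $ 2 * a i $ 1" by (simp add: p_def algebra_simps)
      then show False using fg[of i j] ij by (simp add: mult.commute)
    qed
    show "orient x y i j k \<noteq> 0" if "i \<in> I" "j \<in> I" "k \<in> I" "i \<noteq> j" "j \<noteq> k" "i \<noteq> k" for i j k
      using o[of i j k] det[of i j k] that by auto
  qed
  have "C.chi i j k = sgn (det3 (a i) (a j) (a k))" if "i \<in> I" "j \<in> I" "k \<in> I" for i j k
    unfolding C.chi_def \<sigma>_def o[OF that, symmetric] by (simp add: sgn_mult)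
  then have "sum4 I (\<lambda>i j k l. of_bool (crossing_signs (\<lambda>i j k. sgn (det3 (a i) (a j) (a k))) i j k l))
      = sum4 I (\<lambda>i j k l. of_bool (crossing_signs C.chi i j k l))"
    unfolding sum4_def crossing_signs_def by (intro sum.cong refl) simp
  moreover have "(\<Sum>i\<in>I. \<sigma> i) = 0"
  proof -
    have "(\<Sum>i\<in>I. \<sigma> i) = (\<Sum>i\<in>I. 2 * of_bool (p i > 0) - 1)"
      using p by (intro sum.cong) (auto simp: \<sigma>_def sgn_if)
    also have "\<dots> = 2 * real (card {i \<in> I. p i > 0}) - real (card I)"
      using fin by (simp add: sum_subtractf Int_def flip: sum_distrib_left)
    finally show ?thesis using c(2) card by (simp add: p_def)
  qed
  ultimately show ?thesis using C.crossing_signs_count by simp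
qed

section \<open>Geodesic arcs\<close>

lemma sphere_unit_eq:
  fixes x y :: "real ^ 3"
  assumes "norm x = 1" "norm y = 1" "x \<bullet> y = 1"
  shows "x = y"
proof -
  have "(norm (x - y))\<^sup>2 = (norm x)\<^sup>2 + (norm y)\<^sup>2 - 2 * (x \<bullet> y)"
    by (simp add: power2_norm_eq_inner algebra_simps inner_commute)
  then show ?thesis using assms by simp
qed

lemma cos_sphere_dist:
  assumes "norm x = 1" "norm y = 1"
  shows "cos (sphere_dist x y) = x \<bullet> y"
  unfolding sphere_dist_def using Cauchy_Schwarz_ineq2[of x y] assms by (intro cos_arccos) auto

lemma sphere_dist_bounds:
  assumes "norm x = 1" "norm y = 1"
  shows "0 \<le> sphere_dist x y" "sphere_dist x y \<le> pi"
  unfolding sphere_dist_def using Cauchy_Schwarz_ineq2[of x y] assms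
  by (auto intro: arccos_lbound arccos_ubound)

lemma norm_circle_point:
  fixes x w :: "real ^ 3"
  assumes "norm x = 1" "norm w = 1" "x \<bullet> w = 0"
  shows "norm (c *\<^sub>R x + d *\<^sub>R w) = sqrt (c\<^sup>2 + d\<^sup>2)"
proof -
  have "x \<bullet> x = 1" "w \<bullet> w = 1" using assms by (simp_all add: dot_square_norm)
  then have "(norm (c *\<^sub>R x + d *\<^sub>R w))\<^sup>2 = c\<^sup>2 + d\<^sup>2"
    unfolding power2_norm_eq_inner
    using assms(3) by (simp add: inner_add_left inner_add_right inner_commute[of w x] power2_eq_square)
  then show ?thesis by (metis norm_ge_zero real_sqrt_unique)
qed

definition circle_arc :: "real ^ 3 \<Rightarrow> real ^ 3 \<Rightarrow> real \<Rightarrow> (real ^ 3) set" where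
  "circle_arc x w \<theta> = (\<lambda>s. cos s *\<^sub>R x + sin s *\<^sub>R w) ` {0..\<theta>}"

lemma min_geodesic_arc_circle:
  assumes arc: "min_geodesic_arc x y A" and x: "norm x = 1" and y: "norm y = 1" and ne: "x \<noteq> y"
  obtains w \<theta> where "0 < \<theta>" "\<theta> \<le> pi" "norm w = 1" "x \<bullet> w = 0" "y = cos \<theta> *\<^sub>R x + sin \<theta> *\<^sub>R w"
    "A = circle_arc x w \<theta>"
proof -
  define \<theta> where "\<theta> = sphere_dist x y"
  obtain g where g: "g 0 = x" "g \<theta> = y" "g ` {0..\<theta>} \<subseteq> sphere 0 1"
    "\<And>s t. \<lbrakk>s \<in> {0..\<theta>}; t \<in> {0..\<theta>}\<rbrakk> \<Longrightarrow> sphere_dist (g s) (g t) = \<bar>s - t\<bar>" "A = g ` {0..\<theta>}"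
    using arc unfolding min_geodesic_arc_def \<theta>_def by blast
  have \<theta>: "0 < \<theta>" "\<theta> \<le> pi"
  proof -
    have "\<theta> \<noteq> 0" using g(1,2) ne by auto
    then show "0 < \<theta>" "\<theta> \<le> pi" using sphere_dist_bounds[OF x y] by (auto simp: \<theta>_def)
  qed
  have n: "norm (g s) = 1" if "s \<in> {0..\<theta>}" for s
    using subsetD[OF g(3) imageI[OF that]] by simp
  have ip: "g s \<bullet> g t = cos (s - t)" if "s \<in> {0..\<theta>}" "t \<in> {0..\<theta>}" for s t
    using cos_sphere_dist[of "g s" "g t"] n g(4) that by simp
  \<comment> \<open>The tangent \<open>w\<close> is read off at the midpoint and not at
    \<open>y\<close>, because \<open>sin \<theta>\<close> vanishes when the ends are
    antipodal.\<close>
  define m where "m = \<theta> / 2"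
  have m: "m \<in> {0..\<theta>}" "0 < m" "m < pi" using \<theta> by (auto simp: m_def)
  have sm: "sin m > 0" using m by (intro sin_gt_zero) auto
  define w where "w = (1 / sin m) *\<^sub>R (g m - cos m *\<^sub>R x)"
  have gm: "g m = cos m *\<^sub>R x + sin m *\<^sub>R w" using sm by (simp add: w_def)
  have xx: "x \<bullet> x = 1" using x by (simp add: dot_square_norm)
  have xs: "x \<bullet> g s = cos s" if "s \<in> {0..\<theta>}" for s using ip[of 0 s] that \<theta> g(1) by auto
  have xw: "x \<bullet> w = 0" using xs[OF m(1)] xx by (simp add: w_def inner_diff_right)
  have gw: "g s \<bullet> w = sin s" if s: "s \<in> {0..\<theta>}" for s
  proof -
    have "g s \<bullet> w = (cos (s - m) - cos m * cos s) / sin m"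
      using ip[OF s m(1)] xs[OF s] by (simp add: w_def inner_diff_right inner_commute[of "g s" x])
    then show ?thesis using sm by (simp add: cos_diff)
  qed
  have "w \<bullet> w = 1"
  proof -
    have "g m \<bullet> w = cos m * (x \<bullet> w) + sin m * (w \<bullet> w)" unfolding gm by (simp add: inner_add_left)
    then show ?thesis using gw[OF m(1)] xw sm by simp
  qed
  then have w: "norm w = 1" by (simp add: norm_eq_1)
  \<comment> \<open>Two unit vectors with inner product 1 coincide, and the isometry fixes all inner
    products along the path.\<close>
  have gs: "g s = cos s *\<^sub>R x + sin s *\<^sub>R w" if s: "s \<in> {0..\<theta>}" for s
  proof (rule sphere_unit_eq)
    show "norm (g s) = 1" using n s by simp
    show "norm (cos s *\<^sub>R x + sin s *\<^sub>R w) = 1" using norm_circle_point[OF x w xw] by simp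
    show "g s \<bullet> (cos s *\<^sub>R x + sin s *\<^sub>R w) = 1"
      using xs[OF s] gw[OF s] by (simp add: inner_add_right inner_commute[of "g s" x] flip: power2_eq_square)
  qed
  have "A = circle_arc x w \<theta>" unfolding g(5) circle_arc_def using gs by auto
  moreover have "y = cos \<theta> *\<^sub>R x + sin \<theta> *\<^sub>R w" using gs[of \<theta>] g(2) \<theta> by auto
  ultimately show thesis using that \<theta> w xw by blast
qed

lemma min_geodesic_arc_exists:
  assumes x: "norm x = 1" and w: "norm w = 1" and xw: "x \<bullet> w = 0" and \<theta>: "0 \<le> \<theta>" "\<theta> \<le> pi"
  shows "min_geodesic_arc x (cos \<theta> *\<^sub>R x + sin \<theta> *\<^sub>R w) (circle_arc x w \<theta>)"
proof -
  define g where "g s = cos s *\<^sub>R x + sin s *\<^sub>R w" for s :: real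
  have "x \<bullet> x = 1" "w \<bullet> w = 1" using x w by (simp_all add: dot_square_norm)
  then have ip: "g s \<bullet> g t = cos (s - t)" for s t
    using xw by (simp add: g_def inner_add_left inner_add_right inner_commute[of w x] cos_diff)
  have d: "sphere_dist (g s) (g t) = \<bar>s - t\<bar>" if "s \<in> {0..\<theta>}" "t \<in> {0..\<theta>}" for s t
  proof -
    have "arccos (cos \<bar>s - t\<bar>) = \<bar>s - t\<bar>" using that \<theta> by (intro arccos_cos) auto
    then show ?thesis by (simp add: sphere_dist_def ip)
  qed
  have g0: "g 0 = x" by (simp add: g_def)
  then have d\<theta>: "sphere_dist x (g \<theta>) = \<theta>" using d[of 0 \<theta>] \<theta> by simp
  have n: "norm (g s) = 1" for s using norm_circle_point[OF x w xw, of "cos s" "sin s"] by (simp add: g_def)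
  show ?thesis unfolding min_geodesic_arc_def g_def[symmetric] d\<theta> circle_arc_def
    using d g0 n by (intro exI[of _ g]) auto
qed

text \<open>If \<open>s\<close> is the angle of \<open>z\<close>, the two inequalities read
  \<open>sin s \<ge> 0\<close> and \<open>sin (\<theta> - s) \<ge> 0\<close>. They describe the arc
  also for \<open>\<theta> = pi\<close>, and they are closed conditions, hence stable under
  limits.\<close>

lemma circle_arc_mem:
  fixes x w z :: "real ^ 3"
  assumes x: "norm x = 1" and w: "norm w = 1" and xw: "x \<bullet> w = 0" and \<theta>: "0 < \<theta>" "\<theta> \<le> pi"
    and z: "norm z = 1" "z = c *\<^sub>R x + d *\<^sub>R w" "0 \<le> d" "0 \<le> c * sin \<theta> - d * cos \<theta>"
  shows "z \<in> circle_arc x w \<theta>"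
proof -
  have cd: "c\<^sup>2 + d\<^sup>2 = 1" using z norm_circle_point[OF x w xw] by simp
  then have "c\<^sup>2 \<le> 1" by (smt (verit) zero_le_power2)
  then have c: "- 1 \<le> c" "c \<le> 1" by (simp_all add: abs_square_le_1 abs_le_iff)
  define s where "s = arccos c"
  have s: "0 \<le> s" "s \<le> pi" "cos s = c" using c by (auto simp: s_def arccos_lbound arccos_ubound)
  have "sin s = sqrt (1 - c\<^sup>2)" using c by (simp add: s_def sin_arccos_abs)
  also have "\<dots> = d" using cd z(3) by (simp add: real_sqrt_unique)
  finally have ss: "sin s = d" .
  have "s \<le> \<theta>"
  proof (rule ccontr)
    assume "\<not> s \<le> \<theta>"
    then have "0 < sin (s - \<theta>)" using s \<theta> by (intro sin_gt_zero) auto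
    then show False using z(4) s ss by (simp add: sin_diff mult.commute)
  qed
  then show ?thesis using s ss z(2) by (auto simp: circle_arc_def intro!: image_eqI[of _ _ s])
qed

lemma circle_arc_limit:
  fixes x w z :: "real ^ 3" and y e :: "nat \<Rightarrow> real ^ 3" and c d :: "nat \<Rightarrow> real"
  assumes x: "norm x = 1" and w: "norm w = 1" and xw: "x \<bullet> w = 0" and \<theta>: "0 < \<theta>" "\<theta> \<le> pi"
    and lim: "y \<longlonglongrightarrow> z" and e: "e \<longlonglongrightarrow> 0" and z: "norm z = 1"
    and y: "\<And>m. y m = c m *\<^sub>R x + d m *\<^sub>R w + e m" and d: "\<And>m. 0 \<le> d m"
    and cd: "\<And>m. 0 \<le> c m * sin \<theta> - d m * cos \<theta>"
  shows "z \<in> circle_arc x w \<theta>"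
proof -
  define u where "u m = c m *\<^sub>R x + d m *\<^sub>R w" for m
  have xx: "x \<bullet> x = 1" "w \<bullet> w = 1" using x w by (simp_all add: dot_square_norm)
  have ux: "u m \<bullet> x = c m" and uw: "u m \<bullet> w = d m" for m
    using xx xw by (simp_all add: u_def inner_add_left inner_commute[of w x])
  have "(\<lambda>m. y m - e m) \<longlonglongrightarrow> z - 0" using lim e by (rule tendsto_diff)
  moreover have "u = (\<lambda>m. y m - e m)" using y by (auto simp: u_def)
  ultimately have u: "u \<longlonglongrightarrow> z" by simp
  have c': "c \<longlonglongrightarrow> z \<bullet> x" using tendsto_inner[OF u tendsto_const[of x]] by (simp add: ux)
  have d': "d \<longlonglongrightarrow> z \<bullet> w" using tendsto_inner[OF u tendsto_const[of w]] by (simp add: uw)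
  have "u \<longlonglongrightarrow> (z \<bullet> x) *\<^sub>R x + (z \<bullet> w) *\<^sub>R w"
    unfolding u_def using c' d' by (intro tendsto_intros)
  then have zeq: "z = (z \<bullet> x) *\<^sub>R x + (z \<bullet> w) *\<^sub>R w" using u LIMSEQ_unique by blast
  have "0 \<le> z \<bullet> w" using d' d by (intro LIMSEQ_le_const) auto
  moreover have "(\<lambda>m. c m * sin \<theta> - d m * cos \<theta>) \<longlonglongrightarrow> (z \<bullet> x) * sin \<theta> - (z \<bullet> w) * cos \<theta>"
    using c' d' by (intro tendsto_intros)
  then have "0 \<le> (z \<bullet> x) * sin \<theta> - (z \<bullet> w) * cos \<theta>" using cd by (intro LIMSEQ_le_const) auto
  ultimately show ?thesis using circle_arc_mem[OF x w xw \<theta> z zeq] by blast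
qed

lemma circle_arc_at_interior:
  fixes x w :: "real ^ 3"
  assumes x: "norm x = 1" and w: "norm w = 1" and xw: "x \<bullet> w = 0" and \<theta>: "0 < \<theta>" "\<theta> \<le> pi"
    and y: "y = cos \<theta> *\<^sub>R x + sin \<theta> *\<^sub>R w"
    and z: "z \<in> circle_arc x w \<theta>" "z \<noteq> x" "z \<noteq> y"
  obtains \<tau> \<alpha> \<beta> where "norm z = 1" "norm \<tau> = 1" "z \<bullet> \<tau> = 0" "0 < \<alpha>" "0 < \<beta>" "\<alpha> + \<beta> \<le> pi"
    "x = cos \<alpha> *\<^sub>R z - sin \<alpha> *\<^sub>R \<tau>" "y = cos \<beta> *\<^sub>R z + sin \<beta> *\<^sub>R \<tau>"
    "circle_arc x w \<theta> = (\<lambda>r. cos r *\<^sub>R z + sin r *\<^sub>R \<tau>) ` {-\<alpha>..\<beta>}"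
proof -
  obtain s where s: "0 \<le> s" "s \<le> \<theta>" "z = cos s *\<^sub>R x + sin s *\<^sub>R w"
    using z(1) by (auto simp: circle_arc_def)
  have s0: "0 < s" "s < \<theta>"
  proof -
    have "s \<noteq> 0" "s \<noteq> \<theta>" using s z y by auto
    then show "0 < s" "s < \<theta>" using s by auto
  qed
  define \<tau> where "\<tau> = (- sin s) *\<^sub>R x + cos s *\<^sub>R w"
  have pt: "cos (s + r) *\<^sub>R x + sin (s + r) *\<^sub>R w = cos r *\<^sub>R z + sin r *\<^sub>R \<tau>" for r
    by (simp add: s(3) \<tau>_def cos_add sin_add algebra_simps)
  have "norm z = 1" using norm_circle_point[OF x w xw] s by simp
  moreover have "norm \<tau> = 1" using norm_circle_point[OF x w xw, of "- sin s" "cos s"] by (simp add: \<tau>_def)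
  moreover have "z \<bullet> \<tau> = 0"
  proof -
    have "x \<bullet> x = 1" "w \<bullet> w = 1" using x w by (simp_all add: dot_square_norm)
    then show ?thesis using xw
      by (simp add: s(3) \<tau>_def inner_add_left inner_add_right inner_diff_left inner_diff_right inner_commute[of w x])
  qed
  moreover have "x = cos s *\<^sub>R z - sin s *\<^sub>R \<tau>" using pt[of "- s"] by simp
  moreover have "y = cos (\<theta> - s) *\<^sub>R z + sin (\<theta> - s) *\<^sub>R \<tau>" using pt[of "\<theta> - s"] y by simp
  moreover have "circle_arc x w \<theta> = (\<lambda>r. cos r *\<^sub>R z + sin r *\<^sub>R \<tau>) ` {-s..\<theta> - s}"
  proof -
    have "{0..\<theta>} = (\<lambda>r. s + r) ` {-s..\<theta> - s}" by (simp add: image_add_atLeastAtMost)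
    then show ?thesis unfolding circle_arc_def by (simp only: image_image pt)
  qed
  ultimately show thesis using that[of \<tau> s "\<theta> - s"] s0 \<theta> by simp
qed

section \<open>Edges through a common interior point\<close>

text \<open>The edge parametrised by arc length from its interior point \<open>z\<close> with unit
  tangent \<open>\<tau>\<close>, so that two edges through \<open>z\<close> can be compared by their
  tangents.\<close>

definition arc_through :: "('v \<Rightarrow> real ^ 3) \<Rightarrow> ('v set \<Rightarrow> (real ^ 3) set) \<Rightarrow> 'v set \<Rightarrow> real ^ 3 \<Rightarrow> real ^ 3
    \<Rightarrow> 'v \<Rightarrow> 'v \<Rightarrow> real \<Rightarrow> real \<Rightarrow> bool" where
  "arc_through p a e z \<tau> u v \<alpha> \<beta> \<longleftrightarrow> norm z = 1 \<and> norm \<tau> = 1 \<and> z \<bullet> \<tau> = 0 \<and> 0 < \<alpha> \<and> 0 < \<beta> \<and> \<alpha> + \<beta> \<le> pi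
    \<and> e = {u, v} \<and> p u = cos \<alpha> *\<^sub>R z - sin \<alpha> *\<^sub>R \<tau> \<and> p v = cos \<beta> *\<^sub>R z + sin \<beta> *\<^sub>R \<tau>
    \<and> a e = (\<lambda>r. cos r *\<^sub>R z + sin r *\<^sub>R \<tau>) ` {-\<alpha>..\<beta>}"

lemma arc_through_flip:
  assumes "arc_through p a e z \<tau> u v \<alpha> \<beta>"
  shows "arc_through p a e z (- \<tau>) v u \<beta> \<alpha>"
proof -
  have "(\<lambda>r. cos r *\<^sub>R z + sin r *\<^sub>R \<tau>) ` {-\<alpha>..\<beta>} = (\<lambda>r. cos r *\<^sub>R z + sin r *\<^sub>R (- \<tau>)) ` uminus ` {-\<alpha>..\<beta>}"
    unfolding image_image by simp
  also have "uminus ` {-\<alpha>..\<beta>} = {-\<beta>..\<alpha>}" by simp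
  finally show ?thesis using assms by (auto simp: arc_through_def)
qed

locale complete_drawing =
  fixes V :: "'v set" and p :: "'v \<Rightarrow> real ^ 3" and a :: "'v set \<Rightarrow> (real ^ 3) set"
  assumes finV: "finite V" and drawing: "spherical_geodesic_drawing V {e. e \<subseteq> V \<and> card e = 2} p a"
begin

lemma norm_p: "u \<in> V \<Longrightarrow> norm (p u) = 1"
proof -
  assume "u \<in> V"
  then have "p u \<in> sphere 0 1" using drawing unfolding spherical_geodesic_drawing_def by blast
  then show ?thesis by simp
qed

lemma inj_p: "\<lbrakk>u \<in> V; v \<in> V; p u = p v\<rbrakk> \<Longrightarrow> u = v"
  using drawing unfolding spherical_geodesic_drawing_def by (meson inj_onD)

lemma vertex_not_on_arc: "\<lbrakk>u \<in> V; v \<in> V; u \<noteq> v; x \<in> V; x \<noteq> u; x \<noteq> v\<rbrakk> \<Longrightarrow> p x \<notin> a {u, v}"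
proof -
  assume *: "u \<in> V" "v \<in> V" "u \<noteq> v" "x \<in> V" "x \<noteq> u" "x \<noteq> v"
  then have "{u, v} \<in> {e. e \<subseteq> V \<and> card e = 2}" "x \<in> V - {u, v}" by simp_all
  then show ?thesis using drawing unfolding spherical_geodesic_drawing_def by blast
qed

lemma arc_circle:
  assumes "u \<in> V" "v \<in> V" "u \<noteq> v"
  obtains w \<theta> where "0 < \<theta>" "\<theta> \<le> pi" "norm w = 1" "p u \<bullet> w = 0" "p v = cos \<theta> *\<^sub>R p u + sin \<theta> *\<^sub>R w"
    "a {u, v} = circle_arc (p u) w \<theta>"
proof -
  have "min_geodesic_arc (p u) (p v) (a {u, v})"
  proof -
    have "{u, v} \<in> {e. e \<subseteq> V \<and> card e = 2}" using assms by simp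
    then show ?thesis using drawing unfolding spherical_geodesic_drawing_def by blast
  qed
  moreover have "p u \<noteq> p v" using inj_p assms by blast
  ultimately show thesis
    using min_geodesic_arc_circle[of "p u" "p v" "a {u, v}"] norm_p assms that by blast
qed

lemma interior_arc_through:
  assumes e: "e \<subseteq> V" "card e = 2" and z: "z \<in> edge_interior p a e"
  obtains \<tau> u v \<alpha> \<beta> where "arc_through p a e z \<tau> u v \<alpha> \<beta>"
proof -
  obtain u v where uv: "e = {u, v}" "u \<noteq> v" using e(2) by (auto simp: card_2_iff)
  then have V: "u \<in> V" "v \<in> V" using e by auto
  obtain w \<theta> where c: "0 < \<theta>" "\<theta> \<le> pi" "norm w = 1" "p u \<bullet> w = 0" "p v = cos \<theta> *\<^sub>R p u + sin \<theta> *\<^sub>R w"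
    "a {u, v} = circle_arc (p u) w \<theta>" using arc_circle[OF V uv(2)] .
  have "z \<in> circle_arc (p u) w \<theta>" "z \<noteq> p u" "z \<noteq> p v" using z uv c by (auto simp: edge_interior_def)
  from circle_arc_at_interior[OF norm_p[OF V(1)] c(3,4,1,2,5) this]
  obtain \<tau> \<alpha> \<beta> where "norm z = 1" "norm \<tau> = 1" "z \<bullet> \<tau> = 0" "0 < \<alpha>" "0 < \<beta>" "\<alpha> + \<beta> \<le> pi"
    "p u = cos \<alpha> *\<^sub>R z - sin \<alpha> *\<^sub>R \<tau>" "p v = cos \<beta> *\<^sub>R z + sin \<beta> *\<^sub>R \<tau>"
    "circle_arc (p u) w \<theta> = (\<lambda>r. cos r *\<^sub>R z + sin r *\<^sub>R \<tau>) ` {-\<alpha>..\<beta>}" .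
  then have "arc_through p a e z \<tau> u v \<alpha> \<beta>" using c(6) uv(1) by (simp add: arc_through_def)
  then show thesis by (rule that)
qed

text \<open>If \<open>f\<close> reached further back than \<open>e\<close>, it would contain the end
  \<open>u\<close> of \<open>e\<close>, which would then be an end of \<open>f\<close>. It is not
  \<open>u'\<close> because cosine is strictly decreasing on the range of angles, and not
  \<open>v'\<close> because that end lies on the other side of \<open>z\<close>.\<close>

lemma endpoint_angle_le:
  assumes e: "arc_through p a e z \<tau> u v \<alpha> \<beta>" "e \<subseteq> V" and f: "arc_through p a f z \<tau> u' v' \<alpha>' \<beta>'" "f \<subseteq> V" "card f = 2"
  shows "\<alpha>' \<le> \<alpha>"
proof (rule ccontr)
  assume *: "\<not> \<alpha>' \<le> \<alpha>"
  note e = e[unfolded arc_through_def] and f = f[unfolded arc_through_def]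
  have zt: "z \<bullet> z = 1" "\<tau> \<bullet> \<tau> = 1" "z \<bullet> \<tau> = 0" "\<tau> \<bullet> z = 0" using e by (auto simp: dot_square_norm inner_commute)
  have pu: "p u = cos \<alpha> *\<^sub>R z - sin \<alpha> *\<^sub>R \<tau>" and pu': "p u' = cos \<alpha>' *\<^sub>R z - sin \<alpha>' *\<^sub>R \<tau>"
    and pv': "p v' = cos \<beta>' *\<^sub>R z + sin \<beta>' *\<^sub>R \<tau>"
    using e f by blast+
  have ab: "0 < \<alpha>" "\<alpha> < pi" "\<alpha>' < pi" "0 < \<beta>'" "\<beta>' < pi" using e f by auto
  have "p u = cos (- \<alpha>) *\<^sub>R z + sin (- \<alpha>) *\<^sub>R \<tau>" using pu by simp
  moreover have "- \<alpha> \<in> {-\<alpha>'..\<beta>'}" using * e f by auto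
  ultimately have "p u \<in> a f" using f by blast
  moreover have uV: "u \<in> V" using e by auto
  moreover have "u' \<noteq> v'" "u' \<in> V" "v' \<in> V" using f by (auto simp: card_insert_if split: if_splits)
  ultimately have "u = u' \<or> u = v'" using vertex_not_on_arc[of u' v' u] f by auto
  then show False
  proof
    assume "u = u'"
    moreover have "p u' \<bullet> z = cos \<alpha>'" "p u \<bullet> z = cos \<alpha>" unfolding pu pu' using zt by (simp_all add: inner_diff_left)
    ultimately have "cos \<alpha> = cos \<alpha>'" by simp
    moreover have "cos \<alpha>' < cos \<alpha>" using * ab by (intro cos_monotone_0_pi) auto
    ultimately show False by simp
  next
    assume "u = v'"
    moreover have "p u \<bullet> \<tau> = - sin \<alpha>" "p v' \<bullet> \<tau> = sin \<beta>'"
      unfolding pu pv' using zt by (simp_all add: inner_diff_left inner_add_left)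
    moreover have "sin \<alpha> > 0" "sin \<beta>' > 0" using ab by (auto intro!: sin_gt_zero)
    ultimately show False by simp
  qed
qed

lemma same_direction_same_edge:
  assumes e: "arc_through p a e z \<tau> u v \<alpha> \<beta>" "e \<subseteq> V" "card e = 2"
    and f: "arc_through p a f z \<tau> u' v' \<alpha>' \<beta>'" "f \<subseteq> V" "card f = 2"
  shows "e = f"
proof -
  have "\<alpha> = \<alpha>'" using endpoint_angle_le[OF e(1,2) f] endpoint_angle_le[OF f(1,2) e] by simp
  moreover have "\<beta> = \<beta>'"
    using endpoint_angle_le[OF arc_through_flip[OF e(1)] e(2) arc_through_flip[OF f(1)] f(2,3)]
      endpoint_angle_le[OF arc_through_flip[OF f(1)] f(2) arc_through_flip[OF e(1)] e(2,3)] by simp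
  ultimately have "p u = p u'" "p v = p v'" using e(1) f(1) by (auto simp: arc_through_def)
  then show ?thesis using inj_p e f by (auto simp: arc_through_def)
qed

lemma direction_ne:
  assumes e: "arc_through p a e z \<tau> u v \<alpha> \<beta>" "e \<subseteq> V" "card e = 2"
    and f: "arc_through p a f z \<tau>' u' v' \<alpha>' \<beta>'" "f \<subseteq> V" "card f = 2" and "e \<noteq> f"
  shows "\<tau> \<noteq> \<tau>'" "\<tau> \<noteq> - \<tau>'"
proof -
  show "\<tau> \<noteq> \<tau>'" using same_direction_same_edge[OF e _ f(2,3)] f(1) assms(7) by auto
  show "\<tau> \<noteq> - \<tau>'" using same_direction_same_edge[OF e _ f(2,3)] arc_through_flip[OF f(1)] assms(7) by auto
qed

text \<open>Two planes through the axis of \<open>z\<close> that share a vector off this axis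
  coincide.\<close>

lemma direction_eq:
  fixes z \<tau> \<tau>' :: "real ^ 3"
  assumes "norm z = 1" "norm \<tau> = 1" "norm \<tau>' = 1" "z \<bullet> \<tau> = 0" "z \<bullet> \<tau>' = 0"
    and "c *\<^sub>R z + d *\<^sub>R \<tau> = c' *\<^sub>R z + d' *\<^sub>R \<tau>'" "d \<noteq> 0"
  shows "\<tau> = \<tau>' \<or> \<tau> = - \<tau>'"
proof -
  have "z \<bullet> z = 1" using assms by (simp add: dot_square_norm)
  then have "c = c'" using arg_cong[OF assms(6), of "\<lambda>q. z \<bullet> q"] assms(4,5) by (simp add: inner_add_right)
  then have eq: "d *\<^sub>R \<tau> = d' *\<^sub>R \<tau>'" using assms(6) by simp
  have "norm (d *\<^sub>R \<tau>) = norm (d' *\<^sub>R \<tau>')" by (simp only: eq)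
  then have "\<bar>d\<bar> = \<bar>d'\<bar>" using assms(2,3) by simp
  then have "d' = d \<or> d' = - d" by (auto simp: abs_eq_iff)
  then show ?thesis
  proof
    assume "d' = d" then show ?thesis using eq assms(7) by simp
  next
    assume "d' = - d"
    then have "d *\<^sub>R \<tau> = d *\<^sub>R (- \<tau>')" using eq by simp
    then show ?thesis using assms(7) by (metis scaleR_left_imp_eq)
  qed
qed

text \<open>A common end would lie on both great circles and off the axis of \<open>z\<close>,
  forcing equal tangents up to sign. A crossing therefore involves exactly four vertices, as the
  deletion argument requires.\<close>

lemma crossing_edges_disjoint:
  assumes e: "e \<subseteq> V" "card e = 2" and f: "f \<subseteq> V" "card f = 2" and "e \<noteq> f"
    and z: "z \<in> edge_interior p a e" "z \<in> edge_interior p a f"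
  shows "e \<inter> f = {}"
proof (rule ccontr)
  assume "e \<inter> f \<noteq> {}"
  obtain \<tau> u v \<alpha> \<beta> where E: "arc_through p a e z \<tau> u v \<alpha> \<beta>" using interior_arc_through[OF e z(1)] .
  obtain \<tau>' u' v' \<alpha>' \<beta>' where F: "arc_through p a f z \<tau>' u' v' \<alpha>' \<beta>'" using interior_arc_through[OF f z(2)] .
  note ne = direction_ne[OF E e F f \<open>e \<noteq> f\<close>]
  have pos: "sin \<alpha> > 0" "sin \<beta> > 0"
    using E by (auto simp: arc_through_def intro!: sin_gt_zero)
  have pe: "\<exists>c d. d \<noteq> 0 \<and> p q = c *\<^sub>R z + d *\<^sub>R \<tau>" if "q \<in> e" for q
  proof -
    have "p u = cos \<alpha> *\<^sub>R z + (- sin \<alpha>) *\<^sub>R \<tau>" "p v = cos \<beta> *\<^sub>R z + sin \<beta> *\<^sub>R \<tau>" "e = {u, v}"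
      using E by (auto simp: arc_through_def)
    then show ?thesis using that pos by (metis insertE neg_equal_0_iff_equal order_less_irrefl singletonD)
  qed
  have pf: "\<exists>c d. p q = c *\<^sub>R z + d *\<^sub>R \<tau>'" if "q \<in> f" for q
  proof -
    have "p u' = cos \<alpha>' *\<^sub>R z + (- sin \<alpha>') *\<^sub>R \<tau>'" "p v' = cos \<beta>' *\<^sub>R z + sin \<beta>' *\<^sub>R \<tau>'" "f = {u', v'}"
      using F by (auto simp: arc_through_def)
    then show ?thesis using that by (metis insertE singletonD)
  qed
  obtain q where "q \<in> e" "q \<in> f" using \<open>e \<inter> f \<noteq> {}\<close> by blast
  then obtain c d c' d' where "d \<noteq> 0" "p q = c *\<^sub>R z + d *\<^sub>R \<tau>" "p q = c' *\<^sub>R z + d' *\<^sub>R \<tau>'"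
    using pe pf by blast
  then show False using direction_eq[of z \<tau> \<tau>' c d c' d'] ne E F by (auto simp: arc_through_def)
qed

lemma common_interior_points:
  assumes e: "e \<subseteq> V" "card e = 2" and f: "f \<subseteq> V" "card f = 2" and "e \<noteq> f"
    and z: "z \<in> edge_interior p a e" "z \<in> edge_interior p a f"
    and y: "y \<in> edge_interior p a e" "y \<in> edge_interior p a f"
  shows "y = z \<or> y = - z"
proof -
  obtain \<tau> u v \<alpha> \<beta> where E: "arc_through p a e z \<tau> u v \<alpha> \<beta>" using interior_arc_through[OF e z(1)] .
  obtain \<tau>' u' v' \<alpha>' \<beta>' where F: "arc_through p a f z \<tau>' u' v' \<alpha>' \<beta>'" using interior_arc_through[OF f z(2)] .
  note ne = direction_ne[OF E e F f \<open>e \<noteq> f\<close>]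
  have "y \<in> a e" "y \<in> a f" using y by (auto simp: edge_interior_def)
  then obtain r r' where r: "y = cos r *\<^sub>R z + sin r *\<^sub>R \<tau>" "y = cos r' *\<^sub>R z + sin r' *\<^sub>R \<tau>'"
    using E F unfolding arc_through_def by blast
  have "sin r = 0"
    using direction_eq[of z \<tau> \<tau>' "cos r" "sin r" "cos r'" "sin r'"] r ne E F by (auto simp: arc_through_def)
  then have "cos r = 1 \<or> cos r = - 1" using sin_zero_abs_cos_one[of r] by auto
  then show ?thesis using r(1) \<open>sin r = 0\<close> by auto
qed

text \<open>Finiteness matters because \<open>card\<close> is 0 on infinite sets. Allowing both
  \<open>z\<close> and \<open>- z\<close> for each pair of edges is crude but sufficient for a
  quartic bound.\<close>

lemma crossings_bound:
  defines "E \<equiv> {e. e \<subseteq> V \<and> card e = 2}"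
  shows "finite (crossings E p a)" "card (crossings E p a) \<le> 2 * (card E * card E)"
proof -
  have finE: "finite E" using finV by (auto simp: E_def)
  define C where "C e f = (if e = f then {} else edge_interior p a e \<inter> edge_interior p a f)" for e f
  have C: "finite (C e f) \<and> card (C e f) \<le> 2" if "e \<in> E" "f \<in> E" for e f
  proof (cases "C e f = {}")
    case False
    then obtain z where z: "z \<in> C e f" by blast
    then have "C e f \<subseteq> {z, - z}"
      using common_interior_points[of e f z] that by (auto simp: C_def E_def split: if_splits)
    moreover have "card {z, - z} \<le> 2" by (simp add: card_insert_if)
    ultimately show ?thesis using card_mono[of "{z, - z}" "C e f"] by (auto intro: finite_subset)
  qed simp
  have sub: "crossings E p a \<subseteq> (\<Union>(e, f)\<in>E \<times> E. (\<lambda>x. ({e, f}, x)) ` C e f)"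
    unfolding crossings_def C_def by fastforce
  have fin: "finite (\<Union>(e, f)\<in>E \<times> E. (\<lambda>x. ({e, f}, x)) ` C e f)" using finE C by auto
  then show "finite (crossings E p a)" using sub finite_subset by blast
  have "card (crossings E p a) \<le> card (\<Union>(e, f)\<in>E \<times> E. (\<lambda>x. ({e, f}, x)) ` C e f)"
    using fin sub by (rule card_mono)
  also have "\<dots> \<le> (\<Sum>i\<in>E \<times> E. card ((\<lambda>(e, f). (\<lambda>x. ({e, f}, x)) ` C e f) i))"
    using finE by (intro card_UN_le) simp
  also have "\<dots> \<le> (\<Sum>i\<in>E \<times> E. 2)"
  proof (rule sum_mono)
    fix i assume "i \<in> E \<times> E"
    then obtain e f where "i = (e, f)" "e \<in> E" "f \<in> E" by auto
    then show "card ((\<lambda>(e, f). (\<lambda>x. ({e, f}, x)) ` C e f) i) \<le> 2"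
      using C[of e f] card_image_le[of "C e f" "\<lambda>x. ({e, f}, x)"] by auto
  qed
  also have "\<dots> = 2 * (card E * card E)" by (simp add: card_cartesian_product)
  finally show "card (crossings E p a) \<le> 2 * (card E * card E)" .
qed

end

section \<open>Perturbing a drawing\<close>

text \<open>Here \<open>S\<close> is the total weight of the coefficients of a unit vector whose
  main part has size at least \<open>\<kappa> * S\<close>. Once \<open>\<zeta>\<close> is below
  \<open>\<kappa> / 2\<close>, the weight is at most \<open>2 / \<kappa>\<close>, so a relative
  error \<open>\<zeta>\<close> is also small absolutely.\<close>

lemma error_vanishes:
  fixes e :: "nat \<Rightarrow> 'b :: real_normed_vector"
  assumes "\<And>t. norm (e t) \<le> S t * \<zeta> t" "\<And>t. \<kappa> * S t - S t * \<zeta> t \<le> 1" "\<And>t. 0 \<le> S t"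
    and \<kappa>: "0 < \<kappa>" and \<zeta>: "\<zeta> \<longlonglongrightarrow> (0 :: real)"
  shows "e \<longlonglongrightarrow> 0"
proof (rule Lim_null_comparison)
  show "(\<lambda>t. 2 / \<kappa> * \<bar>\<zeta> t\<bar>) \<longlonglongrightarrow> 0"
    using tendsto_mult_left[OF tendsto_rabs[OF \<zeta>], of "2 / \<kappa>"] by simp
  have "eventually (\<lambda>t. \<zeta> t < \<kappa> / 2) sequentially"
    using \<kappa> by (intro order_tendstoD(2)[OF \<zeta>]) simp
  then show "\<forall>\<^sub>F t in sequentially. norm (e t) \<le> 2 / \<kappa> * \<bar>\<zeta> t\<bar>"
  proof (rule eventually_mono)
    fix t assume "\<zeta> t < \<kappa> / 2"
    then have "S t * (\<kappa> / 2) \<le> S t * (\<kappa> - \<zeta> t)" using assms(3)[of t] by (intro mult_left_mono) auto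
    also have "\<dots> \<le> 1" using assms(2)[of t] by (simp add: algebra_simps)
    finally have "S t \<le> 2 / \<kappa>" using \<kappa> by (simp add: field_simps)
    moreover have "norm (e t) \<le> S t * \<bar>\<zeta> t\<bar>"
      using assms(1)[of t] mult_left_mono[OF abs_ge_self[of "\<zeta> t"] assms(3)[of t]] by linarith
    ultimately show "norm (e t) \<le> 2 / \<kappa> * \<bar>\<zeta> t\<bar>"
      using mult_right_mono[of "S t" "2 / \<kappa>" "\<bar>\<zeta> t\<bar>"] by linarith
  qed
qed

text \<open>Genericity for all large parameters can thus be checked at the parameter 0, although the
  limit of interest is at infinity.\<close>

lemma poly_eventually_nonzero:
  fixes P :: "real poly"
  assumes "poly P 0 \<noteq> 0"
  shows "eventually (\<lambda>m. poly P (real m) \<noteq> 0) sequentially"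
proof -
  have "P \<noteq> 0" using assms by auto
  then have "finite {x. poly P x = 0}" by (rule poly_roots_finite)
  moreover have "real ` {m. poly P (real m) = 0} \<subseteq> {x. poly P x = 0}" by auto
  ultimately have "finite {m. poly P (real m) = 0}"
    by (meson finite_imageD finite_subset inj_of_nat inj_on_subset subset_UNIV)
  then show ?thesis by (simp add: cofinite_eq_sequentially[symmetric] eventually_cofinite)
qed

lemma choose_coefficients:
  fixes Z x y :: "nat \<Rightarrow> real ^ 3"
  assumes "\<And>t. \<exists>A B. 0 \<le> A \<and> 0 \<le> B \<and> Z t = A *\<^sub>R x t + B *\<^sub>R y t"
  obtains A B where "\<And>t. 0 \<le> A t" "\<And>t. 0 \<le> B t" "\<And>t. Z t = A t *\<^sub>R x t + B t *\<^sub>R y t"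
proof -
  have "\<forall>t. \<exists>c. 0 \<le> fst c \<and> 0 \<le> snd c \<and> Z t = fst c *\<^sub>R x t + snd c *\<^sub>R y t"
    using assms by simp
  from choice[OF this] obtain c where "\<And>t. 0 \<le> fst (c t) \<and> 0 \<le> snd (c t) \<and> Z t = fst (c t) *\<^sub>R x t + snd (c t) *\<^sub>R y t"
    by blast
  then show thesis using that[of "\<lambda>t. fst (c t)" "\<lambda>t. snd (c t)"] by blast
qed

text \<open>Points of the moment curve: any three are independent, by the Vandermonde determinant.
  The shift by 1 keeps the second coordinate nonzero at index 0.\<close>

definition moment :: "nat \<Rightarrow> real ^ 3" where
  "moment i = vector [1, real i + 1, (real i + 1)\<^sup>2]"

lemma moment_nth [simp]: "moment i $ 1 = 1" "moment i $ 2 = real i + 1" "moment i $ 3 = (real i + 1)\<^sup>2"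
  by (simp_all add: moment_def)

lemma det3_moment:
  assumes "i \<noteq> j" "j \<noteq> k" "i \<noteq> k"
  shows "det3 (moment i) (moment j) (moment k) \<noteq> 0"
proof -
  have "det3 (moment i) (moment j) (moment k) = (real j - real i) * (real k - real i) * (real k - real j)"
    by (simp add: det3_def power2_eq_square algebra_simps)
  then show ?thesis using assms by simp
qed

locale complete_nat_drawing = complete_drawing V p a
  for V :: "nat set" and p :: "nat \<Rightarrow> real ^ 3" and a :: "nat set \<Rightarrow> (real ^ 3) set"
begin

text \<open>The arc between antipodal vertices is not determined by them, so these two vertices are
  pushed towards the midpoint of the arc.\<close>

definition push :: "nat \<Rightarrow> real ^ 3" where
  "push i = (if \<exists>j\<in>V. p j = - p i then (SOME m. \<exists>j\<in>V. p j = - p i \<and> m \<in> a {i, j} \<and> m \<bullet> p i = 0) else 0)"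

text \<open>Up to the positive factor \<open>\<delta>\<^sup>2\<close> this moves \<open>p i\<close>
  by a push of first order and a generic displacement of second order in
  \<open>1 / \<delta>\<close>. The push dominates, so it decides which semicircle between antipodal
  vertices is approached. In this scaling everything is polynomial in \<open>\<delta>\<close>, with
  value \<open>moment i\<close> at 0.\<close>

definition perturbed :: "real \<Rightarrow> nat \<Rightarrow> real ^ 3" where
  "perturbed \<delta> i = \<delta>\<^sup>2 *\<^sub>R p i + \<delta> *\<^sub>R push i + moment i"

text \<open>The choice in \<open>push\<close> has a single candidate: a vertex has at most one
  antipodal vertex by injectivity, and the midpoint is the only point of a semicircle orthogonal to
  its ends.\<close>

lemma push_antipodal:
  assumes V: "i \<in> V" "j \<in> V" and anti: "p j = - p i"
    and w: "norm w = 1" "p i \<bullet> w = 0" "a {i, j} = circle_arc (p i) w pi"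
  shows "push i = w" "push j = w"
proof -
  have pp: "p i \<bullet> p i = 1" using norm_p[OF V(1)] by (simp add: dot_square_norm)
  have mid: "m \<in> a {i, j} \<and> m \<bullet> p i = 0 \<longleftrightarrow> m = w" for m
  proof
    assume "m \<in> a {i, j} \<and> m \<bullet> p i = 0"
    then obtain s where s: "0 \<le> s" "s \<le> pi" "m = cos s *\<^sub>R p i + sin s *\<^sub>R w" "m \<bullet> p i = 0"
      by (auto simp: w(3) circle_arc_def)
    then have "cos s = 0" using pp w(2) by (simp add: inner_add_left inner_commute[of w])
    moreover have "sin s \<ge> 0" using s by (intro sin_ge_zero)
    ultimately have "sin s = 1" using sin_cos_squared_add[of s] by (simp add: power2_eq_1_iff)
    then show "m = w" using s(3) \<open>cos s = 0\<close> by simp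
  next
    assume "m = w"
    moreover have "w \<in> circle_arc (p i) w pi"
      unfolding circle_arc_def by (intro image_eqI[of _ _ "pi / 2"]) auto
    ultimately show "m \<in> a {i, j} \<and> m \<bullet> p i = 0" using w by (simp add: inner_commute)
  qed
  have "k = j" if "k \<in> V" "p k = - p i" for k using inj_p[of k j] that V anti by simp
  then have "{k \<in> V. p k = - p i} = {j}" using V anti by blast
  moreover have "(\<exists>k\<in>V. p k = - p i \<and> m \<in> a {i, k} \<and> m \<bullet> p i = 0)
      \<longleftrightarrow> (\<exists>k\<in>{k \<in> V. p k = - p i}. m \<in> a {i, k} \<and> m \<bullet> p i = 0)" for m by blast
  ultimately have "(\<exists>k\<in>V. p k = - p i \<and> m \<in> a {i, k} \<and> m \<bullet> p i = 0) \<longleftrightarrow> m = w" for m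
    using mid[of m] by simp
  moreover have "\<exists>k\<in>V. p k = - p i" using V anti by blast
  ultimately show "push i = w" by (simp add: push_def)
  have "k = i" if "k \<in> V" "p k = - p j" for k using inj_p[of k i] that V anti by simp
  then have "{k \<in> V. p k = - p j} = {i}" using V anti by auto
  moreover have "(\<exists>k\<in>V. p k = - p j \<and> m \<in> a {j, k} \<and> m \<bullet> p j = 0)
      \<longleftrightarrow> (\<exists>k\<in>{k \<in> V. p k = - p j}. m \<in> a {j, k} \<and> m \<bullet> p j = 0)" for m by blast
  ultimately have "(\<exists>k\<in>V. p k = - p j \<and> m \<in> a {j, k} \<and> m \<bullet> p j = 0) \<longleftrightarrow> m = w" for m
    using mid[of m] anti by (simp add: insert_commute)
  moreover have "\<exists>k\<in>V. p k = - p j" using V anti by auto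
  ultimately show "push j = w" by (simp add: push_def)
qed

text \<open>A unit vector of the perturbed cone is a point of the cone over the arc plus an error.
  The difficulty is that the coefficients are not bounded beforehand.\<close>

lemma perturbed_cone_limit:
  assumes V: "i \<in> V" "j \<in> V" "i \<noteq> j" and \<delta>: "filterlim \<delta> at_top sequentially" "\<And>t. 0 < \<delta> t"
    and AB: "\<And>t. 0 \<le> A t" "\<And>t. 0 \<le> B t"
    and Z: "\<And>t. Z t = A t *\<^sub>R perturbed (\<delta> t) i + B t *\<^sub>R perturbed (\<delta> t) j" "\<And>t. norm (Z t) = 1" "Z \<longlonglongrightarrow> z"
  shows "z \<in> a {i, j}"
proof -
  obtain w \<theta> where c: "0 < \<theta>" "\<theta> \<le> pi" "norm w = 1" "p i \<bullet> w = 0" "p j = cos \<theta> *\<^sub>R p i + sin \<theta> *\<^sub>R w"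
    "a {i, j} = circle_arc (p i) w \<theta>" using arc_circle[OF V] .
  have nz: "norm z = 1" using tendsto_norm[OF Z(3)] Z(2) LIMSEQ_unique[of "\<lambda>t. norm (Z t)"] by simp
  define \<alpha> where "\<alpha> t = A t * (\<delta> t)\<^sup>2" for t
  define \<beta> where "\<beta> t = B t * (\<delta> t)\<^sup>2" for t
  define \<eta> where "\<eta> t = 1 / \<delta> t" for t
  have \<alpha>\<beta>: "0 \<le> \<alpha> t" "0 \<le> \<beta> t" "0 < \<eta> t" for t using AB \<delta>(2) by (simp_all add: \<alpha>_def \<beta>_def \<eta>_def)
  have \<eta>: "\<eta> \<longlonglongrightarrow> 0" unfolding \<eta>_def using \<delta>(1) by (rule tendsto_divide_0[OF tendsto_const filterlim_at_top_imp_at_infinity])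
  have pert: "A t *\<^sub>R perturbed (\<delta> t) k = (A t * (\<delta> t)\<^sup>2) *\<^sub>R (p k + \<eta> t *\<^sub>R push k + (\<eta> t)\<^sup>2 *\<^sub>R moment k)" for A :: "nat \<Rightarrow> real" and t k
    using \<delta>(2)[of t] by (simp add: perturbed_def \<eta>_def algebra_simps power2_eq_square)
  have Zeq: "Z t = \<alpha> t *\<^sub>R (p i + \<eta> t *\<^sub>R push i + (\<eta> t)\<^sup>2 *\<^sub>R moment i)
      + \<beta> t *\<^sub>R (p j + \<eta> t *\<^sub>R push j + (\<eta> t)\<^sup>2 *\<^sub>R moment j)" for t
    unfolding Z(1) pert \<alpha>_def \<beta>_def ..
  define q where "q = max (norm (push i)) (norm (push j))"
  define r where "r = max (norm (moment i)) (norm (moment j))"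
  have comb: "norm (\<alpha> t *\<^sub>R x + \<beta> t *\<^sub>R y) \<le> (\<alpha> t + \<beta> t) * max (norm x) (norm y)" for t and x y :: "real ^ 3"
  proof -
    have "norm (\<alpha> t *\<^sub>R x + \<beta> t *\<^sub>R y) \<le> \<alpha> t * norm x + \<beta> t * norm y"
      using norm_triangle_ineq[of "\<alpha> t *\<^sub>R x" "\<beta> t *\<^sub>R y"] \<alpha>\<beta>[of t] by simp
    also have "\<dots> \<le> \<alpha> t * max (norm x) (norm y) + \<beta> t * max (norm x) (norm y)"
      using \<alpha>\<beta>[of t] by (intro add_mono mult_left_mono) auto
    finally show ?thesis by (simp add: distrib_right)
  qed
  note arc_lim = circle_arc_limit[OF norm_p[OF V(1)] c(3,4,1,2) Z(3) _ nz]
  show ?thesis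
  proof (cases "\<theta> = pi")
    case False
    then have th: "\<theta> < pi" using c by simp
    then have sp: "sin \<theta> > 0" using c by (intro sin_gt_zero)
    have cp: "cos \<theta> > - 1" using cos_monotone_0_pi[of \<theta> pi] th c by simp
    define e where "e t = \<eta> t *\<^sub>R (\<alpha> t *\<^sub>R push i + \<beta> t *\<^sub>R push j) + (\<eta> t)\<^sup>2 *\<^sub>R (\<alpha> t *\<^sub>R moment i + \<beta> t *\<^sub>R moment j)" for t
    have Ze: "Z t = (\<alpha> t *\<^sub>R p i + \<beta> t *\<^sub>R p j) + e t" for t
      unfolding Zeq e_def by (simp add: algebra_simps)
    have "e \<longlonglongrightarrow> 0"
    proof (rule error_vanishes)
      show n: "norm (e t) \<le> (\<alpha> t + \<beta> t) * (\<eta> t * q + (\<eta> t)\<^sup>2 * r)" for t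
      proof -
        have "norm (e t) \<le> \<eta> t * norm (\<alpha> t *\<^sub>R push i + \<beta> t *\<^sub>R push j) + (\<eta> t)\<^sup>2 * norm (\<alpha> t *\<^sub>R moment i + \<beta> t *\<^sub>R moment j)"
          unfolding e_def by (rule order_trans[OF norm_triangle_ineq]) (use \<alpha>\<beta>[of t] in simp)
        also have "\<dots> \<le> \<eta> t * ((\<alpha> t + \<beta> t) * q) + (\<eta> t)\<^sup>2 * ((\<alpha> t + \<beta> t) * r)"
          unfolding q_def r_def using \<alpha>\<beta>[of t] by (intro add_mono mult_left_mono comb) auto
        finally show ?thesis by (simp add: algebra_simps)
      qed
      \<comment> \<open>The constant comes from testing the main part against
        \<open>p i + p j\<close>, a vector of norm at most 2.\<close>
      show "(1 + cos \<theta>) / 2 * (\<alpha> t + \<beta> t) - (\<alpha> t + \<beta> t) * (\<eta> t * q + (\<eta> t)\<^sup>2 * r) \<le> 1" for t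
      proof -
        have ii: "p i \<bullet> p i = 1" "p j \<bullet> p j = 1" using norm_p V by (simp_all add: dot_square_norm)
        have ij: "p i \<bullet> p j = cos \<theta>" using ii c(4) by (simp add: c(5) inner_add_right)
        have "(\<alpha> t + \<beta> t) * (1 + cos \<theta>) = (\<alpha> t *\<^sub>R p i + \<beta> t *\<^sub>R p j) \<bullet> (p i + p j)"
          using ii ij by (simp add: inner_add_left inner_add_right inner_commute[of "p j" "p i"] algebra_simps)
        also have "\<dots> \<le> norm (\<alpha> t *\<^sub>R p i + \<beta> t *\<^sub>R p j) * norm (p i + p j)" by (rule norm_cauchy_schwarz)
        also have "\<dots> \<le> norm (\<alpha> t *\<^sub>R p i + \<beta> t *\<^sub>R p j) * 2"
          using norm_triangle_ineq[of "p i" "p j"] norm_p V by (intro mult_left_mono) auto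
        also have "\<alpha> t *\<^sub>R p i + \<beta> t *\<^sub>R p j = Z t - e t" using Ze by simp
        also have "norm (Z t - e t) * 2 \<le> (1 + norm (e t)) * 2"
          using norm_triangle_ineq4[of "Z t" "e t"] Z(2) by simp
        finally show ?thesis using n[of t] by (simp add: field_simps)
      qed
      show "(\<lambda>t. \<eta> t * q + (\<eta> t)\<^sup>2 * r) \<longlonglongrightarrow> 0" by (rule tendsto_eq_intros \<eta> refl)+ simp
    qed (use \<alpha>\<beta> cp in auto)
    moreover have "Z t = (\<alpha> t + \<beta> t * cos \<theta>) *\<^sub>R p i + (\<beta> t * sin \<theta>) *\<^sub>R w + e t" for t
      unfolding Ze c(5) by (simp add: algebra_simps)
    moreover have "0 \<le> \<beta> t * sin \<theta>" for t using \<alpha>\<beta>[of t] sp by simp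
    moreover have "0 \<le> (\<alpha> t + \<beta> t * cos \<theta>) * sin \<theta> - \<beta> t * sin \<theta> * cos \<theta>" for t
      using \<alpha>\<beta>[of t] sp by (simp add: algebra_simps)
    ultimately show ?thesis unfolding c(6) by (intro arc_lim)
  next
    case True
    then have anti: "p j = - p i" and arc: "a {i, j} = circle_arc (p i) w pi" using c(5,6) by auto
    note push = push_antipodal[OF V(1,2) anti c(3,4) arc]
    \<comment> \<open>For antipodal ends the leading terms may cancel, leaving the coefficient sum
      unbounded. The component \<open>d\<close> along \<open>w\<close> takes its place: it is
      controlled by the unit norm, and the error is smaller by a factor of order
      \<open>\<eta>\<close>.\<close>
    define d where "d t = \<eta> t * (\<alpha> t + \<beta> t)" for t
    define e where "e t = (\<eta> t)\<^sup>2 *\<^sub>R (\<alpha> t *\<^sub>R moment i + \<beta> t *\<^sub>R moment j)" for t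
    have Ze: "Z t = (\<alpha> t - \<beta> t) *\<^sub>R p i + d t *\<^sub>R w + e t" for t
      unfolding Zeq e_def d_def push anti by (simp add: algebra_simps)
    have d0: "0 \<le> d t" for t using \<alpha>\<beta>[of t] by (simp add: d_def)
    have "e \<longlonglongrightarrow> 0"
    proof (rule error_vanishes)
      show n: "norm (e t) \<le> d t * (\<eta> t * r)" for t
      proof -
        have "norm (e t) \<le> (\<eta> t)\<^sup>2 * ((\<alpha> t + \<beta> t) * r)"
          unfolding e_def r_def using \<alpha>\<beta>[of t] comb by (simp add: mult_left_mono)
        then show ?thesis by (simp add: d_def power2_eq_square algebra_simps)
      qed
      show "1 * d t - d t * (\<eta> t * r) \<le> 1" for t
      proof -
        have ww: "w \<bullet> w = 1" using c(3) by (simp add: dot_square_norm)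
        have "d t = Z t \<bullet> w - e t \<bullet> w" unfolding Ze using ww c(4) by (simp add: inner_add_left)
        also have "\<dots> \<le> norm (Z t) * norm w + norm (e t) * norm w"
          using norm_cauchy_schwarz[of "Z t" w] Cauchy_Schwarz_ineq2[of "e t" w] by linarith
        finally show ?thesis using n[of t] Z(2)[of t] c(3) by simp
      qed
      show "(\<lambda>t. \<eta> t * r) \<longlonglongrightarrow> 0" by (rule tendsto_eq_intros \<eta> refl)+ simp
    qed (use d0 in auto)
    moreover have "0 \<le> (\<alpha> t - \<beta> t) * sin \<theta> - d t * cos \<theta>" for t using d0[of t] True by simp
    ultimately show ?thesis unfolding c(6) using Ze d0 by (intro arc_lim)
  qed
qed

text \<open>If the sign pattern occurred for infinitely many parameters, the two perturbed cones
  would share unit vectors, and by compactness a limit of these would lie on both arcs. Perturbing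
  may lose meeting pairs but creates none, which is the direction a lower bound needs.\<close>

lemma crossing_signs_eventually_meet:
  assumes V: "i \<in> V" "j \<in> V" "k \<in> V" "l \<in> V" "i \<noteq> j" "k \<noteq> l" and disj: "a {i, j} \<inter> a {k, l} = {}"
  shows "eventually (\<lambda>m. \<not> crossing_signs (\<lambda>i j k. sgn (det3 (perturbed (real m) i) (perturbed (real m) j) (perturbed (real m) k))) i j k l) sequentially"
proof (rule ccontr)
  define Q where "Q m \<longleftrightarrow> crossing_signs (\<lambda>i j k. sgn (det3 (perturbed (real m) i) (perturbed (real m) j) (perturbed (real m) k))) i j k l" for m :: nat
  assume "\<not> ?thesis"
  then have "\<exists>\<^sub>F m in sequentially. Q m" by (simp add: frequently_def Q_def)
  then have "infinite {m. Q m}" by (simp add: frequently_cofinite[symmetric] cofinite_eq_sequentially)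
  then have inf: "infinite ({m. Q m} - {0})" by simp
  define \<phi> where "\<phi> = enumerate ({m. Q m} - {0})"
  have \<phi>: "strict_mono \<phi>" "\<And>t. Q (\<phi> t)" "\<And>t. \<phi> t > 0"
    using strict_mono_enumerate[OF inf] enumerate_in_set[OF inf] by (auto simp: \<phi>_def)
  have "\<forall>t. \<exists>z. norm z = 1
      \<and> (\<exists>A B. 0 \<le> A \<and> 0 \<le> B \<and> z = A *\<^sub>R perturbed (real (\<phi> t)) i + B *\<^sub>R perturbed (real (\<phi> t)) j)
      \<and> (\<exists>C D. 0 \<le> C \<and> 0 \<le> D \<and> z = C *\<^sub>R perturbed (real (\<phi> t)) k + D *\<^sub>R perturbed (real (\<phi> t)) l)"
  proof
    fix t
    let ?b = "perturbed (real (\<phi> t))"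
    obtain c1 c2 c3 c4 where c: "c1 > 0" "c2 > 0" "c3 > 0" "c4 > 0"
      "c1 *\<^sub>R ?b i + c2 *\<^sub>R ?b j = c3 *\<^sub>R ?b k + c4 *\<^sub>R ?b l"
      using crossing_signs_imp_cones_meet[OF \<phi>(2)[of t, unfolded Q_def]] .
    define u where "u = c1 *\<^sub>R ?b i + c2 *\<^sub>R ?b j"
    have "det3 (?b i) (?b j) (?b k) \<noteq> 0" using \<phi>(2)[of t] by (auto simp: Q_def crossing_signs_def sgn_0_0)
    moreover have "det3 (?b i) (?b j) (?b k) = 0" if "u = 0"
    proof -
      have n: "c1 * ?b i $ n + c2 * ?b j $ n = 0" for n
      proof -
        have "u $ n = 0" using that by simp
        then show ?thesis by (simp add: u_def)
      qed
      have "c1 * det3 (?b i) (?b j) (?b k) = 0" unfolding det3_def using n[of 1] n[of 2] n[of 3] by algebra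
      then show ?thesis using c(1) by simp
    qed
    ultimately have "norm u > 0" by auto
    let ?z = "(1 / norm u) *\<^sub>R u"
    have z1: "norm ?z = 1" using \<open>norm u > 0\<close> by simp
    have z2: "?z = (c1 / norm u) *\<^sub>R ?b i + (c2 / norm u) *\<^sub>R ?b j"
      unfolding u_def by (simp add: scaleR_add_right)
    have z3: "?z = (c3 / norm u) *\<^sub>R ?b k + (c4 / norm u) *\<^sub>R ?b l"
      unfolding u_def c(5) by (simp add: scaleR_add_right)
    have "0 \<le> c1 / norm u" "0 \<le> c2 / norm u" "0 \<le> c3 / norm u" "0 \<le> c4 / norm u" using c by simp_all
    with z2 z3 have "\<exists>A B. 0 \<le> A \<and> 0 \<le> B \<and> ?z = A *\<^sub>R ?b i + B *\<^sub>R ?b j"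
      "\<exists>C D. 0 \<le> C \<and> 0 \<le> D \<and> ?z = C *\<^sub>R ?b k + D *\<^sub>R ?b l" by blast+
    with z1 show "\<exists>z. norm z = 1 \<and> (\<exists>A B. 0 \<le> A \<and> 0 \<le> B \<and> z = A *\<^sub>R ?b i + B *\<^sub>R ?b j)
      \<and> (\<exists>C D. 0 \<le> C \<and> 0 \<le> D \<and> z = C *\<^sub>R ?b k + D *\<^sub>R ?b l)"
      by (intro exI[of _ ?z] conjI)
  qed
  from choice[OF this] obtain Z where ZZ: "\<forall>t. norm (Z t) = 1
      \<and> (\<exists>A B. 0 \<le> A \<and> 0 \<le> B \<and> Z t = A *\<^sub>R perturbed (real (\<phi> t)) i + B *\<^sub>R perturbed (real (\<phi> t)) j)
      \<and> (\<exists>C D. 0 \<le> C \<and> 0 \<le> D \<and> Z t = C *\<^sub>R perturbed (real (\<phi> t)) k + D *\<^sub>R perturbed (real (\<phi> t)) l)" ..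
  have Z: "\<And>t. norm (Z t) = 1"
      and ZA: "\<And>t. \<exists>A B. 0 \<le> A \<and> 0 \<le> B \<and> Z t = A *\<^sub>R perturbed (real (\<phi> t)) i + B *\<^sub>R perturbed (real (\<phi> t)) j"
      and ZC: "\<And>t. \<exists>C D. 0 \<le> C \<and> 0 \<le> D \<and> Z t = C *\<^sub>R perturbed (real (\<phi> t)) k + D *\<^sub>R perturbed (real (\<phi> t)) l"
    using ZZ by auto
  obtain A B where A: "\<And>t. 0 \<le> A t" "\<And>t. 0 \<le> B t"
    "\<And>t. Z t = A t *\<^sub>R perturbed (real (\<phi> t)) i + B t *\<^sub>R perturbed (real (\<phi> t)) j"
    using choose_coefficients[of Z "\<lambda>t. perturbed (real (\<phi> t)) i" "\<lambda>t. perturbed (real (\<phi> t)) j", OF ZA] by blast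
  obtain C D where C: "\<And>t. 0 \<le> C t" "\<And>t. 0 \<le> D t"
    "\<And>t. Z t = C t *\<^sub>R perturbed (real (\<phi> t)) k + D t *\<^sub>R perturbed (real (\<phi> t)) l"
    using choose_coefficients[of Z "\<lambda>t. perturbed (real (\<phi> t)) k" "\<lambda>t. perturbed (real (\<phi> t)) l", OF ZC] by blast
  have "seq_compact (sphere (0 :: real ^ 3) 1)" by (simp add: compact_imp_seq_compact)
  moreover have "\<forall>t. Z t \<in> sphere 0 1" using Z by simp
  ultimately obtain z \<psi> where \<psi>: "strict_mono \<psi>" "(Z \<circ> \<psi>) \<longlonglongrightarrow> z" by (meson seq_compactE)
  have lim: "filterlim (\<lambda>t. real (\<phi> (\<psi> t))) at_top sequentially"
    using filterlim_subseq[OF strict_mono_o[OF \<phi>(1) \<psi>(1)]]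
    by (intro filterlim_compose[OF filterlim_real_sequentially]) (simp add: o_def)
  have lim': "(\<lambda>t. Z (\<psi> t)) \<longlonglongrightarrow> z" using \<psi>(2) by (simp add: o_def)
  have "z \<in> a {i, j}"
    by (rule perturbed_cone_limit[where A = "\<lambda>t. A (\<psi> t)" and B = "\<lambda>t. B (\<psi> t)",
          OF V(1,2,5) lim _ A(1,2,3) Z lim']) (use \<phi>(3) in auto)
  moreover have "z \<in> a {k, l}"
    by (rule perturbed_cone_limit[where A = "\<lambda>t. C (\<psi> t)" and B = "\<lambda>t. D (\<psi> t)",
          OF V(3,4,6) lim _ C(1,2,3) Z lim']) (use \<phi>(3) in auto)
  ultimately show False using disj by blast
qed

lemma perturbed_generic:
  shows "i \<in> V \<Longrightarrow> eventually (\<lambda>m. perturbed (real m) i $ 2 \<noteq> 0) sequentially"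
    and "i \<noteq> j \<Longrightarrow> eventually (\<lambda>m. perturbed (real m) i $ 1 * perturbed (real m) j $ 2
        \<noteq> perturbed (real m) j $ 1 * perturbed (real m) i $ 2) sequentially"
    and "\<lbrakk>i \<noteq> j; j \<noteq> k; i \<noteq> k\<rbrakk> \<Longrightarrow>
      eventually (\<lambda>m. det3 (perturbed (real m) i) (perturbed (real m) j) (perturbed (real m) k) \<noteq> 0) sequentially"
proof -
  define B where "B i c = [:moment i $ c, push i $ c, p i $ c:]" for i c
  have B: "poly (B i c) \<delta> = perturbed \<delta> i $ c" for i c \<delta>
    by (simp add: B_def perturbed_def power2_eq_square algebra_simps)
  have p0: "perturbed 0 i = moment i" for i by (simp add: perturbed_def)
  show "eventually (\<lambda>m. perturbed (real m) i $ 2 \<noteq> 0) sequentially"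
    using poly_eventually_nonzero[of "B i 2"] by (simp add: B p0)
  show "i \<noteq> j \<Longrightarrow> eventually (\<lambda>m. perturbed (real m) i $ 1 * perturbed (real m) j $ 2
        \<noteq> perturbed (real m) j $ 1 * perturbed (real m) i $ 2) sequentially"
    using poly_eventually_nonzero[of "B i 1 * B j 2 - B j 1 * B i 2"] by (simp add: B p0)
  let ?D = "B i 1 * (B j 2 * B k 3 - B k 2 * B j 3) - B i 2 * (B j 1 * B k 3 - B k 1 * B j 3)
    + B i 3 * (B j 1 * B k 2 - B k 1 * B j 2)"
  have "poly ?D \<delta> = det3 (perturbed \<delta> i) (perturbed \<delta> j) (perturbed \<delta> k)" for \<delta>
    by (simp add: B det3_def)
  note D = this
  show "\<lbrakk>i \<noteq> j; j \<noteq> k; i \<noteq> k\<rbrakk> \<Longrightarrow>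
      eventually (\<lambda>m. det3 (perturbed (real m) i) (perturbed (real m) j) (perturbed (real m) k) \<noteq> 0) sequentially"
    using poly_eventually_nonzero[of ?D] det3_moment[of i j k] unfolding D p0 by blast
qed

lemma meeting_arcs_count:
  assumes card: "card V = 2 * q"
  shows "sum4 V (\<lambda>i j k l. of_bool (distinct [i, j, k, l] \<and> a {i, j} \<inter> a {k, l} \<noteq> {}))
    \<ge> real (card V) ^ 4 / 8 - 10 * real (card V) ^ 3"
proof -
  let ?s = "\<lambda>m i j k. sgn (det3 (perturbed (real m) i) (perturbed (real m) j) (perturbed (real m) k))"
  have "eventually (\<lambda>m. \<forall>i\<in>V. perturbed (real m) i $ 2 \<noteq> 0) sequentially"
    using perturbed_generic(1) by (intro eventually_ball_finite finV) auto
  moreover have "eventually (\<lambda>m. \<forall>i\<in>V. \<forall>j\<in>V. i \<noteq> j \<longrightarrow> perturbed (real m) i $ 1 * perturbed (real m) j $ 2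
        \<noteq> perturbed (real m) j $ 1 * perturbed (real m) i $ 2) sequentially"
    using perturbed_generic(2) by (intro eventually_ball_finite finV ballI) (auto intro: eventually_mono)
  moreover have "eventually (\<lambda>m. \<forall>i\<in>V. \<forall>j\<in>V. \<forall>k\<in>V. i \<noteq> j \<longrightarrow> j \<noteq> k \<longrightarrow> i \<noteq> k \<longrightarrow>
      det3 (perturbed (real m) i) (perturbed (real m) j) (perturbed (real m) k) \<noteq> 0) sequentially"
    using perturbed_generic(3) by (intro eventually_ball_finite finV ballI) (auto intro: eventually_mono)
  moreover have "eventually (\<lambda>m. \<forall>i\<in>V. \<forall>j\<in>V. \<forall>k\<in>V. \<forall>l\<in>V. i \<noteq> j \<longrightarrow> k \<noteq> l \<longrightarrow> a {i, j} \<inter> a {k, l} = {} \<longrightarrow>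
      \<not> crossing_signs (?s m) i j k l) sequentially"
    using crossing_signs_eventually_meet by (intro eventually_ball_finite finV ballI) (auto intro: eventually_mono)
  ultimately have "\<exists>m. (\<forall>i\<in>V. perturbed (real m) i $ 2 \<noteq> 0)
      \<and> (\<forall>i\<in>V. \<forall>j\<in>V. i \<noteq> j \<longrightarrow> perturbed (real m) i $ 1 * perturbed (real m) j $ 2
        \<noteq> perturbed (real m) j $ 1 * perturbed (real m) i $ 2)
      \<and> (\<forall>i\<in>V. \<forall>j\<in>V. \<forall>k\<in>V. i \<noteq> j \<longrightarrow> j \<noteq> k \<longrightarrow> i \<noteq> k \<longrightarrow>
          det3 (perturbed (real m) i) (perturbed (real m) j) (perturbed (real m) k) \<noteq> 0)
      \<and> (\<forall>i\<in>V. \<forall>j\<in>V. \<forall>k\<in>V. \<forall>l\<in>V. i \<noteq> j \<longrightarrow> k \<noteq> l \<longrightarrow> a {i, j} \<inter> a {k, l} = {} \<longrightarrow>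
          \<not> crossing_signs (?s m) i j k l)"
    by (intro eventually_happens'[OF sequentially_bot] eventually_conj)
  then obtain m where M1: "\<forall>i\<in>V. perturbed (real m) i $ 2 \<noteq> 0"
    and M2: "\<forall>i\<in>V. \<forall>j\<in>V. i \<noteq> j \<longrightarrow> perturbed (real m) i $ 1 * perturbed (real m) j $ 2
        \<noteq> perturbed (real m) j $ 1 * perturbed (real m) i $ 2"
    and M3: "\<forall>i\<in>V. \<forall>j\<in>V. \<forall>k\<in>V. i \<noteq> j \<longrightarrow> j \<noteq> k \<longrightarrow> i \<noteq> k \<longrightarrow>
          det3 (perturbed (real m) i) (perturbed (real m) j) (perturbed (real m) k) \<noteq> 0"
    and M4: "\<forall>i\<in>V. \<forall>j\<in>V. \<forall>k\<in>V. \<forall>l\<in>V. i \<noteq> j \<longrightarrow> k \<noteq> l \<longrightarrow> a {i, j} \<inter> a {k, l} = {} \<longrightarrow>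
          \<not> crossing_signs (?s m) i j k l"
    by (elim exE conjE)
  note m = M1[rule_format] M2[rule_format] M3[rule_format] M4[rule_format]
  have "real (card V) ^ 4 / 8 - 10 * real (card V) ^ 3 \<le> sum4 V (\<lambda>i j k l. of_bool (crossing_signs (?s m) i j k l))"
    by (rule vectors_crossing_count[OF finV card m(1,2,3)])
  also have "\<dots> \<le> sum4 V (\<lambda>i j k l. of_bool (distinct [i, j, k, l] \<and> a {i, j} \<inter> a {k, l} \<noteq> {}))"
  proof (rule sum4_mono)
    fix i j k l assume V: "i \<in> V" "j \<in> V" "k \<in> V" "l \<in> V"
    have "distinct [i, j, k, l]" if "crossing_signs (?s m) i j k l"
    proof -
      have "det3 x x y = 0" "det3 x y x = 0" "det3 x y y = 0" for x y by (simp_all add: det3_def algebra_simps)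
      then show ?thesis using that unfolding crossing_signs_def by (auto simp: sgn_0_0)
    qed
    then show "of_bool (crossing_signs (?s m) i j k l) \<le> (of_bool (distinct [i, j, k, l] \<and> a {i, j} \<inter> a {k, l} \<noteq> {}) :: real)"
      using m(4)[OF V] by auto
  qed
  finally show ?thesis .
qed

text \<open>The factor 8 counts the ordered quadruples that describe one unordered pair of disjoint
  edges.\<close>

lemma crossings_lower_bound:
  assumes card: "card V = 2 * q"
  shows "8 * real (card (crossings {e. e \<subseteq> V \<and> card e = 2} p a)) \<ge> real (card V) ^ 4 / 8 - 10 * real (card V) ^ 3"
proof -
  let ?C = "crossings {e. e \<subseteq> V \<and> card e = 2} p a"
  define K where "K = {(i, j, k, l). i \<in> V \<and> j \<in> V \<and> k \<in> V \<and> l \<in> V \<and> distinct [i, j, k, l] \<and> a {i, j} \<inter> a {k, l} \<noteq> {}}"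
  define D where "D = (\<lambda>(i, j, k, l). {{i, j}, {k, l}}) ` K"
  have K: "K \<subseteq> V \<times> V \<times> V \<times> V" by (auto simp: K_def)
  then have finK: "finite K" using finV by (meson finite_SigmaI finite_subset)
  have finD: "finite D" using finK by (simp add: D_def)
  have "sum4 V (\<lambda>i j k l. of_bool (distinct [i, j, k, l] \<and> a {i, j} \<inter> a {k, l} \<noteq> {}))
      = (\<Sum>x\<in>V \<times> V \<times> V \<times> V. of_bool (x \<in> K))"
    unfolding sum4_def sum.cartesian_product by (intro sum.cong refl) (auto simp: K_def)
  also have "\<dots> = real (card K)" using K finV by (simp add: Int_absorb1)
  finally have cK: "sum4 V (\<lambda>i j k l. of_bool (distinct [i, j, k, l] \<and> a {i, j} \<inter> a {k, l} \<noteq> {})) = real (card K)" .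
  have "card K \<le> 8 * card D"
  proof -
    have fib: "finite {(i, j, k, l). {{i, j}, {k, l}} = d} \<and> card {(i, j, k, l). {{i, j}, {k, l}} = d} \<le> 8"
      if dD: "d \<in> D" for d
    proof -
      obtain x where "d = (\<lambda>(i, j, k, l). {{i, j}, {k, l}}) x" 
        using dD unfolding D_def by (rule imageE)
      then obtain i j k l where d: "d = {{i, j}, {k, l}}" by (cases x) auto
      let ?L = "[(i, j, k, l), (j, i, k, l), (i, j, l, k), (j, i, l, k), (k, l, i, j), (l, k, i, j), (k, l, j, i), (l, k, j, i)]"
      have "{(i, j, k, l). {{i, j}, {k, l}} = d} \<subseteq> set ?L"
        unfolding d by (auto simp: doubleton_eq_iff)
      moreover have "card (set ?L) \<le> 8" using card_length[of ?L] by simp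
      ultimately show ?thesis by (meson card_mono finite_set finite_subset order_trans)
    qed
    have "K \<subseteq> (\<Union>d\<in>D. {(i, j, k, l). {{i, j}, {k, l}} = d})" by (fastforce simp: D_def)
    then have "card K \<le> card (\<Union>d\<in>D. {(i, j, k, l). {{i, j}, {k, l}} = d})"
      using finD fib by (intro card_mono) auto
    also have "\<dots> \<le> (\<Sum>d\<in>D. card {(i, j, k, l). {{i, j}, {k, l}} = d})" using finD by (rule card_UN_le)
    also have "\<dots> \<le> (\<Sum>d\<in>D. 8)" using fib by (intro sum_mono) auto
    finally show ?thesis by simp
  qed
  moreover have "D \<subseteq> fst ` ?C"
  proof
    fix d assume "d \<in> D"
    then obtain x where x: "x \<in> K" "d = (\<lambda>(i, j, k, l). {{i, j}, {k, l}}) x" unfolding D_def by blast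
    obtain i j k l where "x = (i, j, k, l)" by (cases x)
    with x have d: "d = {{i, j}, {k, l}}" "i \<in> V" "j \<in> V" "k \<in> V" "l \<in> V" "distinct [i, j, k, l]"
      and ne: "a {i, j} \<inter> a {k, l} \<noteq> {}" by (auto simp: K_def)
    from ne obtain z where z: "z \<in> a {i, j}" "z \<in> a {k, l}" by blast
    \<comment> \<open>No vertex lies on an edge it does not belong to, so a common point of the arcs
      is interior to both.\<close>
    have "p i \<notin> a {k, l}" "p j \<notin> a {k, l}" "p k \<notin> a {i, j}" "p l \<notin> a {i, j}"
      using vertex_not_on_arc d by auto
    then have "z \<in> edge_interior p a {i, j} \<inter> edge_interior p a {k, l}" using z by (auto simp: edge_interior_def)
    moreover have "{i, j} \<noteq> {k, l}" using d by (auto simp: doubleton_eq_iff)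
    moreover have "{i, j} \<in> {e. e \<subseteq> V \<and> card e = 2}" "{k, l} \<in> {e. e \<subseteq> V \<and> card e = 2}" using d by auto
    ultimately have "(d, z) \<in> ?C" unfolding crossings_def d(1) by blast
    then show "d \<in> fst ` ?C" by force
  qed
  then have "card D \<le> card ?C"
    using crossings_bound(1) by (meson card_image_le card_mono finite_imageI order_trans)
  ultimately have "real (card K) \<le> 8 * real (card ?C)" by linarith
  then show ?thesis using meeting_arcs_count[OF card] cK by simp
qed

end

section \<open>The limit\<close>

text \<open>An edge is an unordered pair, so one arc has to serve both orders of its ends.\<close>

lemma min_geodesic_arc_commute:
  assumes "min_geodesic_arc x y A" shows "min_geodesic_arc y x A"
proof -
  define \<theta> where "\<theta> = sphere_dist x y"
  have sym: "sphere_dist y x = \<theta>" by (simp add: \<theta>_def sphere_dist_def inner_commute)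
  obtain g where g: "g 0 = x" "g \<theta> = y" "g ` {0..\<theta>} \<subseteq> sphere 0 1"
    "\<forall>s\<in>{0..\<theta>}. \<forall>t\<in>{0..\<theta>}. sphere_dist (g s) (g t) = \<bar>s - t\<bar>" "A = g ` {0..\<theta>}"
    using assms unfolding min_geodesic_arc_def \<theta>_def by blast
  have im: "(\<lambda>s. g (\<theta> - s)) ` {0..\<theta>} = g ` {0..\<theta>}"
  proof -
    have "(\<lambda>s. \<theta> - s) ` {0..\<theta>} = {0..\<theta>}" by simp
    then show ?thesis by (metis image_image)
  qed
  show ?thesis unfolding min_geodesic_arc_def sym
  proof (intro exI[of _ "\<lambda>s. g (\<theta> - s)"] conjI ballI)
    fix s t assume "s \<in> {0..\<theta>}" "t \<in> {0..\<theta>}"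
    then have "sphere_dist (g (\<theta> - s)) (g (\<theta> - t)) = \<bar>(\<theta> - s) - (\<theta> - t)\<bar>" using g(4) by auto
    then show "sphere_dist (g (\<theta> - s)) (g (\<theta> - t)) = \<bar>s - t\<bar>" by (simp add: abs_minus_commute)
  qed (use g im in auto)
qed

lemma min_geodesic_arc_between:
  assumes x: "norm x = 1" and y: "norm y = 1" and ne: "x \<noteq> y" "x \<noteq> - y"
  shows "\<exists>A. min_geodesic_arc x y A"
proof -
  define \<theta> where "\<theta> = sphere_dist x y"
  have c: "cos \<theta> = x \<bullet> y" and b: "0 \<le> \<theta>" "\<theta> \<le> pi"
    using cos_sphere_dist[OF x y] sphere_dist_bounds[OF x y] by (auto simp: \<theta>_def)
  have "\<theta> \<noteq> 0" using c sphere_unit_eq[OF x y] ne by auto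
  moreover have "\<theta> \<noteq> pi"
  proof
    assume "\<theta> = pi"
    then have "x \<bullet> (- y) = 1" using c by simp
    then show False using sphere_unit_eq[of x "- y"] x y ne by auto
  qed
  ultimately have s: "sin \<theta> > 0" using b by (intro sin_gt_zero) auto
  define w where "w = (1 / sin \<theta>) *\<^sub>R (y - cos \<theta> *\<^sub>R x)"
  have yw: "y = cos \<theta> *\<^sub>R x + sin \<theta> *\<^sub>R w" using s by (simp add: w_def)
  have xx: "x \<bullet> x = 1" "y \<bullet> y = 1" using x y by (simp_all add: dot_square_norm)
  have xw: "x \<bullet> w = 0" using xx c by (simp add: w_def inner_diff_right)
  have "w \<bullet> w = (1 / sin \<theta>)\<^sup>2 * (1 - (cos \<theta>)\<^sup>2)"
    using xx c by (simp add: w_def inner_diff_right inner_diff_left inner_commute[of y x] power2_eq_square algebra_simps)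
  also have "\<dots> = 1" using s by (simp add: power_divide sin_squared_eq[symmetric])
  finally have "norm w = 1" by (simp add: norm_eq_1)
  then show ?thesis using min_geodesic_arc_exists[OF x _ xw b] yw by metis
qed

lemma det3_plane: "det3 x (c *\<^sub>R x + d *\<^sub>R w) (c' *\<^sub>R x + d' *\<^sub>R w) = 0"
  unfolding det3_def by (simp add: algebra_simps)

text \<open>Without a drawing the \<open>LEAST\<close> in the crossing number would be unspecified.
  Normalised moment points work: no two are equal or antipodal, and no three lie on a great
  circle.\<close>

lemma complete_drawing_exists:
  "\<exists>p a. spherical_geodesic_drawing {..<n} (complete_edges n) p a"
proof -
  define p where "p i = (1 / norm (moment i)) *\<^sub>R moment i" for i
  have m0: "norm (moment i) > 0" for i
  proof -
    have "moment i $ 1 \<noteq> 0" by simp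
    then have "moment i \<noteq> 0" by (metis zero_index)
    then show ?thesis by simp
  qed
  have np: "norm (p i) = 1" for i using m0[of i] by (simp add: p_def)
  have dp: "det3 (p i) (p j) (p k) \<noteq> 0" if "i \<noteq> j" "j \<noteq> k" "i \<noteq> k" for i j k
  proof -
    have "det3 (p i) (p j) (p k) = det3 (moment i) (moment j) (moment k) / (norm (moment i) * norm (moment j) * norm (moment k))"
      unfolding det3_def p_def using m0 by (simp add: field_simps)
    then show ?thesis using det3_moment[OF that] m0 by simp
  qed
  have ne: "p i \<noteq> c *\<^sub>R p j" if "i \<noteq> j" for i j c
  proof
    assume eq: "p i = c *\<^sub>R p j"
    obtain k where "k \<noteq> i" "k \<noteq> j" using that by (metis lessI less_SucI less_irrefl_nat max.strict_coboundedI1 max.strict_coboundedI2)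
    moreover have "det3 (p j) (p i) (p k) = 0" unfolding eq det3_def by (simp add: algebra_simps)
    ultimately show False using dp[of j i k] that by auto
  qed
  define a where "a e = (SOME A. \<exists>u v. e = {u, v} \<and> min_geodesic_arc (p u) (p v) A)" for e
  have arc: "min_geodesic_arc (p u) (p v) (a {u, v})" if "u \<noteq> v" for u v
  proof -
    have "p u \<noteq> p v" "p u \<noteq> - p v" using ne[OF that, of 1] ne[OF that, of "- 1"] by auto
    then have "\<exists>A. \<exists>u' v'. {u, v} = {u', v'} \<and> min_geodesic_arc (p u') (p v') A"
      using min_geodesic_arc_between[OF np np] by blast
    from someI_ex[OF this] obtain u' v' where "{u, v} = {u', v'}" "min_geodesic_arc (p u') (p v') (a {u, v})"
      unfolding a_def by blast
    then show ?thesis using min_geodesic_arc_commute by (auto simp: doubleton_eq_iff)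
  qed
  have off: "p w \<notin> a {u, v}" if "u \<noteq> v" "w \<noteq> u" "w \<noteq> v" for u v w
  proof
    assume pw: "p w \<in> a {u, v}"
    have "p u \<noteq> p v" using ne[OF that(1), of 1] by auto
    from min_geodesic_arc_circle[OF arc[OF that(1)] np np this]
    obtain t \<theta> where t: "p v = cos \<theta> *\<^sub>R p u + sin \<theta> *\<^sub>R t" "a {u, v} = circle_arc (p u) t \<theta>" by metis
    then obtain s where "p w = cos s *\<^sub>R p u + sin s *\<^sub>R t" using pw by (auto simp: circle_arc_def)
    then have "det3 (p u) (p v) (p w) = 0" unfolding t(1) by (simp only: det3_plane)
    then show False using dp[of u v w] that by auto
  qed
  have "spherical_geodesic_drawing {..<n} (complete_edges n) p a"
    unfolding spherical_geodesic_drawing_def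
  proof (intro conjI allI impI ballI)
    show "p ` {..<n} \<subseteq> sphere 0 1" using np by auto
    show "inj_on p {..<n}"
    proof (rule inj_onI, rule ccontr)
      fix i j assume "p i = p j" "i \<noteq> j"
      then show False using ne[of i j 1] by simp
    qed
  next
    fix u v assume "{u, v} \<in> complete_edges n"
    then have "u \<noteq> v" by (auto simp: complete_edges_def)
    then show "min_geodesic_arc (p u) (p v) (a {u, v})" by (rule arc)
  next
    fix e w assume e: "e \<in> complete_edges n" and w: "w \<in> {..<n} - e"
    obtain u v where "e = {u, v}" "u \<noteq> v" using e by (auto simp: complete_edges_def card_2_iff)
    then show "p w \<notin> a e" using off w by auto
  qed
  then show ?thesis by blast
qed

lemma optimal_drawing:
  obtains p a where "complete_nat_drawing {..<n} p a" "cr_S2_K n = card (crossings (complete_edges n) p a)"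
proof -
  have "\<exists>k p a. spherical_geodesic_drawing {..<n} (complete_edges n) p a \<and> k = card (crossings (complete_edges n) p a)"
    using complete_drawing_exists[of n] by blast
  from LeastI_ex[OF this] obtain p a where pa: "spherical_geodesic_drawing {..<n} (complete_edges n) p a"
    "cr_S2_K n = card (crossings (complete_edges n) p a)"
    unfolding cr_S2_K_def spherical_geodesic_crossing_number_def by blast
  have "complete_nat_drawing {..<n} p a"
    by unfold_locales (use pa(1) in \<open>simp_all add: complete_edges_def\<close>)
  then show thesis using that pa(2) by blast
qed

lemma cr_S2_K_le:
  assumes "spherical_geodesic_drawing {..<n} (complete_edges n) p a"
  shows "cr_S2_K n \<le> card (crossings (complete_edges n) p a)"
  unfolding cr_S2_K_def spherical_geodesic_crossing_number_def by (rule Least_le) (use assms in blast)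

lemma cr_S2_K_upper: "real (cr_S2_K n) \<le> 2 * real n ^ 4"
proof -
  obtain p a where pa: "complete_nat_drawing {..<n} p a" "cr_S2_K n = card (crossings (complete_edges n) p a)"
    by (rule optimal_drawing)
  interpret complete_nat_drawing "{..<n}" p a by (rule pa(1))
  have "card (complete_edges n) = n choose 2"
    using n_subsets[of "{..<n}" 2] by (simp add: complete_edges_def)
  also have "\<dots> \<le> n * n" by (simp add: choose_two) (metis diff_le_self div_le_dividend le_trans mult_le_mono2)
  finally have "card (complete_edges n) * card (complete_edges n) \<le> (n * n) * (n * n)" by (intro mult_mono) auto
  then have "cr_S2_K n \<le> 2 * n ^ 4"
    using crossings_bound(2) pa(2) by (simp add: complete_edges_def power4_eq_xxxx)
  then show ?thesis by (metis of_nat_le_iff of_nat_mult of_nat_numeral of_nat_power)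
qed

lemma cr_S2_K_lower: "real (cr_S2_K (2 * q)) \<ge> real (2 * q) ^ 4 / 64 - 5 / 4 * real (2 * q) ^ 3"
proof -
  obtain p a where pa: "complete_nat_drawing {..<2 * q} p a" "cr_S2_K (2 * q) = card (crossings (complete_edges (2 * q)) p a)"
    by (rule optimal_drawing)
  show ?thesis
    using complete_nat_drawing.crossings_lower_bound[OF pa(1), of q] pa(2) by (simp add: complete_edges_def)
qed

section \<open>Deleting a vertex\<close>

lemma cr_S2_K_delete_vertex:
  assumes D: "complete_nat_drawing {..<Suc n} p a" and v: "v < Suc n"
  shows "cr_S2_K n \<le> card {c \<in> crossings (complete_edges (Suc n)) p a. v \<notin> \<Union> (fst c)}"
proof -
  interpret complete_nat_drawing "{..<Suc n}" p a by (rule D)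
  define h where "h i = (if i < v then i else Suc i)" for i
  have inj: "inj h" by (auto simp: inj_def h_def split: if_splits)
  have hv: "h i \<noteq> v" for i by (simp add: h_def)
  have hn: "h i < Suc n" if "i < n" for i using that by (simp add: h_def)
  have hsub: "h ` e \<subseteq> {..<Suc n}" if "e \<subseteq> {..<n}" for e using that hn by (fastforce)
  have he: "h ` e \<in> complete_edges (Suc n)" if "e \<in> complete_edges n" for e
    using that hsub card_image[OF inj_on_subset[OF inj subset_UNIV, of e]] by (auto simp: complete_edges_def)
  have dr: "spherical_geodesic_drawing {..<Suc n} (complete_edges (Suc n)) p a"
    using drawing by (simp add: complete_edges_def)
  define p' where "p' i = p (h i)" for i
  define a' where "a' e = a (h ` e)" for e
  have d': "spherical_geodesic_drawing {..<n} (complete_edges n) p' a'"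
    unfolding spherical_geodesic_drawing_def
  proof (intro conjI allI impI ballI)
    show "p' ` {..<n} \<subseteq> sphere 0 1" using norm_p hn by (auto simp: p'_def)
    show "inj_on p' {..<n}"
    proof (rule inj_onI)
      fix i j assume "i \<in> {..<n}" "j \<in> {..<n}" "p' i = p' j"
      then have "h i = h j" using inj_p[of "h i" "h j"] hn by (auto simp: p'_def)
      then show "i = j" using inj by (simp add: inj_eq)
    qed
  next
    fix i j assume "{i, j} \<in> complete_edges n"
    then have "h ` {i, j} \<in> complete_edges (Suc n)" by (rule he)
    then show "min_geodesic_arc (p' i) (p' j) (a' {i, j})"
      using dr unfolding spherical_geodesic_drawing_def p'_def a'_def by simp
  next
    fix e w assume e: "e \<in> complete_edges n" and w: "w \<in> {..<n} - e"
    have "h w \<in> {..<Suc n} - h ` e" using w hn inj by (auto simp: inj_eq)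
    then show "p' w \<notin> a' e"
      using dr he[OF e] unfolding spherical_geodesic_drawing_def p'_def a'_def by blast
  qed
  have ei: "edge_interior p' a' e = edge_interior p a (h ` e)" for e
    by (simp add: edge_interior_def p'_def a'_def image_image)
  define F :: "nat set set \<times> (real ^ 3) \<Rightarrow> nat set set \<times> (real ^ 3)" where "F = map_prod ((`) ((`) h)) id"
  have "inj ((`) h)" using inj by (simp add: inj_image_eq_iff inj_def)
  then have "inj ((`) ((`) h))" by (metis inj_def inj_image_eq_iff)
  then have injF: "inj F" unfolding F_def by (intro prod.inj_map inj_on_id)
  have sub: "F ` crossings (complete_edges n) p' a' \<subseteq> {c \<in> crossings (complete_edges (Suc n)) p a. v \<notin> \<Union> (fst c)}"
  proof
    fix c assume "c \<in> F ` crossings (complete_edges n) p' a'"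
    then obtain e f x where c: "c = F ({e, f}, x)" "e \<in> complete_edges n" "f \<in> complete_edges n" "e \<noteq> f"
      "x \<in> edge_interior p' a' e \<inter> edge_interior p' a' f"
      unfolding crossings_def by blast
    have c': "c = ({h ` e, h ` f}, x)" using c by (simp add: F_def)
    have "h ` e \<noteq> h ` f" using c(4) inj by (simp add: inj_image_eq_iff)
    then have "c \<in> crossings (complete_edges (Suc n)) p a"
      unfolding crossings_def c' using he[OF c(2)] he[OF c(3)] c(5) unfolding ei by blast
    moreover have "v \<notin> \<Union> (fst c)" using hv by (auto simp: c')
    ultimately show "c \<in> {c \<in> crossings (complete_edges (Suc n)) p a. v \<notin> \<Union> (fst c)}" by blast
  qed
  have "cr_S2_K n \<le> card (crossings (complete_edges n) p' a')" by (rule cr_S2_K_le[OF d'])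
  also have "\<dots> = card (F ` crossings (complete_edges n) p' a')"
    using injF by (metis card_image inj_on_subset subset_UNIV)
  also have "\<dots> \<le> card {c \<in> crossings (complete_edges (Suc n)) p a. v \<notin> \<Union> (fst c)}"
    using sub crossings_bound(1) by (intro card_mono) (auto simp: complete_edges_def)
  finally show ?thesis .
qed

lemma card_filter_sum: "finite A \<Longrightarrow> card {x \<in> A. Q x} = (\<Sum>x\<in>A. of_bool (Q x))"
  by (simp add: Int_def)

text \<open>Double counting in an optimal drawing: every deletion leaves a drawing of the smaller
  complete graph, and every crossing, having four vertices, survives all but four of the
  deletions.\<close>

lemma cr_S2_K_step: "Suc n * cr_S2_K n \<le> (Suc n - 4) * cr_S2_K (Suc n)"
proof -
  obtain p a where pa: "complete_nat_drawing {..<Suc n} p a"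
    "cr_S2_K (Suc n) = card (crossings (complete_edges (Suc n)) p a)"
    by (rule optimal_drawing)
  interpret complete_nat_drawing "{..<Suc n}" p a by (rule pa(1))
  let ?C = "crossings (complete_edges (Suc n)) p a"
  have finC: "finite ?C" using crossings_bound(1) by (simp add: complete_edges_def)
  have "Suc n * cr_S2_K n = (\<Sum>v<Suc n. cr_S2_K n)" by simp
  also have "\<dots> \<le> (\<Sum>v<Suc n. card {c \<in> ?C. v \<notin> \<Union> (fst c)})"
    using cr_S2_K_delete_vertex[OF pa(1)] by (intro sum_mono) auto
  also have "\<dots> = (\<Sum>v<Suc n. \<Sum>c\<in>?C. of_bool (v \<notin> \<Union> (fst c)))"
    by (simp only: card_filter_sum[OF finC])
  also have "\<dots> = (\<Sum>c\<in>?C. \<Sum>v<Suc n. of_bool (v \<notin> \<Union> (fst c)))" by (rule sum.swap)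
  also have "\<dots> = (\<Sum>c\<in>?C. Suc n - 4)"
  proof (rule sum.cong[OF refl])
    fix c assume "c \<in> ?C"
    then obtain e f x where c: "c = ({e, f}, x)" "e \<in> complete_edges (Suc n)" "f \<in> complete_edges (Suc n)" "e \<noteq> f"
      "x \<in> edge_interior p a e" "x \<in> edge_interior p a f"
      unfolding crossings_def by blast
    have ef: "e \<subseteq> {..<Suc n}" "card e = 2" "f \<subseteq> {..<Suc n}" "card f = 2" using c by (auto simp: complete_edges_def)
    have "e \<inter> f = {}" using crossing_edges_disjoint[OF ef c(4-6)] .
    then have "card (e \<union> f) = 4" using ef by (subst card_Un_disjoint) (auto intro: finite_subset)
    moreover have "{v \<in> {..<Suc n}. v \<notin> \<Union> (fst c)} = {..<Suc n} - (e \<union> f)" by (auto simp: c)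
    ultimately have "card {v \<in> {..<Suc n}. v \<notin> \<Union> (fst c)} = Suc n - 4"
      using ef by (simp add: card_Diff_subset finite_subset)
    then show "(\<Sum>v<Suc n. of_bool (v \<notin> \<Union> (fst c))) = Suc n - 4"
      by (simp only: card_filter_sum[OF finite_lessThan])
  qed
  also have "\<dots> = (Suc n - 4) * cr_S2_K (Suc n)" using pa(2) by simp
  finally show ?thesis .
qed

section \<open>Asymptotics\<close>

lemma falling4_ratio: "(\<lambda>n. real n * (real n - 1) * (real n - 2) * (real n - 3) / real n ^ 4) \<longlonglongrightarrow> 1"
proof -
  have one: "(\<lambda>n. (real n - c) / real n) \<longlonglongrightarrow> 1" for c
  proof -
    have "(\<lambda>n. 1 - c * inverse (real n)) \<longlonglongrightarrow> 1 - c * 0"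
      by (intro tendsto_intros LIMSEQ_inverse_real_of_nat lim_inverse_n)
    moreover have "eventually (\<lambda>n. 1 - c * inverse (real n) = (real n - c) / real n) sequentially"
      using eventually_gt_at_top[of 0] by eventually_elim (simp add: field_simps)
    ultimately show ?thesis by (simp add: tendsto_cong)
  qed
  have "(\<lambda>n. (real n - 0) / real n * ((real n - 1) / real n) * ((real n - 2) / real n) * ((real n - 3) / real n)) \<longlonglongrightarrow> 1 * 1 * 1 * 1"
    by (intro tendsto_mult one)
  then show ?thesis by (simp only: times_divide_times_eq power4_eq_xxxx diff_0_right mult_1)
qed

lemma hill_ratio: "(\<lambda>n. hill n / real n ^ 4) \<longlonglongrightarrow> 1 / 64"
proof -
  have half: "(\<lambda>n. real_of_int \<lfloor>(real n - c) / 2\<rfloor> / real n) \<longlonglongrightarrow> 1 / 2" for c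
  proof (rule tendsto_sandwich)
    have lin: "(\<lambda>n. ((real n - d) / 2) / real n) \<longlonglongrightarrow> 1 / 2" for d
    proof -
      have "(\<lambda>n. 1 / 2 - d / 2 * inverse (real n)) \<longlonglongrightarrow> 1 / 2 - d / 2 * 0"
        by (intro tendsto_intros lim_inverse_n)
      moreover have "eventually (\<lambda>n. 1 / 2 - d / 2 * inverse (real n) = ((real n - d) / 2) / real n) sequentially"
        using eventually_gt_at_top[of 0] by eventually_elim (simp add: field_simps)
      ultimately show ?thesis by (simp add: tendsto_cong)
    qed
    show "(\<lambda>n. ((real n - (c + 2)) / 2) / real n) \<longlonglongrightarrow> 1 / 2" by (rule lin)
    show "(\<lambda>n. ((real n - c) / 2) / real n) \<longlonglongrightarrow> 1 / 2" by (rule lin)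
    show "\<forall>\<^sub>F n in sequentially. ((real n - (c + 2)) / 2) / real n \<le> real_of_int \<lfloor>(real n - c) / 2\<rfloor> / real n"
    proof (intro always_eventually allI divide_right_mono)
      fix n show "(real n - (c + 2)) / 2 \<le> real_of_int \<lfloor>(real n - c) / 2\<rfloor>" 
        using real_of_int_floor_gt_diff_one[of "(real n - c) / 2"] by (simp add: field_simps)
    qed simp
    show "\<forall>\<^sub>F n in sequentially. real_of_int \<lfloor>(real n - c) / 2\<rfloor> / real n \<le> ((real n - c) / 2) / real n"
      by (intro always_eventually allI divide_right_mono of_int_floor_le) simp
  qed
  have "(\<lambda>n. real_of_int \<lfloor>(real n - 0) / 2\<rfloor> / real n * (real_of_int \<lfloor>(real n - 1) / 2\<rfloor> / real n)
      * (real_of_int \<lfloor>(real n - 2) / 2\<rfloor> / real n) * (real_of_int \<lfloor>(real n - 3) / 2\<rfloor> / real n))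
      \<longlonglongrightarrow> 1 / 2 * (1 / 2) * (1 / 2) * (1 / 2)"
    by (intro tendsto_mult half)
  then have "(\<lambda>n. real_of_int \<lfloor>real n / 2\<rfloor> * real_of_int \<lfloor>(real n - 1) / 2\<rfloor>
      * real_of_int \<lfloor>(real n - 2) / 2\<rfloor> * real_of_int \<lfloor>(real n - 3) / 2\<rfloor> / real n ^ 4)
      \<longlonglongrightarrow> 1 / 2 * (1 / 2) * (1 / 2) * (1 / 2)"
    by (simp only: times_divide_times_eq power4_eq_xxxx diff_0_right)
  from tendsto_mult[OF tendsto_const[of "1 / 4"] this] show ?thesis by (simp add: hill_def mult.assoc)
qed

theorem theorem2:
  shows "\<exists>L :: real. (\<lambda>n. real (cr_S2_K n) / hill n) \<longlonglongrightarrow> L \<and> L > 0.99635588"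
proof -
  define g where "g n = real n * (real n - 1) * (real n - 2) * (real n - 3)" for n :: nat
  \<comment> \<open>With this normalisation \<open>cr_S2_K_step\<close> becomes
    monotonicity.\<close>
  define b where "b n = real (cr_S2_K n) / g n" for n
  have g_pos: "g n > 0" if "n \<ge> 4" for n using that by (simp add: g_def)
  have step: "b n \<le> b (Suc n)" if "n \<ge> 4" for n
  proof -
    have "real (Suc n * cr_S2_K n) \<le> real ((Suc n - 4) * cr_S2_K (Suc n))"
      using cr_S2_K_step[of n] of_nat_le_iff by blast
    then have "real (Suc n) * real (cr_S2_K n) \<le> (real n - 3) * real (cr_S2_K (Suc n))"
      using that by (simp add: of_nat_diff algebra_simps)
    moreover have "g (Suc n) * (real n - 3) = real (Suc n) * g n" by (simp add: g_def algebra_simps)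
    ultimately have "(real (cr_S2_K n) * g (Suc n)) * (real n - 3) \<le> (real (cr_S2_K (Suc n)) * g n) * (real n - 3)"
      using mult_right_mono[of _ _ "g n"] g_pos[OF that] by (smt (verit) mult.assoc mult.commute)
    then have "real (cr_S2_K n) * g (Suc n) \<le> real (cr_S2_K (Suc n)) * g n"
      using that by (simp add: mult_le_cancel_right)
    then show ?thesis using g_pos[OF that] g_pos[of "Suc n"] that by (simp add: b_def frac_le_eq divide_le_eq field_simps)
  qed
  \<comment> \<open>The shift by 8 serves the monotonicity and also makes every factor of
    \<open>g\<close> at least half of its argument; then \<open>g\<close> is at least a sixteenth of
    the fourth power, whence the bound 32.\<close>
  have "incseq (\<lambda>n. b (n + 8))" by (rule incseq_SucI) (unfold add_Suc, rule step, simp)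
  moreover have "b (n + 8) \<le> 32" for n
  proof -
    let ?m = "real (n + 8)"
    have "?m / 2 * (?m / 2) * (?m / 2) * (?m / 2) \<le> g (n + 8)"
      unfolding g_def by (intro mult_mono) auto
    then have "2 * ?m ^ 4 \<le> 32 * g (n + 8)" by (simp add: power4_eq_xxxx)
    then have "real (cr_S2_K (n + 8)) \<le> 32 * g (n + 8)" using cr_S2_K_upper[of "n + 8"] by linarith
    then show ?thesis using g_pos[of "n + 8"] by (simp add: b_def divide_le_eq)
  qed
  ultimately obtain l where l8: "(\<lambda>n. b (n + 8)) \<longlonglongrightarrow> l" using incseq_convergent[of "\<lambda>n. b (n + 8)"] by metis
  then have l: "b \<longlonglongrightarrow> l" by (rule LIMSEQ_offset)
  have "(\<lambda>n. b n * (g n / real n ^ 4) / (hill n / real n ^ 4)) \<longlonglongrightarrow> l * 1 / (1 / 64)"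
    unfolding g_def by (intro tendsto_divide tendsto_mult l falling4_ratio hill_ratio) simp
  moreover have "eventually (\<lambda>n. b n * (g n / real n ^ 4) / (hill n / real n ^ 4) = real (cr_S2_K n) / hill n) sequentially"
    using eventually_ge_at_top[of 4]
  proof eventually_elim
    case (elim n)
    then show ?case using g_pos[OF elim] by (simp add: b_def)
  qed
  ultimately have "(\<lambda>n. real (cr_S2_K n) / hill n) \<longlonglongrightarrow> l * 1 / (1 / 64)"
    by (rule Lim_transform_eventually)
  then have lim: "(\<lambda>n. real (cr_S2_K n) / hill n) \<longlonglongrightarrow> 64 * l" by (simp add: mult.commute)
  \<comment> \<open>As \<open>b\<close> converges, its limit can be bounded along even numbers,
    where the halving plane is available.\<close>
  have "1 / 64 \<le> l"
  proof (rule LIMSEQ_le)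
    have sub: "strict_mono (\<lambda>q. 2 * q :: nat)" by (simp add: strict_mono_def)
    have l2: "(\<lambda>q. b (2 * q)) \<longlonglongrightarrow> l" using LIMSEQ_subseq_LIMSEQ[OF l sub] by (simp add: o_def)
    have f2: "(\<lambda>q. g (2 * q) / real (2 * q) ^ 4) \<longlonglongrightarrow> 1"
      using LIMSEQ_subseq_LIMSEQ[OF falling4_ratio sub] by (simp add: o_def g_def)
    show "(\<lambda>q. b (2 * q) * (g (2 * q) / real (2 * q) ^ 4)) \<longlonglongrightarrow> l"
      using tendsto_mult[OF l2 f2] by simp
    show "(\<lambda>q. 1 / 64 - 5 / 4 * inverse (real (2 * q))) \<longlonglongrightarrow> 1 / 64"
    proof -
      have "(\<lambda>q. inverse (real (2 * q))) \<longlonglongrightarrow> 0"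
        using LIMSEQ_subseq_LIMSEQ[OF lim_inverse_n sub] by (simp add: o_def)
      from tendsto_diff[OF tendsto_const[of "1 / 64"] tendsto_mult[OF tendsto_const[of "5 / 4"] this]]
      show ?thesis by (simp only: mult_zero_right diff_0_right)
    qed
    show "\<exists>N. \<forall>q\<ge>N. 1 / 64 - 5 / 4 * inverse (real (2 * q)) \<le> b (2 * q) * (g (2 * q) / real (2 * q) ^ 4)"
    proof (intro exI[of _ 2] allI impI)
      fix q :: nat assume q: "q \<ge> 2"
      let ?n = "real (2 * q)"
      have n: "?n > 0" using q by simp
      have e1: "b (2 * q) * (g (2 * q) / ?n ^ 4) = real (cr_S2_K (2 * q)) / ?n ^ 4"
        using g_pos[of "2 * q"] q by (simp add: b_def)
      have e2: "(?n ^ 4 / 64 - 5 / 4 * ?n ^ 3) / ?n ^ 4 \<le> real (cr_S2_K (2 * q)) / ?n ^ 4"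
        using cr_S2_K_lower[of q] by (intro divide_right_mono) auto
      have e3: "(?n ^ 4 / 64 - 5 / 4 * ?n ^ 3) / ?n ^ 4 = 1 / 64 - 5 / 4 * inverse ?n"
        using n by (simp add: field_simps power4_eq_xxxx power3_eq_cube)
      show "1 / 64 - 5 / 4 * inverse ?n \<le> b (2 * q) * (g (2 * q) / ?n ^ 4)"
        using e2 unfolding e1 e3 .
    qed
  qed
  then have "64 * l > 0.99635588" by simp
  then show ?thesis using lim by blast
qed

end
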